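(* Let $\delta\in(0,1]$, $\mathcal{S}=\mathbb{T}\times(-1,0)$, $\Gamma=\mathbb{T}\times\{0\}$, $\Gamma_{\rm b}=\mathbb{T}\times\{-1\}$. Let $s_0\ge1$, $\lambda\ge0$ and ${\bf g}=(g_1,g_2)\in\mathcal{A}^{s_0,1}_\lambda$. Then there exists a unique solution $\varphi$ of $$\begin{cases}\Delta_\delta\varphi=\nabla_\delta\cdot{\bf g} & \text{in }\mathcal{S},\\ \varphi=0 & \text{on }\Gamma,\\ \partial_2\varphi=0 & \text{on }\Gamma_{\rm b},\end{cases}$$ and this solution satisfies, for every $s\ge0$, $$\|\nabla_\delta\varphi\|_{\mathcal{A}^{s,1}_\lambda}\le13\,\|{\bf g}\|_{\mathcal{A}^{s,1}_\lambda}.$$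
   Context: $\mathbb{T}=\mathbb{R}/2\pi\mathbb{Z}$. $\nabla_\delta v=(\sqrt\delta\,\partial_1v,\partial_2v)$, $\nabla_\delta\cdot V=\sqrt\delta\,\partial_1V^1+\partial_2V^2$, $\Delta_\delta v=\delta\partial_1^2v+\partial_2^2v$. For a function $v$ on $\mathcal{S}$, $\hat v(n,x_2)$ is the $n$-th Fourier coefficient in $x_1$, $\hat v(n,x_2)=\frac1{2\pi}\int_{\mathbb{T}}v(x_1,x_2)e^{-inx_1}dx_1$. For $s,\lambda\ge0$, $k\in\mathbb{N}$, set $$\|v\|_{\mathcal{A}^{s,k}_\lambda}=\sum_{n\in\mathbb{Z}}(1+|n|)^se^{\lambda|n|}\int_{-1}^0|\partial_2^k\hat v(n,x_2)|\,dx_2,$$ and let the Wiener–Sobolev space $\mathcal{A}^{s,k}_\lambda=\mathcal{A}^{s,k}_\lambda(\mathcal{S})$ be the closure, with respect to this norm, of the space of smooth functions compactly supported in $\mathbb{T}\times(-1,0]$ (so elements of $\mathcal{A}^{s,1}_\lambda$ vanish at $x_2=-1$). For vector fields, membership is componentwise and the norm is the sum of the norms of the components. In the estimate, $\|\nabla_\delta\varphi\|_{\mathcal{A}^{s,1}_\lambda}$ denotes the quantity given by the formula above, and the right-hand side may be $+\infty$ when $s>s_0$. *)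

theory Defs
  imports "HOL-Analysis.Analysis"
begin

(* Functions on the torus T = R / 2 pi Z times an x2-interval are represented by functions of
   (x1, x2) on R x R that are 2 pi-periodic in x1; only the values with x2 in [-1, 0] matter,
   and integrals over the strip are taken over one period cell. *)

definition periodic1 :: "(real \<times> real \<Rightarrow> 'a) \<Rightarrow> bool" where
  "periodic1 v \<longleftrightarrow> (\<forall>x1 x2. v (x1 + 2 * pi, x2) = v (x1, x2))"

definition cstrip :: "(real \<times> real) set" where
  "cstrip = UNIV \<times> {-1..0}"

definition cell :: "(real \<times> real) set" where
  "cell = {0..2 * pi} \<times> {-1..0}"


section \<open>Smooth functions and weak derivatives\<close>

primrec C_class :: "nat \<Rightarrow> ('a::real_normed_vector \<Rightarrow> real) \<Rightarrow> bool" where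
  "C_class 0 f \<longleftrightarrow> continuous_on UNIV f"
| "C_class (Suc k) f \<longleftrightarrow>
     (\<forall>x. f differentiable (at x)) \<and> (\<forall>h. C_class k (\<lambda>x. frechet_derivative f (at x) h))"

definition smooth :: "('a::real_normed_vector \<Rightarrow> real) \<Rightarrow> bool" where
  "smooth f \<longleftrightarrow> (\<forall>k. C_class k f)"

definition test_interval :: "(real \<Rightarrow> real) \<Rightarrow> bool" where
  "test_interval \<psi> \<longleftrightarrow>
     smooth \<psi> \<and> (\<exists>a b. -1 < a \<and> b < 0 \<and> (\<forall>y. y \<notin> {a..b} \<longrightarrow> \<psi> y = 0))"

(* w is the k-th weak derivative of u on (-1, 0), both being integrable there. *)
definition weak_deriv :: "nat \<Rightarrow> (real \<Rightarrow> complex) \<Rightarrow> (real \<Rightarrow> complex) \<Rightarrow> bool" where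
  "weak_deriv k u w \<longleftrightarrow>
     set_integrable lborel {-1<..<0} u \<and> set_integrable lborel {-1<..<0} w \<and>
     (\<forall>\<psi>. test_interval \<psi> \<longrightarrow>
        (LINT y:{-1<..<0}|lborel. (deriv ^^ k) \<psi> y *\<^sub>R u y) =
        (-1) ^ k * (LINT y:{-1<..<0}|lborel. \<psi> y *\<^sub>R w y))"

(* The integral of |d^k u / dx2^k| over (-1, 0).  Weak derivatives are unique almost everywhere,
   so the infimum is over a single value; it is infinite if u has no integrable k-th weak
   derivative. *)
definition deriv_L1 :: "nat \<Rightarrow> (real \<Rightarrow> complex) \<Rightarrow> ennreal" where
  "deriv_L1 k u =
     (INF w\<in>{w. weak_deriv k u w}. \<integral>\<^sup>+y\<in>{-1<..<0}. ennreal (cmod (w y)) \<partial>lborel)"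


section \<open>Wiener--Sobolev spaces\<close>

definition fourier1 :: "(real \<times> real \<Rightarrow> real) \<Rightarrow> int \<Rightarrow> real \<Rightarrow> complex" where
  "fourier1 v n x2 =
     (1 / (2 * pi)) *\<^sub>R
       (LINT x1:{0..2 * pi}|lborel. complex_of_real (v (x1, x2)) * cis (- (of_int n * x1)))"

definition ws_norm :: "real \<Rightarrow> nat \<Rightarrow> real \<Rightarrow> (real \<times> real \<Rightarrow> real) \<Rightarrow> ennreal" where
  "ws_norm s k lam v =
     (\<Sum>\<^sub>\<infinity>n::int. ennreal ((1 + real_of_int \<bar>n\<bar>) powr s * exp (lam * real_of_int \<bar>n\<bar>))
        * deriv_L1 k (fourier1 v n))"

definition ws_norm_vec ::
  "real \<Rightarrow> nat \<Rightarrow> real \<Rightarrow> (real \<times> real \<Rightarrow> real \<times> real) \<Rightarrow> ennreal" where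
  "ws_norm_vec s k lam V = ws_norm s k lam (fst \<circ> V) + ws_norm s k lam (snd \<circ> V)"

(* Smooth functions with compact support in T x (-1, 0]: smooth up to x2 = 0, i.e. restrictions
   of smooth functions on the plane, with no condition at x2 = 0. *)
definition test_halfopen :: "(real \<times> real \<Rightarrow> real) \<Rightarrow> bool" where
  "test_halfopen v \<longleftrightarrow>
     smooth v \<and> periodic1 v \<and> (\<exists>a>-1. \<forall>x1 x2. x2 \<le> a \<longrightarrow> v (x1, x2) = 0)"

(* The closure of the test functions, realised inside L^1 of the strip.  For k > 0 the formula
   for ws_norm is only a seminorm on L^1 (it does not see functions of x1 alone), so closing up in
   the seminorm alone would lose the vanishing at x2 = -1.  On test functions ws_norm dominates
   the L^1 norm, so asking for convergence in L^1 as well yields exactly the completion. *)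
definition ws_space :: "real \<Rightarrow> nat \<Rightarrow> real \<Rightarrow> (real \<times> real \<Rightarrow> real) set" where
  "ws_space s k lam =
     {v. periodic1 v \<and> set_integrable lborel cell v \<and>
         (\<exists>w. (\<forall>j::nat. test_halfopen (w j)) \<and>
              (\<lambda>j. ws_norm s k lam (\<lambda>x. w j x - v x)) \<longlonglongrightarrow> 0 \<and>
              (\<lambda>j. LINT x:cell|lborel. \<bar>w j x - v x\<bar>) \<longlonglongrightarrow> 0)}"

definition ws_space_vec :: "real \<Rightarrow> nat \<Rightarrow> real \<Rightarrow> (real \<times> real \<Rightarrow> real \<times> real) set" where
  "ws_space_vec s k lam = {V. fst \<circ> V \<in> ws_space s k lam \<and> snd \<circ> V \<in> ws_space s k lam}"


section \<open>The boundary value problem\<close>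

definition pd1 :: "(real \<times> real \<Rightarrow> real) \<Rightarrow> real \<times> real \<Rightarrow> real" where
  "pd1 v x = vector_derivative (\<lambda>t. v (t, snd x)) (at (fst x))"

(* One-sided at x2 = 0 and x2 = -1. *)
definition pd2 :: "(real \<times> real \<Rightarrow> real) \<Rightarrow> real \<times> real \<Rightarrow> real" where
  "pd2 v x = vector_derivative (\<lambda>t. v (fst x, t)) (at (snd x) within {-1..0})"

definition grad\<delta> :: "real \<Rightarrow> (real \<times> real \<Rightarrow> real) \<Rightarrow> real \<times> real \<Rightarrow> real \<times> real" where
  "grad\<delta> \<delta> v x = (sqrt \<delta> * pd1 v x, pd2 v x)"

definition laplace\<delta> :: "real \<Rightarrow> (real \<times> real \<Rightarrow> real) \<Rightarrow> real \<times> real \<Rightarrow> real" where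
  "laplace\<delta> \<delta> v x = \<delta> * pd1 (pd1 v) x + pd2 (pd2 v) x"

definition C1_closed_strip :: "(real \<times> real \<Rightarrow> real) \<Rightarrow> bool" where
  "C1_closed_strip v \<longleftrightarrow>
     v differentiable_on cstrip \<and> continuous_on cstrip (pd1 v) \<and> continuous_on cstrip (pd2 v)"

definition test_strip :: "(real \<times> real \<Rightarrow> real) \<Rightarrow> bool" where
  "test_strip \<psi> \<longleftrightarrow>
     smooth \<psi> \<and> periodic1 \<psi> \<and>
     (\<exists>a b. -1 < a \<and> b < 0 \<and> (\<forall>x1 x2. x2 \<notin> {a..b} \<longrightarrow> \<psi> (x1, x2) = 0))"

(* The divergence of g involves an x2-derivative that is merely integrable, so the equation in
   the open strip is understood in the sense of distributions; the solution is C^1 up to the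
   boundary, so that both boundary conditions hold pointwise. *)
definition bvp_solution ::
  "real \<Rightarrow> (real \<times> real \<Rightarrow> real \<times> real) \<Rightarrow> (real \<times> real \<Rightarrow> real) \<Rightarrow> bool" where
  "bvp_solution \<delta> g \<phi> \<longleftrightarrow>
     periodic1 \<phi> \<and> C1_closed_strip \<phi> \<and>
     (\<forall>\<psi>. test_strip \<psi> \<longrightarrow>
        (LINT x:cell|lborel. \<phi> x * laplace\<delta> \<delta> \<psi> x) =
        - (LINT x:cell|lborel. g x \<bullet> grad\<delta> \<delta> \<psi> x)) \<and>
     (\<forall>x1. \<phi> (x1, 0) = 0) \<and>
     (\<forall>x1. pd2 \<phi> (x1, -1) = 0)"

end

(* The problem decouples into Fourier modes in x1.  With m = sqrt(delta) n, the n-th mode solves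
   phi'' - m^2 phi = i m g1 + g2' on (-1,0) with phi(0) = phi'(-1) = 0.  Writing k = |m| and
   sigma = sgn m, the combinations phi' + k phi + i sigma g1 and phi' - k phi - i sigma g1 satisfy
   first order equations whose right-hand sides g2' +- i sigma g1' contain only x2-derivatives of
   the data and no power of m; here g(-1) = 0 is used.  Exponential decay bounds k times their
   L^1 norms by the data, which gives |m phi'|_1 + |phi''|_1 <= 12 (|g1'|_1 + |g2'|_1) for each
   mode with a constant independent of n and delta, hence the estimate for every weight (s, lambda)
   at once and absolute convergence of the Fourier series of phi in C^1.

   For lambda > 0 an element of the space may have infinite norm, because smooth test functions
   need not have exponentially decaying Fourier coefficients.  Existence therefore only uses
   summability of the modes with s = lambda = 0, which always holds.

   Uniqueness: testing with trigonometric polynomials times functions of x2 shows that each mode of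
   the difference of two solutions solves the homogeneous problem, hence vanishes. *)

theory Submission
  imports Defs "HOL-Library.Nat_Bijection"
begin

section \<open>Smooth functions\<close>

text \<open>The constant 12 comes from one 2 x 2 system. The combination \<open>p\<close> (with + k)
  is integrated from y = 0 and \<open>q\<close> (with - k) from y = -1, each in its direction of
  decay; the boundary conditions couple \<open>p 0\<close> and \<open>q (-1)\<close> through a
  matrix with determinant 1 + exp (- 2 k) up to sign. With N the sum of the L^1 norms of the
  derivatives of the data, this gives |p 0| <= 4 N and |q (-1)| <= 5 N, then k |p|_1 <= 5 N and k
  |q|_1 <= 6 N, so that the two terms of the gradient cost 11/2 N and 11/2 N + N. Three obstacles
  shape the rest. A mode of an element of the space is fixed only almost everywhere in x2, so it is
  replaced by an absolutely continuous representative, whose value at x2 = -1 is controlled by L^1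
  norms of the approximation error and of its derivative. Mode solutions are picked separately for n
  and -n, so they must be symmetrised before a real series has them as coefficients. And the
  distributional equation must be read off from the modes, which a Parseval identity between an
  integrable and a smooth function does.\<close>

lemma C_class_SucI:
  assumes "\<And>x. (f has_derivative f' x) (at x)" "\<And>h. C_class k (\<lambda>x. f' x h)"
  shows "C_class (Suc k) f"
proof -
  have "frechet_derivative f (at x) = f' x" for x
    using frechet_derivative_at[OF assms(1)] by metis
  then show ?thesis
    using assms by (auto simp: differentiable_def)
qed

text \<open>\<open>C_class\<close> is stated with \<open>frechet_derivative\<close>; together with
  the introduction rule above, this lets the inductions on k work with any explicit family of
  derivatives.\<close>

lemma C_class_SucE:
  assumes "C_class (Suc k) f"
  shows "\<exists>f'. (\<forall>x. (f has_derivative f' x) (at x)) \<and> (\<forall>h. C_class k (\<lambda>x. f' x h))"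
  using assms by (intro exI[of _ "\<lambda>x. frechet_derivative f (at x)"]) (auto simp flip: frechet_derivative_works)

lemma C_class_SucD: "C_class (Suc k) f \<Longrightarrow> C_class k f"
proof (induction k arbitrary: f)
  case 0
  then show ?case
    by (auto intro!: differentiable_imp_continuous_on simp: differentiable_on_def intro: differentiable_at_withinI)
next
  case (Suc k)
  from Suc.prems obtain f' where "\<And>x. (f has_derivative f' x) (at x)" "\<And>h. C_class (Suc k) (\<lambda>x. f' x h)"
    using C_class_SucE by blast
  with Suc.IH show ?case by (blast intro: C_class_SucI)
qed

lemma C_class_const: "C_class k (\<lambda>x. c)"
  by (induction k arbitrary: c)
    (auto intro: C_class_SucI[where f' = "\<lambda>x h. 0", OF has_derivative_const] continuous_on_const simp del: C_class.simps(2))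

lemma C_class_add: "C_class k f \<Longrightarrow> C_class k g \<Longrightarrow> C_class k (\<lambda>x. f x + g x)"
proof (induction k arbitrary: f g)
  case (Suc k)
  from Suc.prems obtain f' g' where
    "\<And>x. (f has_derivative f' x) (at x)" "\<And>h. C_class k (\<lambda>x. f' x h)"
    "\<And>x. (g has_derivative g' x) (at x)" "\<And>h. C_class k (\<lambda>x. g' x h)"
    using C_class_SucE[OF Suc.prems(1)] C_class_SucE[OF Suc.prems(2)] by blast
  with Suc.IH show ?case
    by (intro C_class_SucI[where f' = "\<lambda>x h. f' x h + g' x h"]) (auto intro: has_derivative_add)
qed (auto intro: continuous_on_add)

lemma C_class_mult: "C_class k f \<Longrightarrow> C_class k g \<Longrightarrow> C_class k (\<lambda>x. f x * g x)"
proof (induction k arbitrary: f g)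
  case (Suc k)
  from Suc.prems obtain f' g' where *:
    "\<And>x. (f has_derivative f' x) (at x)" "\<And>h. C_class k (\<lambda>x. f' x h)"
    "\<And>x. (g has_derivative g' x) (at x)" "\<And>h. C_class k (\<lambda>x. g' x h)"
    using C_class_SucE[OF Suc.prems(1)] C_class_SucE[OF Suc.prems(2)] by blast
  show ?case
  proof (rule C_class_SucI)
    show "((\<lambda>x. f x * g x) has_derivative (\<lambda>h. f x * g' x h + f' x h * g x)) (at x)" for x
      by (intro has_derivative_mult *)
    show "C_class k (\<lambda>x. f x * g' x h + f' x h * g x)" for h
      by (intro C_class_add Suc.IH * C_class_SucD[OF Suc.prems(1)] C_class_SucD[OF Suc.prems(2)])
  qed
qed (auto intro: continuous_on_mult)

lemma C_class_compose_linear: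
  assumes "bounded_linear L"
  shows "C_class k f \<Longrightarrow> C_class k (\<lambda>x. f (L x))"
proof (induction k arbitrary: f)
  case 0
  have "continuous_on UNIV L"
    using assms by (simp add: linear_continuous_on)
  with 0 show ?case
    using continuous_on_compose2 by fastforce
next
  case (Suc k)
  from Suc.prems obtain f' where *:
    "\<And>x. (f has_derivative f' x) (at x)" "\<And>h. C_class k (\<lambda>x. f' x h)"
    using C_class_SucE by blast
  show ?case
  proof (rule C_class_SucI)
    show "((\<lambda>x. f (L x)) has_derivative (\<lambda>h. f' (L x) (L h))) (at x)" for x
      using has_derivative_compose[OF bounded_linear_imp_has_derivative[OF assms] *(1)] .
    show "C_class k (\<lambda>x. f' (L x) (L h))" for h
      by (intro Suc.IH *)
  qed
qed

lemma C_class_Suc_realI: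
  assumes "\<And>y::real. (f has_real_derivative f' y) (at y)" "C_class k f'"
  shows "C_class (Suc k) f"
  using assms by (intro C_class_SucI[where f' = "\<lambda>y h. f' y * h"])
    (auto simp: has_field_derivative_def intro: C_class_mult C_class_const)

lemma smooth_const: "smooth (\<lambda>x. c)"
  by (auto simp: smooth_def C_class_const)

lemma smooth_add: "smooth f \<Longrightarrow> smooth g \<Longrightarrow> smooth (\<lambda>x. f x + g x)"
  by (auto simp: smooth_def C_class_add)

lemma smooth_mult: "smooth f \<Longrightarrow> smooth g \<Longrightarrow> smooth (\<lambda>x. f x * g x)"
  by (auto simp: smooth_def C_class_mult)

lemma smooth_compose_linear: "bounded_linear L \<Longrightarrow> smooth f \<Longrightarrow> smooth (\<lambda>x. f (L x))"
  by (auto simp: smooth_def C_class_compose_linear)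

lemma smooth_compose_add: 
  assumes "smooth f" shows "smooth (\<lambda>x. f (x + c))"
proof -
  have "C_class k f \<Longrightarrow> C_class k (\<lambda>x. f (x + c))" for k
  proof (induction k arbitrary: f)
    case 0
    then show ?case
      by (auto intro!: continuous_on_compose2[of UNIV f UNIV "\<lambda>x. x + c"] continuous_intros)
  next
    case (Suc k)
    from Suc.prems obtain f' where *:
      "\<And>x. (f has_derivative f' x) (at x)" "\<And>h. C_class k (\<lambda>x. f' x h)"
      using C_class_SucE by blast
    have "((\<lambda>x. f (x + c)) has_derivative (\<lambda>h. f' (x + c) h)) (at x)" for x
    proof -
      have "((\<lambda>x. x + c) has_derivative (\<lambda>h. h)) (at x)"
        by (auto intro!: derivative_eq_intros)
      from has_derivative_compose[OF this *(1)] show ?thesis .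
    qed
    then show ?case
      by (rule C_class_SucI) (intro Suc.IH *)
  qed
  then show ?thesis using assms by (auto simp: smooth_def)
qed

lemma smooth_continuous: "smooth f \<Longrightarrow> continuous_on S f"
  by (metis C_class.simps(1) continuous_on_subset smooth_def subset_UNIV)

lemma smooth_has_derivative:
  "smooth f \<Longrightarrow> (f has_derivative frechet_derivative f (at x)) (at x)"
  by (metis C_class.simps(2) frechet_derivative_works smooth_def)

lemma smooth_frechet: "smooth f \<Longrightarrow> smooth (\<lambda>x. frechet_derivative f (at x) h)"
  by (metis C_class.simps(2) smooth_def)

lemma smooth_has_real_derivative:
  fixes f :: "real \<Rightarrow> real"
  shows "smooth f \<Longrightarrow> (f has_real_derivative deriv f y) (at y)"
  by (metis C_class.simps(2) DERIV_deriv_iff_real_differentiable smooth_def)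

lemma smooth_deriv:
  fixes f :: "real \<Rightarrow> real"
  assumes "smooth f" shows "smooth (deriv f)"
proof -
  have "frechet_derivative f (at y) 1 = deriv f y" for y
    using frechet_derivative_at[OF smooth_has_real_derivative[OF assms, unfolded has_field_derivative_def]]
    by (metis mult.right_neutral)
  then show ?thesis using smooth_frechet[OF assms, of 1] by simp
qed

lemma smooth_primitive:
  assumes "\<And>y::real. (f has_real_derivative f' y) (at y)" "smooth f'"
  shows "smooth f"
  unfolding smooth_def using assms C_class_Suc_realI C_class_SucD smooth_def by metis

text \<open>Both coefficients are kept general because differentiation maps this two-parameter
  family into itself, which closes the induction.\<close>

lemma smooth_sin_cos: "smooth (\<lambda>y::real. a * sin (n * y) + b * cos (n * y))"
proof -
  have "C_class k (\<lambda>y::real. a * sin (n * y) + b * cos (n * y))" for k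
  proof (induction k arbitrary: a b)
    case 0
    then show ?case by (auto intro!: continuous_intros)
  next
    case (Suc k)
    show ?case
      by (rule C_class_Suc_realI[where f' = "\<lambda>y. (- (b * n)) * sin (n * y) + (a * n) * cos (n * y)", OF _ Suc])
        (auto intro!: derivative_eq_intros simp: algebra_simps)
  qed
  then show ?thesis by (simp add: smooth_def)
qed

section \<open>Bump functions built from exp (- 1 / x)\<close>

text \<open>The factor \<^term>\<open>poly p (1 / x)\<close> makes this family of functions closed under differentiation.\<close>

definition flat_poly :: "real poly \<Rightarrow> real \<Rightarrow> real" where
  "flat_poly p x = (if x > 0 then poly p (1 / x) * exp (- (1 / x)) else 0)"

text \<open>With t = 1 / x this is the decay of a polynomial times exp (- t) at infinity.\<close>

lemma flat_poly_tendsto_0: "(flat_poly p \<longlongrightarrow> 0) (at_right 0)"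
proof -
  have 1: "((\<lambda>x. poly p x * exp (- x)) \<longlongrightarrow> 0) at_top"
  proof -
    have "((\<lambda>x. \<Sum>i\<le>degree p. coeff p i * (x ^ i / exp x)) \<longlongrightarrow> (\<Sum>i\<le>degree p. coeff p i * 0)) at_top"
      by (intro tendsto_sum tendsto_mult tendsto_const) (rule tendsto_power_div_exp_0)
    then show ?thesis
      by (simp add: poly_altdef sum_distrib_right exp_minus divide_inverse mult.assoc)
  qed
  have "filterlim (\<lambda>x::real. 1 / x) at_top (at_right 0)"
    using filterlim_inverse_at_top_right by (simp add: inverse_eq_divide)
  from filterlim_compose[OF 1 this]
  have "((\<lambda>x. poly p (1 / x) * exp (- (1 / x))) \<longlongrightarrow> 0) (at_right 0)" by simp
  then show ?thesis
    by (rule Lim_transform_eventually) (auto simp: flat_poly_def eventually_at_right_field intro: exI[of _ 1])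
qed

text \<open>For t = 1 / x one has dt/dx = - t^2, so p(t) exp (- t) has derivative t^2 (p - p')(t)
  exp (- t); the factor \<open>[:0, 0, 1:]\<close> is t^2.\<close>

lemma has_real_derivative_flat_poly:
  "(flat_poly p has_real_derivative flat_poly ([:0, 0, 1:] * (p - pderiv p)) x) (at x)"
proof -
  consider "x > 0" | "x < 0" | "x = 0" by linarith
  then show ?thesis
  proof cases
    case 1
    have "((\<lambda>x. poly p (1 / x) * exp (- (1 / x))) has_real_derivative
        poly (pderiv p) (1 / x) * (- (1 / (x * x))) * exp (- (1 / x)) + exp (- (1 / x)) * (1 / (x * x)) * poly p (1 / x)) (at x)"
      using 1 by (auto intro!: derivative_eq_intros DERIV_chain2[OF poly_DERIV] simp: field_simps)
    then have "((\<lambda>x. poly p (1 / x) * exp (- (1 / x))) has_real_derivative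
       flat_poly ([:0, 0, 1:] * (p - pderiv p)) x) (at x)"
      using 1 by (auto simp: flat_poly_def field_simps)
    then show ?thesis
      by (rule has_field_derivative_transform_within_open[of _ _ _ "{0<..}"])
        (use 1 in \<open>auto simp: flat_poly_def\<close>)
  next
    case 2
    have "((\<lambda>x. 0) has_real_derivative flat_poly ([:0, 0, 1:] * (p - pderiv p)) x) (at x)"
      using 2 by (auto simp: flat_poly_def)
    then show ?thesis
      by (rule has_field_derivative_transform_within_open[of _ _ _ "{..<0}"])
        (use 2 in \<open>auto simp: flat_poly_def\<close>)
  next
    case 3
    have "((\<lambda>h. flat_poly p h / h) \<longlongrightarrow> 0) (at 0)"
    proof (subst filterlim_at_split, intro conjI)
      show "((\<lambda>h. flat_poly p h / h) \<longlongrightarrow> 0) (at_left 0)"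
        by (rule Lim_transform_eventually[OF tendsto_const])
          (auto simp: flat_poly_def eventually_at_left_field intro: exI[of _ "-1"])
      \<comment> \<open>Dividing by h multiplies by t = 1 / h, so the difference quotient is again a
        member of the family, for the polynomial t p(t).\<close>
      show "((\<lambda>h. flat_poly p h / h) \<longlongrightarrow> 0) (at_right 0)"
        by (rule Lim_transform_eventually[OF flat_poly_tendsto_0[of "[:0, 1:] * p"]])
          (auto simp: flat_poly_def eventually_at_right_field intro: exI[of _ 1])
    qed
    then show ?thesis
      using 3 by (simp add: DERIV_def flat_poly_def)
  qed
qed

lemma smooth_flat_poly: "smooth (flat_poly p)"
proof -
  have "C_class k (flat_poly p)" for k
  proof (induction k arbitrary: p)
    case 0
    have "isCont (flat_poly p) x" for x
      using DERIV_isCont[OF has_real_derivative_flat_poly] .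
    then show ?case by (simp add: continuous_at_imp_continuous_on)
  next
    case (Suc k)
    show ?case
      by (rule C_class_Suc_realI[OF has_real_derivative_flat_poly Suc])
  qed
  then show ?thesis by (simp add: smooth_def)
qed

text \<open>The factor k + 1 steepens both flanks: the support stays in [a, b] while the functions
  converge pointwise to the indicator of (a, b). Starting at k + 1 keeps the bump positive inside
  for k = 0 as well.\<close>

definition bump :: "real \<Rightarrow> real \<Rightarrow> nat \<Rightarrow> real \<Rightarrow> real" where
  "bump a b k y = flat_poly 1 (real (Suc k) * (y - a)) * flat_poly 1 (real (Suc k) * (b - y))"

lemma smooth_bump: "smooth (bump a b k)"
proof -
  have 1: "smooth (\<lambda>y. flat_poly 1 (real (Suc k) * (y - a)))"
    using smooth_compose_add[OF smooth_compose_linear[OF bounded_linear_mult_right[of "real (Suc k)"] smooth_flat_poly[of 1]], of "- a"]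
    by (simp only: add_uminus_conv_diff)
  have 2: "smooth (\<lambda>y. flat_poly 1 (real (Suc k) * (b - y)))"
    using smooth_compose_add[OF smooth_compose_linear[OF bounded_linear_mult_right[of "- real (Suc k)"] smooth_flat_poly[of 1]], of "- b"]
    by (simp add: algebra_simps)
  from smooth_mult[OF 1 2] show ?thesis
    by (simp add: bump_def[abs_def])
qed

lemma bump_eq_0: "y \<notin> {a<..<b} \<Longrightarrow> bump a b k y = 0"
  by (auto simp: bump_def flat_poly_def zero_less_mult_iff)

lemma bump_pos: "y \<in> {a<..<b} \<Longrightarrow> bump a b k y > 0"
  by (auto simp: bump_def flat_poly_def)

lemma flat_poly_1_bounds: "0 \<le> flat_poly 1 x" "flat_poly 1 x \<le> 1"
  by (auto simp: flat_poly_def)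

lemma bump_bounds: "0 \<le> bump a b k y" "bump a b k y \<le> 1"
  by (auto simp: bump_def flat_poly_1_bounds mult_le_one)

lemma bump_tendsto: "(\<lambda>k. bump a b k y) \<longlonglongrightarrow> indicator {a<..<b} y"
proof (cases "y \<in> {a<..<b}")
  case True
  have 1: "(\<lambda>k. flat_poly 1 (real (Suc k) * c)) \<longlonglongrightarrow> 1" if "c > 0" for c
  proof -
    have "(\<lambda>k. exp (- (1 / c * inverse (real (Suc k))))) \<longlonglongrightarrow> exp (- (1 / c * 0))"
      by (intro tendsto_exp tendsto_minus tendsto_mult tendsto_const LIMSEQ_inverse_real_of_nat)
    moreover have "flat_poly 1 (real (Suc k) * c) = exp (- (1 / c * inverse (real (Suc k))))" for k
      using that zero_less_mult_iff[of "real (Suc k)" c] by (simp add: flat_poly_def del: of_nat_Suc) (simp add: field_simps)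
    ultimately show ?thesis
      by (simp only: mult_zero_right minus_zero exp_zero)
  qed
  have "(\<lambda>k. bump a b k y) \<longlonglongrightarrow> 1 * 1"
    unfolding bump_def using True by (intro tendsto_mult 1) auto
  with True show ?thesis by simp
qed (simp add: bump_eq_0)

lemma test_interval_bump: "-1 < a \<Longrightarrow> b < 0 \<Longrightarrow> test_interval (bump a b k)"
  unfolding test_interval_def using smooth_bump bump_eq_0[of _ a b k]
  by (intro conjI exI[of _ a] exI[of _ b]) auto

section \<open>Absolutely continuous functions and weak derivatives\<close>

text \<open>Absolute continuity in integral form, with the derivative f carried as data, so that
  differentiation almost everywhere never enters.\<close>

definition abs_cont :: "(real \<Rightarrow> complex) \<Rightarrow> (real \<Rightarrow> complex) \<Rightarrow> bool" where
  "abs_cont F f \<longleftrightarrow> set_integrable lborel {-1..0} f \<and>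
     (\<forall>y\<in>{-1..0}. F y = F (-1) + (LINT t:{-1..y}|lborel. f t))"

text \<open>Weak derivatives live on the open interval and \<open>abs_cont\<close> on the closed
  one; the two endpoints form a null set.\<close>

lemma set_integrable_open_iff:
  fixes f :: "real \<Rightarrow> 'a::{banach,second_countable_topology}"
  shows "set_integrable lborel {-1<..<0} f \<longleftrightarrow> set_integrable lborel {-1..0} f"
  by (rule set_integrable_discrete_difference[where X = "{-1, 0}"]) auto

lemma set_integral_open_eq:
  fixes f :: "real \<Rightarrow> 'a::{banach,second_countable_topology}"
  shows "(LINT y:{-1<..<0}|lborel. f y) = (LINT y:{-1..0}|lborel. f y)"
  by (rule set_integral_discrete_difference[where X = "{-1, 0}"]) auto

lemma set_nn_integral_open_eq:
  "(\<integral>\<^sup>+y\<in>{-1<..<0}. ennreal (norm (f y)) \<partial>lborel) = ennreal (LINT y:{-1..0}|lborel. norm (f y))"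
  if "set_integrable lborel {-1..0} f" for f :: "real \<Rightarrow> 'a::{banach,second_countable_topology}"
proof -
  have "integrable lborel (\<lambda>y. indicator {-1<..<0} y *\<^sub>R norm (f y))"
    using set_integrable_norm[OF that[folded set_integrable_open_iff]] by (simp add: set_integrable_def)
  then have "(\<integral>\<^sup>+y. ennreal (indicator {-1<..<0} y *\<^sub>R norm (f y)) \<partial>lborel) =
      ennreal (LINT y|lborel. indicator {-1<..<0} y *\<^sub>R norm (f y))"
    by (intro nn_integral_eq_integral) auto
  moreover have "(\<integral>\<^sup>+y\<in>{-1<..<0}. ennreal (norm (f y)) \<partial>lborel) =
      (\<integral>\<^sup>+y. ennreal (indicator {-1<..<0} y *\<^sub>R norm (f y)) \<partial>lborel)"
    by (intro nn_integral_cong) (auto split: split_indicator)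
  ultimately show ?thesis
    using set_integral_open_eq[of "\<lambda>y. norm (f y)"] by (simp add: set_lebesgue_integral_def)
qed

lemma set_integrable_cmult_bounded:
  fixes f p :: "'a \<Rightarrow> complex"
  assumes "set_integrable M A f" "set_borel_measurable M A p" "\<And>x. x \<in> A \<Longrightarrow> cmod (p x) \<le> B"
  shows "set_integrable M A (\<lambda>x. p x * f x)"
  unfolding set_integrable_def
proof (rule Bochner_Integration.integrable_bound)
  show "integrable M (\<lambda>x. B *\<^sub>R (indicator A x *\<^sub>R f x))"
    by (rule integrable_scaleR_right) (use assms(1) in \<open>simp add: set_integrable_def\<close>)
  have "(\<lambda>x. (indicator A x *\<^sub>R p x) * (indicator A x *\<^sub>R f x)) \<in> borel_measurable M"
    using assms(1,2) unfolding set_integrable_def set_borel_measurable_def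
    by (intro borel_measurable_times) (simp_all add: borel_measurable_integrable)
  then show "(\<lambda>x. indicator A x *\<^sub>R (p x * f x)) \<in> borel_measurable M"
    by (rule measurable_cong[THEN iffD1, rotated]) (auto split: split_indicator)
  show "AE x in M. norm (indicator A x *\<^sub>R (p x * f x)) \<le> norm (B *\<^sub>R (indicator A x *\<^sub>R f x))"
    using assms(3) by (auto simp: norm_mult split: split_indicator intro!: AE_I2 mult_right_mono order_trans[OF _ abs_ge_self])
qed

lemma set_integrable_cmult_continuous:
  fixes f p :: "real \<Rightarrow> complex"
  assumes "set_integrable lborel {a..b} f" "continuous_on {a..b} p"
  shows "set_integrable lborel {a..b} (\<lambda>x. p x * f x)"
proof -
  have "bounded (p ` {a..b})"
    using assms(2) compact_Icc compact_continuous_image compact_imp_bounded by blast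
  then obtain B where "\<And>x. x \<in> {a..b} \<Longrightarrow> cmod (p x) \<le> B"
    by (meson bounded_iff imageI)
  then show ?thesis
    using assms by (intro set_integrable_cmult_bounded[of lborel _ f p B])
      (auto simp: set_borel_measurable_def intro!: borel_measurable_continuous_on_indicator)
qed

lemma abs_cont_integrable: "abs_cont F f \<Longrightarrow> set_integrable lborel {-1..0} f"
  by (simp add: abs_cont_def)

lemma abs_cont_LINT:
  "abs_cont F f \<Longrightarrow> y \<in> {-1..0} \<Longrightarrow> (LINT t:{-1..y}|lborel. f t) = F y - F (-1)"
  unfolding abs_cont_def by (metis add_diff_cancel_left')

lemma set_integrable_Icc_subset:
  fixes f :: "real \<Rightarrow> 'a::{banach,second_countable_topology}"
  shows "set_integrable lborel {-1..0} f \<Longrightarrow> y \<le> 0 \<Longrightarrow> set_integrable lborel {-1..y} f"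
  by (rule set_integrable_subset) auto

lemma abs_cont_integral:
  assumes "abs_cont F f" "y \<in> {-1..0}"
  shows "integral {-1..y} f = F y - F (-1)"
  using abs_cont_LINT[OF assms] assms(2)
    set_borel_integral_eq_integral(2)[OF set_integrable_Icc_subset[OF abs_cont_integrable[OF assms(1)]], of y]
  by simp

lemma abs_cont_continuous:
  assumes "abs_cont F f" shows "continuous_on {-1..0} F"
proof -
  have "f integrable_on {-1..0}"
    using assms set_borel_integral_eq_integral(1) by (auto simp: abs_cont_def)
  then have "continuous_on {-1..0} (\<lambda>y. F (-1) + integral {-1..y} f)"
    by (intro continuous_intros indefinite_integral_continuous_1)
  then show ?thesis
    by (rule continuous_on_eq) (simp add: abs_cont_integral[OF assms])
qed

lemma abs_cont_of_derivative:
  assumes "\<And>y. y \<in> {-1..0} \<Longrightarrow> (F has_vector_derivative f y) (at y within {-1..0})"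
    and "continuous_on {-1..0} f"
  shows "abs_cont F f"
  unfolding abs_cont_def
proof (intro conjI ballI)
  show "set_integrable lborel {-1..0} f"
    by (rule borel_integrable_atLeastAtMost') fact
  fix y :: real assume y: "y \<in> {-1..0}"
  have "(LINT t:{-1..y}|lborel. f t) = F y - F (-1)"
    unfolding set_lebesgue_integral_def
    using y by (intro integral_FTC_atLeastAtMost has_vector_derivative_within_subset[OF assms(1)]
        continuous_on_subset[OF assms(2)]) auto
  then show "F y = F (-1) + (LINT t:{-1..y}|lborel. f t)" by simp
qed

lemma abs_cont_derivative:
  assumes "abs_cont F f" "continuous_on {-1..0} f" "y \<in> {-1..0}"
  shows "(F has_vector_derivative f y) (at y within {-1..0})"
proof -
  have "((\<lambda>y. F (-1) + integral {-1..y} f) has_vector_derivative f y) (at y within {-1..0})"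
    using integral_has_vector_derivative[OF assms(2,3)]
    by (auto intro!: derivative_eq_intros)
  then show ?thesis
    by (rule has_vector_derivative_transform[OF assms(3), rotated]) (simp add: abs_cont_integral[OF assms(1)])
qed

lemma abs_cont_const: "abs_cont (\<lambda>y. c) (\<lambda>y. 0)"
  by (auto simp: abs_cont_def set_integrable_def)

lemma abs_contI:
  assumes "set_integrable lborel {-1..0} f"
    and "\<And>y. y \<in> {-1..0} \<Longrightarrow> (LINT t:{-1..y}|lborel. f t) = F y - F (-1)"
  shows "abs_cont F f"
  unfolding abs_cont_def using assms(1) by (intro conjI ballI) (simp_all only: assms(2), simp)

lemma abs_cont_add:
  assumes "abs_cont F f" "abs_cont G g"
  shows "abs_cont (\<lambda>y. F y + G y) (\<lambda>y. f y + g y)"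
proof (rule abs_contI)
  note f = abs_cont_integrable[OF assms(1)] and g = abs_cont_integrable[OF assms(2)]
  show "set_integrable lborel {-1..0} (\<lambda>y. f y + g y)"
    by (rule set_integral_add(1)[OF f g])
  fix y :: real assume y: "y \<in> {-1..0}"
  then have "(LINT t:{-1..y}|lborel. f t + g t) = (LINT t:{-1..y}|lborel. f t) + (LINT t:{-1..y}|lborel. g t)"
    by (intro set_integral_add(2)[OF set_integrable_Icc_subset[OF f] set_integrable_Icc_subset[OF g]]) auto
  then show "(LINT t:{-1..y}|lborel. f t + g t) = F y + G y - (F (-1) + G (-1))"
    by (simp add: abs_cont_LINT[OF assms(1) y] abs_cont_LINT[OF assms(2) y])
qed

lemma abs_cont_cmult:
  assumes "abs_cont F f" shows "abs_cont (\<lambda>y. c * F y) (\<lambda>y. c * f y)"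
  by (rule abs_contI)
    (simp_all add: abs_cont_integrable[OF assms] abs_cont_LINT[OF assms] right_diff_distrib)

lemma abs_cont_diff:
  "abs_cont F f \<Longrightarrow> abs_cont G g \<Longrightarrow> abs_cont (\<lambda>y. F y - G y) (\<lambda>y. f y - g y)"
  using abs_cont_add[OF _ abs_cont_cmult[where c = "-1"]] by fastforce

lemma abs_cont_cong:
  assumes "abs_cont F f" "\<And>y. y \<in> {-1..0} \<Longrightarrow> F y = G y" "\<And>y. y \<in> {-1..0} \<Longrightarrow> f y = g y"
  shows "abs_cont G g"
proof -
  have "(LINT t:{-1..y}|lborel. f t) = (LINT t:{-1..y}|lborel. g t)" if "y \<le> 0" for y
    using assms(3) that by (intro set_lebesgue_integral_cong) auto
  moreover have "set_integrable lborel {-1..0} f = set_integrable lborel {-1..0} g"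
    using assms(3) by (intro set_integrable_cong) auto
  ultimately show ?thesis
    using abs_cont_LINT[OF assms(1)] abs_cont_integrable[OF assms(1)]
    by (intro abs_contI) (auto simp flip: assms(2))
qed

text \<open>The product of the increments of E and F is the integral of e(s) f(t) over the square
  [-1, y]^2. Cutting the square along its diagonal and integrating over the bounded inner variable
  on each half produces the two terms of the product rule.\<close>

lemma abs_cont_mult:
  assumes "abs_cont E e" "abs_cont F f"
  shows "abs_cont (\<lambda>y. E y * F y) (\<lambda>y. e y * F y + E y * f y)"
  unfolding abs_cont_def
proof (intro conjI ballI)
  note e = abs_cont_integrable[OF assms(1)] and f = abs_cont_integrable[OF assms(2)]
  have eF: "set_integrable lborel {-1..0} (\<lambda>y. e y * F y)"
    using set_integrable_cmult_continuous[OF e abs_cont_continuous[OF assms(2)]] by (simp add: mult.commute)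
  have Ef: "set_integrable lborel {-1..0} (\<lambda>y. E y * f y)"
    using set_integrable_cmult_continuous[OF f abs_cont_continuous[OF assms(1)]] .
  show "set_integrable lborel {-1..0} (\<lambda>y. e y * F y + E y * f y)"
    using eF Ef by (rule set_integral_add)
  fix y :: real assume y: "y \<in> {-1..0}"
  define e' where "e' = (\<lambda>s. indicator {-1..y} s *\<^sub>R e s)"
  define f' where "f' = (\<lambda>s. indicator {-1..y} s *\<^sub>R f s)"
  have e': "integrable lborel e'" and f': "integrable lborel f'"
    using y e f set_integrable_Icc_subset by (auto simp: set_integrable_def e'_def f'_def)
  define K where "K = (\<lambda>(s, t). e' s * f' t)"
  have K: "integrable (lborel \<Otimes>\<^sub>M lborel) K"
  proof (rule lborel_pair.Fubini_integrable)
    show "K \<in> borel_measurable (lborel \<Otimes>\<^sub>M lborel)"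
      using e' f' by (auto simp: K_def)
    have "integrable lborel (\<lambda>x. cmod (e' x) * (LINT y|lborel. cmod (f' y)))"
      using e' by (intro integrable_mult_left) auto
    then show "integrable lborel (\<lambda>x. LINT y|lborel. norm (K (x, y)))"
      by (simp add: K_def norm_mult)
    show "AE x in lborel. integrable lborel (\<lambda>y. K (x, y))"
      using f' by (simp add: K_def)
  qed
  \<comment> \<open>The half-plane t <= s. On it t is the inner variable and reproduces F; on the
    complement s is the inner variable and reproduces E.\<close>
  define D where "D = {p. snd p \<le> (fst p::real)}"
  have D: "D \<in> sets (lborel \<Otimes>\<^sub>M lborel)"
  proof -
    have "closed D" unfolding D_def by (intro closed_Collect_le continuous_intros)
    then show ?thesis by (simp only: lborel_prod sets_lborel borel_closed)
  qed
  have D': "- D \<in> sets (lborel \<Otimes>\<^sub>M lborel)"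
    using D by (simp only: lborel_prod sets_lborel borel_comp)
  have K1: "integrable (lborel \<Otimes>\<^sub>M lborel) (\<lambda>p. indicator D p *\<^sub>R K p)"
    using K D by (rule integrable_mult_indicator[rotated])
  have K2: "integrable (lborel \<Otimes>\<^sub>M lborel) (\<lambda>p. indicator (- D) p *\<^sub>R K p)"
    using K D'  by (rule integrable_mult_indicator[rotated])
  have "integral\<^sup>L (lborel \<Otimes>\<^sub>M lborel) K =
      integral\<^sup>L (lborel \<Otimes>\<^sub>M lborel) (\<lambda>p. indicator D p *\<^sub>R K p + indicator (- D) p *\<^sub>R K p)"
    by (intro Bochner_Integration.integral_cong) (auto split: split_indicator)
  also have "\<dots> = integral\<^sup>L (lborel \<Otimes>\<^sub>M lborel) (\<lambda>p. indicator D p *\<^sub>R K p) +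
      integral\<^sup>L (lborel \<Otimes>\<^sub>M lborel) (\<lambda>p. indicator (- D) p *\<^sub>R K p)"
    using K1 K2 by simp
  also have "integral\<^sup>L (lborel \<Otimes>\<^sub>M lborel) (\<lambda>p. indicator D p *\<^sub>R K p) =
      (LINT s|lborel. LINT t|lborel. indicator D (s, t) *\<^sub>R K (s, t))"
    by (rule lborel_pair.integral_fst'[OF K1, symmetric])
  also have "\<dots> = (LINT s:{-1..y}|lborel. e s * (F s - F (-1)))"
    unfolding set_lebesgue_integral_def
  proof (intro Bochner_Integration.integral_cong refl)
    fix s :: real
    show "(LINT t|lborel. indicator D (s, t) *\<^sub>R K (s, t)) = indicator {-1..y} s *\<^sub>R (e s * (F s - F (-1)))"
    proof (cases "s \<in> {-1..y}")
      case True
      have "(LINT t|lborel. indicator D (s, t) *\<^sub>R K (s, t)) = (LINT t|lborel. e s * (indicator {-1..s} t *\<^sub>R f t))"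
        using True by (intro Bochner_Integration.integral_cong)
          (auto simp: K_def D_def e'_def f'_def split: split_indicator)
      also have "\<dots> = e s * (LINT t:{-1..s}|lborel. f t)"
        by (simp only: set_lebesgue_integral_def integral_mult_right_zero)
      also have "(LINT t:{-1..s}|lborel. f t) = F s - F (-1)"
        using True y by (intro abs_cont_LINT[OF assms(2)]) auto
      finally show ?thesis using True by simp
    qed (auto simp: K_def e'_def)
  qed
  also have "integral\<^sup>L (lborel \<Otimes>\<^sub>M lborel) (\<lambda>p. indicator (- D) p *\<^sub>R K p) =
      (LINT t|lborel. LINT s|lborel. indicator (- D) (s, t) *\<^sub>R K (s, t))"
    using lborel_pair.integral_snd[of "\<lambda>s t. indicator (- D) (s, t) *\<^sub>R K (s, t)"] K2
    by (simp add: case_prod_beta')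
  also have "\<dots> = (LINT t:{-1..y}|lborel. f t * (E t - E (-1)))"
    unfolding set_lebesgue_integral_def
  proof (intro Bochner_Integration.integral_cong refl)
    fix t :: real
    show "(LINT s|lborel. indicator (- D) (s, t) *\<^sub>R K (s, t)) = indicator {-1..y} t *\<^sub>R (f t * (E t - E (-1)))"
    proof (cases "t \<in> {-1..y}")
      case True
      have "(LINT s|lborel. indicator (- D) (s, t) *\<^sub>R K (s, t)) = (LINT s|lborel. f t * (indicator {-1..<t} s *\<^sub>R e s))"
        using True by (intro Bochner_Integration.integral_cong)
          (auto simp: K_def D_def e'_def f'_def split: split_indicator)
      also have "\<dots> = f t * (LINT s:{-1..<t}|lborel. e s)"
        by (simp only: set_lebesgue_integral_def integral_mult_right_zero)
      \<comment> \<open>The complement of the closed half-plane is s < t, so the inner interval is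
        half-open; the missing endpoint is null.\<close>
      also have "(LINT s:{-1..<t}|lborel. e s) = (LINT s:{-1..t}|lborel. e s)"
        by (rule set_integral_discrete_difference[where X = "{t}"]) auto
      also have "(LINT s:{-1..t}|lborel. e s) = E t - E (-1)"
        using True y by (intro abs_cont_LINT[OF assms(1)]) auto
      finally show ?thesis using True by simp
    qed (auto simp: K_def f'_def)
  qed
  finally have 1: "integral\<^sup>L (lborel \<Otimes>\<^sub>M lborel) K =
      (LINT s:{-1..y}|lborel. e s * (F s - F (-1))) + (LINT t:{-1..y}|lborel. f t * (E t - E (-1)))" .
  have "integral\<^sup>L (lborel \<Otimes>\<^sub>M lborel) K = (LINT s|lborel. LINT t|lborel. K (s, t))"
    by (rule lborel_pair.integral_fst'[OF K, symmetric])
  also have "\<dots> = (LINT s|lborel. e' s) * (LINT t|lborel. f' t)"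
    by (simp add: K_def)
  also have "\<dots> = (E y - E (-1)) * (F y - F (-1))"
    using abs_cont_LINT[OF assms(1) y] abs_cont_LINT[OF assms(2) y]
    by (simp add: e'_def f'_def set_lebesgue_integral_def)
  finally have 2: "integral\<^sup>L (lborel \<Otimes>\<^sub>M lborel) K = (E y - E (-1)) * (F y - F (-1))" .
  have e2: "set_integrable lborel {-1..y} e" and f2: "set_integrable lborel {-1..y} f"
    and eF2: "set_integrable lborel {-1..y} (\<lambda>s. e s * F s)" and Ef2: "set_integrable lborel {-1..y} (\<lambda>s. E s * f s)"
    using y e f eF Ef by (auto intro: set_integrable_Icc_subset)
  have 3: "(LINT s:{-1..y}|lborel. e s * (F s - F (-1))) = (LINT s:{-1..y}|lborel. e s * F s) - (E y - E (-1)) * F (-1)"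
    using e2 eF2 by (simp add: right_diff_distrib abs_cont_LINT[OF assms(1) y])
  have 4: "(LINT s:{-1..y}|lborel. f s * (E s - E (-1))) = (LINT s:{-1..y}|lborel. E s * f s) - (F y - F (-1)) * E (-1)"
    using f2 Ef2 by (simp add: right_diff_distrib left_diff_distrib abs_cont_LINT[OF assms(2) y] mult.commute)
  have 5: "(LINT s:{-1..y}|lborel. e s * F s + E s * f s) =
      (LINT s:{-1..y}|lborel. e s * F s) + (LINT s:{-1..y}|lborel. E s * f s)"
    using eF2 Ef2 by simp
  have "(E y - E (-1)) * (F y - F (-1)) =
      (LINT s:{-1..y}|lborel. e s * F s) - (E y - E (-1)) * F (-1) +
      ((LINT s:{-1..y}|lborel. E s * f s) - (F y - F (-1)) * E (-1))"
    using 1 2 unfolding 3 4 by simp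
  then show "E y * F y = E (-1) * F (-1) + (LINT s:{-1..y}|lborel. e s * F s + E s * f s)"
    unfolding 5 by algebra
qed

lemma abs_cont_of_real_smooth:
  assumes "smooth \<psi>" shows "abs_cont (\<lambda>y. of_real (\<psi> y)) (\<lambda>y. of_real (deriv \<psi> y))"
proof (rule abs_cont_of_derivative)
  show "continuous_on {-1..0} (\<lambda>y. complex_of_real (deriv \<psi> y))"
    by (intro continuous_intros smooth_continuous smooth_deriv assms)
  show "((\<lambda>y. complex_of_real (\<psi> y)) has_vector_derivative complex_of_real (deriv \<psi> y)) (at y within {-1..0})" for y
    using smooth_has_real_derivative[OF assms, of y]
    by (intro has_vector_derivative_of_real has_vector_derivative_at_within)
      (simp add: has_real_derivative_iff_has_vector_derivative)
qed

section \<open>Weak derivatives and the fundamental lemma of the calculus of variations\<close>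

lemma test_interval_eq_0:
  assumes "test_interval \<psi>" shows "y \<notin> {-1<..<0} \<Longrightarrow> \<psi> y = 0"
  using assms by (fastforce simp: test_interval_def)

lemma abs_cont_imp_weak_deriv:
  assumes "abs_cont F f" shows "weak_deriv 1 F f"
  unfolding weak_deriv_def
proof (intro conjI allI impI)
  show "set_integrable lborel {-1<..<0} F"
    unfolding set_integrable_open_iff
    by (intro borel_integrable_atLeastAtMost' abs_cont_continuous[OF assms])
  show "set_integrable lborel {-1<..<0} f"
    unfolding set_integrable_open_iff by (rule abs_cont_integrable[OF assms])
  fix \<psi> assume \<psi>: "test_interval \<psi>"
  then have s: "smooth \<psi>" by (simp add: test_interval_def)
  have *: "abs_cont (\<lambda>y. of_real (\<psi> y)) (\<lambda>y. of_real (deriv \<psi> y))"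
    by (rule abs_cont_of_real_smooth[OF s])
  have 1: "set_integrable lborel {-1..0} (\<lambda>y. of_real (deriv \<psi> y) * F y)"
    using set_integrable_cmult_continuous[OF abs_cont_integrable[OF *] abs_cont_continuous[OF assms]]
    by (simp add: mult.commute)
  have 2: "set_integrable lborel {-1..0} (\<lambda>y. of_real (\<psi> y) * f y)"
    using set_integrable_cmult_continuous[OF abs_cont_integrable[OF assms] abs_cont_continuous[OF *]] .
  have "\<psi> 0 = 0" "\<psi> (-1) = 0"
    using test_interval_eq_0[OF \<psi>] by auto
  then have "(LINT y:{-1..0}|lborel. of_real (deriv \<psi> y) * F y + of_real (\<psi> y) * f y) = 0"
    using abs_cont_LINT[OF abs_cont_mult[OF * assms], of 0] by simp
  then show "(LINT y:{-1<..<0}|lborel. (deriv ^^ 1) \<psi> y *\<^sub>R F y) =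
      (-1) ^ 1 * (LINT y:{-1<..<0}|lborel. \<psi> y *\<^sub>R f y)"
    using 1 2 by (simp add: set_integral_open_eq scaleR_conv_of_real eq_neg_iff_add_eq_0)
qed

text \<open>The positive and negative parts of r are densities of two measures that agree on all
  half-lines (x, \<infinity>). Half-lines determine such a measure, and a density is unique almost
  everywhere, so the two parts coincide and both vanish.\<close>

lemma AE_zero_if_integral_greaterThan_zero:
  fixes r :: "real \<Rightarrow> real"
  assumes "integrable lborel r" "\<And>x. (LINT y:{x<..}|lborel. r y) = 0"
  shows "AE y in lborel. r y = 0"
proof -
  have [measurable]: "r \<in> borel_measurable lborel" using assms(1) by auto
  have p: "integrable lborel (\<lambda>y. max 0 (r y))" and m: "integrable lborel (\<lambda>y. max 0 (- r y))"
    using assms(1) by auto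
  have em: "emeasure (density lborel (\<lambda>y. ennreal (max 0 (h y)))) {x<..} = ennreal (LINT y:{x<..}|lborel. max 0 (h y))"
    if "integrable lborel (\<lambda>y. max 0 (h y))" "h \<in> borel_measurable lborel" for h :: "real \<Rightarrow> real" and x
  proof -
    have "emeasure (density lborel (\<lambda>y. ennreal (max 0 (h y)))) {x<..} = (\<integral>\<^sup>+y. ennreal (indicator {x<..} y *\<^sub>R max 0 (h y)) \<partial>lborel)"
      using that by (subst emeasure_density) (auto intro!: nn_integral_cong split: split_indicator)
    also have "\<dots> = ennreal (LINT y|lborel. indicator {x<..} y *\<^sub>R max 0 (h y))"
      using that by (intro nn_integral_eq_integral integrable_mult_indicator) (auto split: split_indicator)
    finally show ?thesis by (simp add: set_lebesgue_integral_def)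
  qed
  have "(LINT y:{x<..}|lborel. max 0 (r y)) = (LINT y:{x<..}|lborel. max 0 (- r y))" for x
  proof -
    have "(LINT y:{x<..}|lborel. max 0 (r y)) - (LINT y:{x<..}|lborel. max 0 (- r y)) =
        (LINT y:{x<..}|lborel. max 0 (r y) - max 0 (- r y))"
      using p m by (intro set_integral_diff(2)[symmetric]) (auto simp: set_integrable_def intro!: integrable_mult_indicator simp del: real_scaleR_def)
    also have "\<dots> = (LINT y:{x<..}|lborel. r y)"
      by (intro set_lebesgue_integral_cong) auto
    finally show ?thesis using assms(2) by simp
  qed
  then have "density lborel (\<lambda>y. ennreal (max 0 (r y))) = density lborel (\<lambda>y. ennreal (max 0 (- r y)))"
    by (intro measure_eqI_lessThan) (auto simp: em p m)
  then have "AE y in lborel. ennreal (max 0 (r y)) = ennreal (max 0 (- r y))"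
    by (intro sigma_finite_measure.density_unique[OF sigma_finite_lborel]) auto
  then show ?thesis
    by eventually_elim (auto simp: max_def split: if_splits)
qed

text \<open>Dominated convergence passes from bumps to indicators of intervals inside (-1, 0), and
  from these to half-lines; the previous lemma then applies to real and imaginary parts.\<close>

lemma fundamental_lemma:
  fixes h :: "real \<Rightarrow> complex"
  assumes h: "set_integrable lborel {-1<..<0} h"
    and 0: "\<And>a b k. -1 < a \<Longrightarrow> b < 0 \<Longrightarrow> (LINT y:{-1<..<0}|lborel. bump a b k y *\<^sub>R h y) = 0"
  shows "AE y in lborel. y \<in> {-1<..<0} \<longrightarrow> h y = 0"
proof -
  define H where "H = (\<lambda>y. indicator {-1<..<0} y *\<^sub>R h y)"
  have H: "integrable lborel H" using h by (simp add: set_integrable_def H_def)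
  have 1: "(LINT y|lborel. indicator {a<..<b} y *\<^sub>R H y) = 0" if "-1 < a" "b < 0" for a b
  proof -
    have "(\<lambda>k. LINT y|lborel. bump a b k y *\<^sub>R H y) \<longlonglongrightarrow> (LINT y|lborel. indicator {a<..<b} y *\<^sub>R H y)"
    proof (rule integral_dominated_convergence)
      show "integrable lborel (\<lambda>y. norm (H y))" using H by simp
      show "AE y in lborel. (\<lambda>k. bump a b k y *\<^sub>R H y) \<longlonglongrightarrow> indicator {a<..<b} y *\<^sub>R H y"
        by (intro AE_I2 tendsto_scaleR bump_tendsto tendsto_const)
      show "AE y in lborel. norm (bump a b k y *\<^sub>R H y) \<le> norm (H y)" for k
        by (simp add: abs_of_nonneg[OF bump_bounds(1)] mult_left_le_one_le bump_bounds)
      have "bump a b k \<in> borel_measurable lborel" for k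
        using borel_measurable_continuous_onI[OF smooth_continuous[OF smooth_bump]] by simp
      then show "(\<lambda>y. bump a b k y *\<^sub>R H y) \<in> borel_measurable lborel" for k
        using H by (intro borel_measurable_scaleR) auto
    qed (use H in auto)
    moreover have "(LINT y|lborel. bump a b k y *\<^sub>R H y) = 0" for k
      using 0[OF that, of k] by (simp add: set_lebesgue_integral_def H_def mult.commute)
    ultimately show ?thesis by (simp add: LIMSEQ_const_iff)
  qed
  have 2: "(LINT y:{x<..}|lborel. H y) = 0" for x
  proof -
    \<comment> \<open>Only intervals with endpoints strictly inside (-1, 0) are available; these
      exhaust (x, \<infinity>) intersected with (-1, 0), where H is supported.\<close>
    define a where "a n = max x (-1 + inverse (real (Suc n)))" for n
    define b where "b n = - inverse (real (Suc n))" for n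
    have "(\<lambda>n. LINT y|lborel. indicator {a n<..<b n} y *\<^sub>R H y) \<longlonglongrightarrow> (LINT y|lborel. indicator {x<..} y *\<^sub>R H y)"
    proof (rule integral_dominated_convergence)
      show "integrable lborel (\<lambda>y. norm (H y))" using H by simp
      have "(\<lambda>n. indicator {a n<..<b n} y *\<^sub>R H y) \<longlonglongrightarrow> indicator {x<..} y *\<^sub>R H y" for y
      proof (cases "y \<in> {-1<..<0} \<and> x < y")
        case True
        have "eventually (\<lambda>n. inverse (real (Suc n)) < min (y + 1) (- y)) sequentially"
          using True by (intro order_tendstoD[OF LIMSEQ_inverse_real_of_nat]) auto
        then have "eventually (\<lambda>n. indicator {a n<..<b n} y *\<^sub>R H y = indicator {x<..} y *\<^sub>R H y) sequentially"
          by eventually_elim (use True in \<open>auto simp: a_def b_def split: split_indicator\<close>)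
        then show ?thesis by (rule tendsto_eventually)
      next
        case False
        then show ?thesis by (auto simp: H_def a_def split: split_indicator)
      qed
      then show "AE y in lborel. (\<lambda>n. indicator {a n<..<b n} y *\<^sub>R H y) \<longlonglongrightarrow> indicator {x<..} y *\<^sub>R H y" 
        by simp
      show "(\<lambda>y. indicator {a n<..<b n} y *\<^sub>R H y) \<in> borel_measurable lborel" for n
        using H by (intro borel_measurable_scaleR) auto
      show "(\<lambda>y. indicator {x<..} y *\<^sub>R H y) \<in> borel_measurable lborel"
        using H by (intro borel_measurable_scaleR) auto
      show "AE y in lborel. norm (indicator {a n<..<b n} y *\<^sub>R H y) \<le> norm (H y)" for n
        by (auto split: split_indicator)
    qed
    moreover have "-1 < a n" "b n < 0" for n
      by (auto simp: a_def b_def less_max_iff_disj)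
    ultimately show ?thesis
      using 1 by (simp add: LIMSEQ_const_iff set_lebesgue_integral_def)
  qed
  have "set_integrable lborel {x<..} H" for x
    using H by (auto simp: set_integrable_def intro!: integrable_mult_indicator)
  then have "(LINT y:{x<..}|lborel. Re (H y)) = Re (LINT y:{x<..}|lborel. H y)"
    "(LINT y:{x<..}|lborel. Im (H y)) = Im (LINT y:{x<..}|lborel. H y)" for x
    by (simp_all add: set_lebesgue_integral_def set_integrable_def flip: integral_Re integral_Im)
  then have "AE y in lborel. Re (H y) = 0" "AE y in lborel. Im (H y) = 0"
    using H by (auto intro!: AE_zero_if_integral_greaterThan_zero simp: 2 integrable_Re integrable_Im)
  then show ?thesis
    by eventually_elim (auto simp: H_def complex_eq_iff)
qed

lemma weak_deriv_integrable:
  assumes "weak_deriv 1 u w"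
  shows "set_integrable lborel {-1<..<0} u" "set_integrable lborel {-1<..<0} w"
    "set_integrable lborel {-1..0} u" "set_integrable lborel {-1..0} w"
  using assms by (auto simp: weak_deriv_def set_integrable_open_iff)

lemma set_integrable_scaleR_test:
  fixes h :: "real \<Rightarrow> complex"
  assumes "smooth \<psi>" "set_integrable lborel {-1<..<0} h"
  shows "set_integrable lborel {-1<..<0} (\<lambda>y. \<psi> y *\<^sub>R h y)"
  using set_integrable_cmult_continuous[of "-1" 0 h "\<lambda>y. of_real (\<psi> y)"] assms
  by (simp add: set_integrable_open_iff scaleR_conv_of_real continuous_intros smooth_continuous)

lemma weak_derivI:
  assumes "set_integrable lborel {-1<..<0} u" "set_integrable lborel {-1<..<0} w"
    and "\<And>\<psi>. test_interval \<psi> \<Longrightarrow>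
      (LINT y:{-1<..<0}|lborel. deriv \<psi> y *\<^sub>R u y) = - (LINT y:{-1<..<0}|lborel. \<psi> y *\<^sub>R w y)"
  shows "weak_deriv 1 u w"
  using assms by (simp add: weak_deriv_def)

lemma weak_derivD:
  assumes "weak_deriv 1 u w" "test_interval \<psi>"
  shows "(LINT y:{-1<..<0}|lborel. deriv \<psi> y *\<^sub>R u y) = - (LINT y:{-1<..<0}|lborel. \<psi> y *\<^sub>R w y)"
  using assms by (simp add: weak_deriv_def)

lemma test_interval_smooth: "test_interval \<psi> \<Longrightarrow> smooth \<psi>" "test_interval \<psi> \<Longrightarrow> smooth (deriv \<psi>)"
  by (auto simp: test_interval_def smooth_deriv)

lemma weak_deriv_cong:
  assumes "weak_deriv 1 u w" "AE y in lborel. y \<in> {-1<..<0} \<longrightarrow> u y = v y"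
    and v: "set_integrable lborel {-1<..<0} v"
  shows "weak_deriv 1 v w"
proof (rule weak_derivI[OF v weak_deriv_integrable(2)[OF assms(1)]])
  fix \<psi> assume \<psi>: "test_interval \<psi>"
  have "(LINT y:{-1<..<0}|lborel. deriv \<psi> y *\<^sub>R v y) = (LINT y:{-1<..<0}|lborel. deriv \<psi> y *\<^sub>R u y)"
    unfolding set_lebesgue_integral_def
  proof (rule integral_cong_AE)
    show "(\<lambda>y. indicator {-1<..<0} y *\<^sub>R deriv \<psi> y *\<^sub>R v y) \<in> borel_measurable lborel"
      "(\<lambda>y. indicator {-1<..<0} y *\<^sub>R deriv \<psi> y *\<^sub>R u y) \<in> borel_measurable lborel"
      using set_integrable_scaleR_test[OF test_interval_smooth(2)[OF \<psi>] v]
        set_integrable_scaleR_test[OF test_interval_smooth(2)[OF \<psi>] weak_deriv_integrable(1)[OF assms(1)]]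
      unfolding set_integrable_def by (simp_all only: borel_measurable_integrable)
    show "AE y in lborel. indicator {-1<..<0} y *\<^sub>R deriv \<psi> y *\<^sub>R v y = indicator {-1<..<0} y *\<^sub>R deriv \<psi> y *\<^sub>R u y"
      using assms(2) by eventually_elim (auto split: split_indicator)
  qed
  with weak_derivD[OF assms(1) \<psi>]
  show "(LINT y:{-1<..<0}|lborel. deriv \<psi> y *\<^sub>R v y) = - (LINT y:{-1<..<0}|lborel. \<psi> y *\<^sub>R w y)"
    by simp
qed

lemma weak_deriv_add:
  assumes "weak_deriv 1 u w" "weak_deriv 1 u' w'"
  shows "weak_deriv 1 (\<lambda>y. u y + u' y) (\<lambda>y. w y + w' y)"
proof (rule weak_derivI)
  note i = weak_deriv_integrable(1,2)[OF assms(1)] weak_deriv_integrable(1,2)[OF assms(2)]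
  show "set_integrable lborel {-1<..<0} (\<lambda>y. u y + u' y)" "set_integrable lborel {-1<..<0} (\<lambda>y. w y + w' y)"
    using i by (auto intro!: set_integral_add(1))
  fix \<psi> assume \<psi>: "test_interval \<psi>"
  note s = test_interval_smooth[OF \<psi>]
  show "(LINT y:{-1<..<0}|lborel. deriv \<psi> y *\<^sub>R (u y + u' y)) = - (LINT y:{-1<..<0}|lborel. \<psi> y *\<^sub>R (w y + w' y))"
    by (simp add: scaleR_add_right set_integral_add(2)[OF set_integrable_scaleR_test[OF s(2) i(1)] set_integrable_scaleR_test[OF s(2) i(3)]]
        set_integral_add(2)[OF set_integrable_scaleR_test[OF s(1) i(2)] set_integrable_scaleR_test[OF s(1) i(4)]]
        weak_derivD[OF assms(1) \<psi>] weak_derivD[OF assms(2) \<psi>])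
qed

lemma weak_deriv_cmult:
  assumes "weak_deriv 1 u w"
  shows "weak_deriv 1 (\<lambda>y. c * u y) (\<lambda>y. c * w y)"
proof (rule weak_derivI)
  show "set_integrable lborel {-1<..<0} (\<lambda>y. c * u y)" "set_integrable lborel {-1<..<0} (\<lambda>y. c * w y)"
    using weak_deriv_integrable(1,2)[OF assms] by auto
  fix \<psi> assume \<psi>: "test_interval \<psi>"
  have *: "(LINT y:{-1<..<0}|lborel. p y *\<^sub>R (c * h y)) = c * (LINT y:{-1<..<0}|lborel. p y *\<^sub>R h y)"
    for p :: "real \<Rightarrow> real" and h
    by (simp flip: mult_scaleR_right)
  show "(LINT y:{-1<..<0}|lborel. deriv \<psi> y *\<^sub>R (c * u y)) = - (LINT y:{-1<..<0}|lborel. \<psi> y *\<^sub>R (c * w y))"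
    unfolding * by (simp add: weak_derivD[OF assms \<psi>])
qed

lemma weak_deriv_diff:
  assumes "weak_deriv 1 u w" "weak_deriv 1 u' w'"
  shows "weak_deriv 1 (\<lambda>y. u y - u' y) (\<lambda>y. w y - w' y)"
  using weak_deriv_add[OF assms(1) weak_deriv_cmult[OF assms(2), of "-1"]] by simp

lemma weak_deriv_unique:
  assumes "weak_deriv 1 u w" "weak_deriv 1 u w'"
  shows "AE y in lborel. y \<in> {-1<..<0} \<longrightarrow> w y = w' y"
proof -
  have *: "weak_deriv 1 (\<lambda>y. u y - u y) (\<lambda>y. w y - w' y)"
    by (rule weak_deriv_diff[OF assms])
  have "AE y in lborel. y \<in> {-1<..<0} \<longrightarrow> w y - w' y = 0"
  proof (rule fundamental_lemma[OF weak_deriv_integrable(2)[OF *]])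
    fix a b :: real and k assume "-1 < a" "b < 0"
    then show "(LINT y:{-1<..<0}|lborel. bump a b k y *\<^sub>R (w y - w' y)) = 0"
      using weak_derivD[OF * test_interval_bump] by simp
  qed
  then show ?thesis by simp
qed

lemma deriv_L1_eq:
  assumes "weak_deriv 1 u w"
  shows "deriv_L1 1 u = ennreal (LINT y:{-1..0}|lborel. cmod (w y))"
proof -
  have *: "(\<integral>\<^sup>+y\<in>{-1<..<0}. ennreal (cmod (w' y)) \<partial>lborel) = ennreal (LINT y:{-1..0}|lborel. cmod (w y))"
    if w': "weak_deriv 1 u w'" for w'
  proof -
    have "(\<integral>\<^sup>+y\<in>{-1<..<0}. ennreal (cmod (w' y)) \<partial>lborel) = (\<integral>\<^sup>+y\<in>{-1<..<0}. ennreal (cmod (w y)) \<partial>lborel)"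
    proof (rule nn_integral_cong_AE)
      show "AE y in lborel. ennreal (cmod (w' y)) * indicator {-1<..<0} y = ennreal (cmod (w y)) * indicator {-1<..<0} y"
        using weak_deriv_unique[OF w' assms] by eventually_elim (auto split: split_indicator)
    qed
    then show ?thesis
      using set_nn_integral_open_eq[OF weak_deriv_integrable(4)[OF assms]] by simp
  qed
  then have "(\<lambda>w'. \<integral>\<^sup>+y\<in>{-1<..<0}. ennreal (cmod (w' y)) \<partial>lborel) ` {w'. weak_deriv 1 u w'} =
      {ennreal (LINT y:{-1..0}|lborel. cmod (w y))}"
    using assms by (auto simp: image_iff intro!: exI[of _ w])
  then show ?thesis by (simp add: deriv_L1_def)
qed

text \<open>The infimum of the empty set is \<infinity>, so a finite value can only come from an
  existing weak derivative.\<close>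

lemma deriv_L1_finite:
  assumes "deriv_L1 1 u < \<infinity>" obtains w where "weak_deriv 1 u w"
proof -
  have "{w. weak_deriv 1 u w} \<noteq> {}"
    using assms unfolding deriv_L1_def by (metis Inf_empty image_empty infinity_ennreal_def less_irrefl)
  then show ?thesis using that by blast
qed

section \<open>Vanishing weak derivatives and absolutely continuous representatives\<close>

lemma test_interval_primitive:
  assumes "test_interval \<zeta>" "(LINT y:{-1..0}|lborel. \<zeta> y) = 0"
  obtains \<psi> where "test_interval \<psi>" "deriv \<psi> = \<zeta>"
proof -
  from assms(1) obtain a b where ab: "-1 < a" "b < 0" "\<And>y. y \<notin> {a..b} \<Longrightarrow> \<zeta> y = 0"
    and s: "smooth \<zeta>" by (auto simp: test_interval_def)
  have "isCont \<zeta> x" for x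
    using smooth_continuous[OF s, of UNIV] by (simp add: continuous_on_eq_continuous_at)
  then obtain F where F: "\<And>x. (F has_vector_derivative \<zeta> x) (at x)"
    using einterval_antiderivative[of "-\<infinity>" \<infinity> \<zeta>] by auto
  define \<psi> where "\<psi> y = F y - F (-1)" for y
  have \<psi>: "(\<psi> has_real_derivative \<zeta> y) (at y)" for y
    unfolding \<psi>_def has_real_derivative_iff_has_vector_derivative
    using F[of y] by (auto intro!: derivative_eq_intros)
  have "(LINT y:{-1..0}|lborel. \<zeta> y) = \<psi> 0 - \<psi> (-1)"
    unfolding set_lebesgue_integral_def
    by (rule integral_FTC_atLeastAtMost)
      (auto intro: smooth_continuous[OF s] has_vector_derivative_at_within \<psi>[unfolded has_real_derivative_iff_has_vector_derivative])
  with assms(2) have 0: "\<psi> 0 = 0" "\<psi> (-1) = 0"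
    by (auto simp: \<psi>_def)
  \<comment> \<open>Off the support of \<zeta> the primitive is locally constant. Each of the two
    outer half-lines is convex and contains an endpoint of the strip interval, where the primitive
    is 0: at -1 by choice, at 0 by the mean-zero hypothesis.\<close>
  have const: "\<psi> x = \<psi> y" if "convex S" "x \<in> S" "y \<in> S" "\<And>z. z \<in> S \<Longrightarrow> z \<notin> {a..b}" for S x y
  proof -
    have "\<exists>c. \<forall>x\<in>S. \<psi> x = c"
    proof (rule has_field_derivative_zero_constant[OF that(1)])
      fix z assume "z \<in> S"
      then show "(\<psi> has_real_derivative 0) (at z within S)"
        using \<psi>[of z] ab(3)[OF that(4)] by (auto intro: has_field_derivative_at_within)
    qed
    with that show ?thesis by metis
  qed
  have "\<psi> y = 0" if "y \<notin> {a..b}" for y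
    using that const[of "{..<a}" y "-1"] const[of "{b<..}" y 0] ab(1,2) 0 by force
  moreover have "smooth \<psi>"
    by (rule smooth_primitive[OF \<psi> s])
  ultimately have "test_interval \<psi>"
    using ab(1,2) unfolding test_interval_def by blast
  moreover have "deriv \<psi> = \<zeta>"
    using \<psi> DERIV_imp_deriv by blast
  ultimately show ?thesis by (rule that)
qed

text \<open>The du Bois-Reymond argument: subtracting from a bump the multiple of one fixed bump
  \<eta> with the same mean leaves the derivative of a test function, which h annihilates. Hence h
  minus its \<eta>-average annihilates every bump.\<close>

lemma zero_weak_deriv_const:
  assumes "weak_deriv 1 h (\<lambda>y. 0)"
  shows "\<exists>c. AE y in lborel. y \<in> {-1<..<0} \<longrightarrow> h y = c"
proof -
  note h = weak_deriv_integrable(1)[OF assms]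
  define \<eta> where "\<eta> = bump (-3/4) (-1/4) 0"
  have \<eta>: "test_interval \<eta>" unfolding \<eta>_def by (rule test_interval_bump) auto
  have bint: "set_integrable lborel {-1..0} (bump a b k)" for a b k
    by (intro borel_integrable_atLeastAtMost' smooth_continuous smooth_bump)
  define m where "m = (LINT y:{-1..0}|lborel. \<eta> y)"
  \<comment> \<open>If the mean vanished, \<eta> would have a primitive vanishing at -1 and at 0;
    but that primitive never decreases and increases strictly where \<eta> is positive.\<close>
  have "m \<noteq> 0"
  proof
    assume "m = 0"
    then obtain \<psi> where \<psi>: "test_interval \<psi>" "deriv \<psi> = \<eta>"
      using test_interval_primitive[OF \<eta>] by (auto simp: m_def)
    have D: "(\<psi> has_real_derivative \<eta> y) (at y)" for y
      using smooth_has_real_derivative[OF test_interval_smooth(1)[OF \<psi>(1)], of y] \<psi>(2) by simp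
    have "\<psi> (-3/4) < \<psi> (-1/4)"
    proof (rule DERIV_pos_imp_increasing_open[where f = \<psi>])
      show "continuous_on {-3/4..-1/4} \<psi>"
        by (intro smooth_continuous test_interval_smooth \<psi>)
      fix x :: real assume "-3/4 < x" "x < -1/4"
      then have "0 < \<eta> x" unfolding \<eta>_def by (intro bump_pos) auto
      with D[of x] show "\<exists>y. (\<psi> has_real_derivative y) (at x) \<and> y > 0" by blast
    qed auto
    moreover have "\<exists>z. (\<psi> has_real_derivative z) (at x) \<and> 0 \<le> z" for x
      using D[of x] bump_bounds(1) unfolding \<eta>_def by blast
    then have "\<psi> (-1) \<le> \<psi> (-3/4)" "\<psi> (-1/4) \<le> \<psi> 0"
      by (auto intro!: DERIV_nonneg_imp_nondecreasing[where f = \<psi>])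
    ultimately show False
      using test_interval_eq_0[OF \<psi>(1), of "-1"] test_interval_eq_0[OF \<psi>(1), of 0] by simp
  qed
  define c where "c = (LINT y:{-1<..<0}|lborel. \<eta> y *\<^sub>R h y) / m"
  have "AE y in lborel. y \<in> {-1<..<0} \<longrightarrow> h y - c = 0"
  proof (rule fundamental_lemma)
    have "set_integrable lborel {-1<..<0} (\<lambda>y::real. c)"
      unfolding set_integrable_open_iff by (intro borel_integrable_atLeastAtMost' continuous_on_const)
    with h show "set_integrable lborel {-1<..<0} (\<lambda>y. h y - c)" by (rule set_integral_diff(1))
    fix a b :: real and k assume ab: "-1 < a" "b < 0"
    define n where "n = (LINT y:{-1..0}|lborel. bump a b k y)"
    \<comment> \<open>The coefficient n / m makes the mean n - (n / m) m vanish, so that \<zeta> has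
      a compactly supported primitive.\<close>
    define \<zeta> where "\<zeta> y = bump a b k y - n / m * \<eta> y" for y
    have "test_interval \<zeta>"
    proof -
      have "smooth \<zeta>"
        using smooth_add[OF smooth_bump[of a b k] smooth_mult[OF smooth_const[of "- (n / m)"] test_interval_smooth(1)[OF \<eta>]]]
        by (simp add: \<zeta>_def[abs_def])
      moreover have "-1 < min a (-3/4)" "max b (-1/4) < 0" using ab by auto
      moreover have "\<zeta> y = 0" if "y \<notin> {min a (-3/4)..max b (-1/4)}" for y
      proof -
        have "bump a b k y = 0" "\<eta> y = 0"
          using that by (auto intro!: bump_eq_0 simp: \<eta>_def)
        then show ?thesis by (simp add: \<zeta>_def)
      qed
      ultimately show ?thesis unfolding test_interval_def by blast
    qed
    moreover have "(LINT y:{-1..0}|lborel. \<zeta> y) = 0"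
    proof -
      have "(LINT y:{-1..0}|lborel. \<zeta> y) = n - (LINT y:{-1..0}|lborel. n / m * \<eta> y)"
        unfolding \<zeta>_def n_def using bint by (intro set_integral_diff(2)) (auto simp: \<eta>_def)
      also have "\<dots> = 0" using \<open>m \<noteq> 0\<close> by (simp add: m_def)
      finally show ?thesis .
    qed
    ultimately obtain \<psi> where \<psi>: "test_interval \<psi>" "deriv \<psi> = \<zeta>"
      by (rule test_interval_primitive)
    have bh: "set_integrable lborel {-1<..<0} (\<lambda>y. bump a' b' k' y *\<^sub>R h y)" for a' b' k'
      by (intro set_integrable_scaleR_test smooth_bump h)
    have bc: "set_integrable lborel {-1<..<0} (\<lambda>y. bump a b k y *\<^sub>R c)"
      by (intro set_integrable_scaleR_test smooth_bump) fact
    have "0 = (LINT y:{-1<..<0}|lborel. \<zeta> y *\<^sub>R h y)"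
      using weak_derivD[OF assms \<psi>(1)] \<psi>(2) by simp
    also have "\<dots> = (LINT y:{-1<..<0}|lborel. bump a b k y *\<^sub>R h y - (n / m) *\<^sub>R (\<eta> y *\<^sub>R h y))"
      by (simp add: \<zeta>_def scaleR_diff_left)
    also have "\<dots> = (LINT y:{-1<..<0}|lborel. bump a b k y *\<^sub>R h y) - (LINT y:{-1<..<0}|lborel. (n / m) *\<^sub>R (\<eta> y *\<^sub>R h y))"
      using bh by (intro set_integral_diff(2) set_integrable_scaleR_right) (auto simp: \<eta>_def)
    also have "\<dots> = (LINT y:{-1<..<0}|lborel. bump a b k y *\<^sub>R h y) - n *\<^sub>R c"
      by (simp add: c_def scaleR_conv_of_real)
    also have "n *\<^sub>R c = (LINT y:{-1<..<0}|lborel. bump a b k y *\<^sub>R c)"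
      unfolding n_def set_integral_open_eq[symmetric]
      by (simp add: scaleR_conv_of_real set_integral_complex_of_real)
    finally show "(LINT y:{-1<..<0}|lborel. bump a b k y *\<^sub>R (h y - c)) = 0"
      using set_integral_diff(2)[OF bh[of a b k] bc] by (simp add: scaleR_diff_right)
  qed
  then show ?thesis by auto
qed

lemma abs_cont_primitive:
  assumes "set_integrable lborel {-1..0} w"
  shows "abs_cont (\<lambda>y. LINT t:{-1..y}|lborel. w t) w"
proof (rule abs_contI[OF assms])
  have "(LINT t:{-1..-1}|lborel. w t) = (LINT t:{}|lborel. w t)"
    by (rule set_integral_discrete_difference[where X = "{-1}"]) auto
  then have "(LINT t:{-1..-1}|lborel. w t) = 0"
    by (simp add: set_lebesgue_integral_def)
  then show "(LINT t:{-1..y}|lborel. w t) = (LINT t:{-1..y}|lborel. w t) - (LINT t:{-1..-1}|lborel. w t)" for y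
    by simp
qed

text \<open>The primitive of w has the same weak derivative as u, so the two differ by a constant
  almost everywhere.\<close>

lemma weak_deriv_imp_abs_cont:
  assumes "weak_deriv 1 u w"
  obtains U where "abs_cont U w" "AE y in lborel. y \<in> {-1<..<0} \<longrightarrow> u y = U y"
proof -
  define W where "W y = (LINT t:{-1..y}|lborel. w t)" for y
  have W: "abs_cont W w"
    unfolding W_def by (rule abs_cont_primitive) (rule weak_deriv_integrable[OF assms])
  have "weak_deriv 1 (\<lambda>y. u y - W y) (\<lambda>y. w y - w y)"
    by (intro weak_deriv_diff assms abs_cont_imp_weak_deriv W)
  then obtain c where c: "AE y in lborel. y \<in> {-1<..<0} \<longrightarrow> u y - W y = c"
    using zero_weak_deriv_const by auto
  have "abs_cont (\<lambda>y. W y + c) w"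
    using abs_cont_add[OF W abs_cont_const] by simp
  moreover have "AE y in lborel. y \<in> {-1<..<0} \<longrightarrow> u y = W y + c"
    using c by eventually_elim (auto simp: algebra_simps)
  ultimately show ?thesis by (rule that)
qed

section \<open>The boundary value problem for a single Fourier mode\<close>

lemma abs_cont_exp_mult:
  assumes "abs_cont F f"
  shows "abs_cont (\<lambda>y. of_real (exp (k * y)) * F y) (\<lambda>y. of_real (exp (k * y)) * (f y + of_real k * F y))"
proof -
  have "abs_cont (\<lambda>y. of_real (exp (k * y))) (\<lambda>y. of_real (k * exp (k * y)))"
    by (rule abs_cont_of_derivative)
      (auto intro!: has_vector_derivative_of_real derivative_eq_intros continuous_intros
        simp flip: has_real_derivative_iff_has_vector_derivative)
  from abs_cont_mult[OF this assms] show ?thesis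
    by (rule abs_cont_cong) (auto simp: algebra_simps)
qed

lemma set_integral_norm_nonneg: "0 \<le> (LINT y:A|M. norm (f y))"
  by (auto simp: set_lebesgue_integral_def intro!: Bochner_Integration.integral_nonneg)

text \<open>Applied with one endpoint where F vanishes, this turns an L^1 bound on the derivative
  into a uniform bound on F.\<close>

lemma abs_cont_norm_le:
  assumes "abs_cont F f" "x \<in> {-1..0}" "y \<in> {-1..0}"
  shows "cmod (F x - F y) \<le> (LINT t:{-1..0}|lborel. cmod (f t))"
proof -
  have *: "cmod (F b - F a) \<le> (LINT t:{-1..0}|lborel. cmod (f t))"
    if "a \<le> b" "a \<in> {-1..0}" "b \<in> {-1..0}" for a b
  proof -
    note f = abs_cont_integrable[OF assms(1)]
    have "F b - F a = integral {-1..b} f - integral {-1..a} f"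
      using that by (simp add: abs_cont_integral[OF assms(1)])
    also have "\<dots> = integral {a..b} f"
    proof -
      have "f integrable_on {-1..b}"
        using set_borel_integral_eq_integral(1)[OF set_integrable_Icc_subset[OF f]] that by auto
      then show ?thesis
        using Henstock_Kurzweil_Integration.integral_combine[of "-1" a b f] that
        by (auto simp: diff_eq_eq add.commute)
    qed
    also have "\<dots> = (LINT t:{a..b}|lborel. f t)"
      by (rule set_borel_integral_eq_integral(2)[symmetric], rule set_integrable_subset[OF f]) (use that in auto)
    also have "cmod \<dots> \<le> (LINT t:{a..b}|lborel. cmod (f t))"
      by (rule set_integral_norm_bound, rule set_integrable_subset[OF f]) (use that in auto)
    also have "\<dots> \<le> (LINT t:{-1..0}|lborel. cmod (f t))"
      unfolding set_lebesgue_integral_def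
      by (rule integral_mono)
        (use that f[THEN set_integrable_norm] set_integrable_subset[OF f[THEN set_integrable_norm], of "{a..b}"] in
          \<open>auto simp: set_integrable_def split: split_indicator\<close>)
    finally show ?thesis .
  qed
  show ?thesis
    using *[of x y] *[of y x] assms(2,3) by (cases "x \<le> y") (auto simp: norm_minus_commute)
qed

text \<open>The gain of a factor k comes from integrating Z' = r - k Z: k times the integral of Z
  equals the integral of r plus Z (-1) - Z 0. A pointwise majorant of X therefore transfers the gain
  to X. Z is complex-valued to fit \<open>abs_cont\<close>.\<close>

lemma integral_bound_by_majorant:
  assumes X: "continuous_on {-1..0} X" and Z: "abs_cont Z (\<lambda>y. r y - of_real k * Z y)"
    and r: "set_integrable lborel {-1..0} r"
    and le: "\<And>y. y \<in> {-1..0} \<Longrightarrow> cmod (X y) \<le> Re (Z y)" and k: "k \<ge> 0"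
  shows "k * (LINT y:{-1..0}|lborel. cmod (X y)) \<le> Re (LINT y:{-1..0}|lborel. r y) + Re (Z (-1)) - Re (Z 0)"
proof -
  have iZ: "set_integrable lborel {-1..0} Z" and iX: "set_integrable lborel {-1..0} (\<lambda>y. cmod (X y))"
    by (intro borel_integrable_atLeastAtMost' continuous_intros X abs_cont_continuous[OF Z])+
  have iR: "set_integrable lborel {-1..0} (\<lambda>y. Re (Z y))"
    by (intro borel_integrable_atLeastAtMost' continuous_intros abs_cont_continuous[OF Z])
  have "k * (LINT y:{-1..0}|lborel. cmod (X y)) \<le> k * (LINT y:{-1..0}|lborel. Re (Z y))"
    using k le by (intro mult_left_mono set_integral_mono iX iR) auto
  also have "(LINT y:{-1..0}|lborel. Re (Z y)) = Re (LINT y:{-1..0}|lborel. Z y)"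
    using iZ by (simp add: set_lebesgue_integral_def set_integrable_def flip: integral_Re)
  also have "k * \<dots> = Re (LINT y:{-1..0}|lborel. of_real k * Z y)"
    by simp
  also have "(LINT y:{-1..0}|lborel. of_real k * Z y) = (LINT y:{-1..0}|lborel. r y) - (Z 0 - Z (-1))"
  proof -
    have "(LINT y:{-1..0}|lborel. r y) - (LINT y:{-1..0}|lborel. of_real k * Z y) = Z 0 - Z (-1)"
      using abs_cont_LINT[OF Z, of 0] set_integral_diff(2)[OF r, of "\<lambda>y. of_real k * Z y"] iZ by simp
    then show ?thesis by algebra
  qed
  finally show ?thesis by simp
qed

text \<open>|X| is dominated by the solution Z of Z' = |r| - k Z with Z (-1) = |X (-1)|, and Z 0
  \<ge> 0 may be dropped from the integrated equation. The bound has no constant depending on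
  k.\<close>

lemma decay_forward:
  assumes X: "abs_cont X (\<lambda>y. r y - of_real k * X y)" and r: "set_integrable lborel {-1..0} r" and k: "k \<ge> 0"
  shows "k * (LINT y:{-1..0}|lborel. cmod (X y)) \<le> cmod (X (-1)) + (LINT y:{-1..0}|lborel. cmod (r y))"
proof -
  define Y where "Y y = of_real (exp (k * y)) * X y" for y
  have Y: "abs_cont Y (\<lambda>y. of_real (exp (k * y)) * r y)"
    using abs_cont_exp_mult[OF X, of k] by (simp add: Y_def[abs_def])
  have rn: "set_integrable lborel {-1..0} (\<lambda>y. complex_of_real (cmod (r y)))"
    using integrable_of_real[OF set_integrable_norm[OF r, unfolded set_integrable_def], where 'a = complex]
    by (simp add: set_integrable_def scaleR_conv_of_real)
  have en: "set_integrable lborel {-1..0} (\<lambda>y. of_real (exp (k * y)) * complex_of_real (cmod (r y)))"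
    by (intro set_integrable_cmult_continuous rn continuous_intros)
  \<comment> \<open>After multiplication by exp (k y) the zero-order term is gone, and H is the
    majorant of \<open>Y\<close> obtained by taking norms in its integral representation;
    \<open>Z\<close> below undoes the integrating factor.\<close>
  define h where "h y = (LINT t:{-1..y}|lborel. of_real (exp (k * t)) * complex_of_real (cmod (r t)))" for y
  define H where "H y = of_real (cmod (Y (-1))) + h y" for y
  have h: "abs_cont h (\<lambda>y. of_real (exp (k * y)) * complex_of_real (cmod (r y)))"
    unfolding h_def by (rule abs_cont_primitive[OF en])
  have H: "abs_cont H (\<lambda>y. of_real (exp (k * y)) * complex_of_real (cmod (r y)))"
    using abs_cont_add[OF abs_cont_const h] by (simp add: H_def[abs_def])
  have hRe: "h y = of_real (LINT t:{-1..y}|lborel. exp (k * t) * cmod (r t))" for y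
    unfolding h_def by (simp flip: of_real_mult add: set_integral_complex_of_real)
  have h0: "h (-1) = 0"
    using abs_cont_LINT[OF h, of "-1"] by (simp add: h_def)
  have le: "cmod (Y y) \<le> Re (H y)" if y: "y \<in> {-1..0}" for y
  proof -
    have "cmod (Y y) \<le> cmod (Y (-1)) + cmod (LINT t:{-1..y}|lborel. of_real (exp (k * t)) * r t)"
      using norm_triangle_ineq[of "Y (-1)" "Y y - Y (-1)"] by (simp add: abs_cont_LINT[OF Y y])
    also have "cmod (LINT t:{-1..y}|lborel. of_real (exp (k * t)) * r t) \<le> (LINT t:{-1..y}|lborel. cmod (of_real (exp (k * t)) * r t))"
      using y by (intro set_integral_norm_bound set_integrable_Icc_subset[OF abs_cont_integrable[OF Y]]) auto
    also have "\<dots> = Re (h y)" by (simp add: hRe norm_mult)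
    finally show ?thesis by (simp add: H_def)
  qed
  define Z where "Z y = of_real (exp (- k * y)) * H y" for y
  have Z: "abs_cont Z (\<lambda>y. of_real (cmod (r y)) - of_real k * Z y)"
    using abs_cont_exp_mult[OF H, of "- k"]
    by (rule abs_cont_cong) (auto simp: Z_def algebra_simps simp flip: of_real_mult exp_add)
  have "cmod (X y) \<le> Re (Z y)" if "y \<in> {-1..0}" for y
  proof -
    have "X y = of_real (exp (- k * y)) * Y y"
      by (simp add: Y_def algebra_simps flip: of_real_mult exp_add)
    then show ?thesis using le[OF that] by (simp add: Z_def norm_mult)
  qed
  then have "k * (LINT y:{-1..0}|lborel. cmod (X y)) \<le>
      Re (LINT y:{-1..0}|lborel. of_real (cmod (r y))) + Re (Z (-1)) - Re (Z 0)"
    by (intro integral_bound_by_majorant abs_cont_continuous[OF X] Z rn k)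
  moreover have "Re (Z (-1)) = cmod (X (-1))"
    by (simp add: Z_def H_def h0 Y_def norm_mult flip: exp_add mult.assoc)
  moreover have "0 \<le> Re (Z 0)"
    using order_trans[OF norm_ge_zero le[of 0]] by (simp add: Z_def)
  moreover have "Re (LINT y:{-1..0}|lborel. of_real (cmod (r y))) = (LINT y:{-1..0}|lborel. cmod (r y))"
    by (simp add: set_integral_complex_of_real)
  ultimately show ?thesis by simp
qed

lemma lborel_set_integral_reflect:
  fixes f :: "real \<Rightarrow> 'a::euclidean_space"
  shows "(LINT y:{-1..0}|lborel. f (-1 - y)) = (LINT y:{-1..0}|lborel. f y)"
    and "set_integrable lborel {-1..0} (\<lambda>y. f (-1 - y)) \<longleftrightarrow> set_integrable lborel {-1..0} f"
proof -
  have *: "indicator {-1..0} (-1 - y) = (indicator {-1..0} y :: real)" for y :: real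
    by (auto split: split_indicator)
  show "(LINT y:{-1..0}|lborel. f (-1 - y)) = (LINT y:{-1..0}|lborel. f y)"
    using lborel_integral_real_affine[of "-1" "\<lambda>y. indicator {-1..0} y *\<^sub>R f y" "-1"]
    by (simp add: set_lebesgue_integral_def *)
  show "set_integrable lborel {-1..0} (\<lambda>y. f (-1 - y)) \<longleftrightarrow> set_integrable lborel {-1..0} f"
    using lborel_integrable_real_affine_iff[of "-1" "\<lambda>y. indicator {-1..0} y *\<^sub>R f y" "-1"] *
    by (simp add: set_integrable_def)
qed

text \<open>The reflection y -> -1 - y swaps the endpoints and turns growth into decay, so the
  estimate starts from the value at 0.\<close>

lemma decay_backward:
  assumes X: "abs_cont X (\<lambda>y. r y + of_real k * X y)" and r: "set_integrable lborel {-1..0} r" and k: "k \<ge> 0"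
  shows "k * (LINT y:{-1..0}|lborel. cmod (X y)) \<le> cmod (X 0) + (LINT y:{-1..0}|lborel. cmod (r y))"
proof -
  define x where "x = (\<lambda>y. r y + of_real k * X y)"
  have x: "set_integrable lborel {-1..0} x"
    using abs_cont_integrable[OF X] by (simp add: x_def)
  have "abs_cont (\<lambda>y. X (-1 - y)) (\<lambda>y. - x (-1 - y))"
  proof (rule abs_contI)
    have *: "set_integrable lborel {-1..0} (\<lambda>y. x (-1 - y))"
      using x by (simp add: lborel_set_integral_reflect)
    then show "set_integrable lborel {-1..0} (\<lambda>y. - x (-1 - y))"
      by (simp add: set_integrable_def)
    fix y :: real assume y: "y \<in> {-1..0}"
    have "(LINT t:{-1..y}|lborel. x (-1 - t)) = (LINT t:{-1..0}|lborel. indicator {-1..y} t *\<^sub>R x (-1 - t))"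
      unfolding set_lebesgue_integral_def using y
      by (intro Bochner_Integration.integral_cong) (auto split: split_indicator)
    also have "\<dots> = (LINT t:{-1..0}|lborel. indicator {-1..y} (-1 - t) *\<^sub>R x t)"
      using lborel_set_integral_reflect(1)[of "\<lambda>t. indicator {-1..y} (-1 - t) *\<^sub>R x t"] by simp
    also have "\<dots> = (LINT t:{-1 - y..0}|lborel. x t)"
      unfolding set_lebesgue_integral_def using y
      by (intro Bochner_Integration.integral_cong) (auto split: split_indicator)
    also have "\<dots> = X 0 - X (-1 - y)"
    proof -
      have s: "set_integrable lborel {-1 - y..0} x"
        by (rule set_integrable_subset[OF x]) (use y in auto)
      have "integral {-1 - y..0} x = integral {-1..0} x - integral {-1..-1 - y} x"
        using Henstock_Kurzweil_Integration.integral_combine[of "-1" "-1 - y" 0 x] y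
          set_borel_integral_eq_integral(1)[OF x] by (simp add: algebra_simps)
      then show ?thesis
        using y set_borel_integral_eq_integral(2)[OF s] by (simp add: abs_cont_integral[OF X, folded x_def])
    qed
    finally show "(LINT t:{-1..y}|lborel. - x (-1 - t)) = X (-1 - y) - X (-1 - (-1))"
      using set_integral_uminus[OF set_integrable_Icc_subset[OF *], of y] y by simp
  qed
  then have "abs_cont (\<lambda>y. X (-1 - y)) (\<lambda>y. - r (-1 - y) - of_real k * X (-1 - y))"
    by (rule abs_cont_cong) (auto simp: x_def)
  moreover have "set_integrable lborel {-1..0} (\<lambda>y. - r (-1 - y))"
    using lborel_set_integral_reflect(2)[of r] r by (simp add: set_integrable_def)
  ultimately have "k * (LINT y:{-1..0}|lborel. cmod (X (-1 - y))) \<le>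
      cmod (X (-1 - (-1))) + (LINT y:{-1..0}|lborel. cmod (- r (-1 - y)))"
    using k by (rule decay_forward)
  then show ?thesis
    using lborel_set_integral_reflect(1)[of "\<lambda>y. cmod (X y)"] lborel_set_integral_reflect(1)[of "\<lambda>y. cmod (r y)"]
    by simp
qed

text \<open>With \<open>k = \<bar>m\<bar>\<close> and \<open>\<sigma> = sgn m\<close>, the combinations
  \<open>p = \<phi>' + k \<phi> + \<i> \<sigma> g1\<close> and \<open>q = \<phi>' - k \<phi> - \<i> \<sigma> g1\<close> decouple the mode equation into
  \<open>p' - k p = w2 + \<i> \<sigma> w1\<close> and \<open>q' + k q = w2 - \<i> \<sigma> w1\<close>, which only involve the derivatives of the data.
  The boundary conditions say \<open>p (-1) = - q (-1)\<close> and \<open>p 0 - q 0 = 2 \<i> \<sigma> g1 0\<close>.\<close>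

lemma mode_solution:
  fixes m :: real and g1 w1 w2 :: "real \<Rightarrow> complex"
  assumes g1: "abs_cont g1 w1" "g1 (-1) = 0" and w2: "set_integrable lborel {-1..0} w2"
  defines "N \<equiv> (LINT y:{-1..0}|lborel. cmod (w1 y)) + (LINT y:{-1..0}|lborel. cmod (w2 y))"
  shows "\<exists>\<phi> D d. abs_cont \<phi> D \<and> \<phi> 0 = 0 \<and> D (-1) = 0 \<and> abs_cont D d \<and>
     (\<forall>y\<in>{-1..0}. d y = of_real (m\<^sup>2) * \<phi> y + \<i> * of_real m * g1 y + w2 y) \<and>
     (LINT y:{-1..0}|lborel. cmod (of_real m * D y)) + (LINT y:{-1..0}|lborel. cmod (d y)) \<le> 12 * N"
proof -
  define k where "k = \<bar>m\<bar>"
  define \<sigma> where "\<sigma> = sgn m"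
  have m: "m = \<sigma> * k" and k: "k \<ge> 0" and \<sigma>: "\<bar>\<sigma>\<bar> \<le> 1" and \<sigma>k: "\<sigma> * m = k"
    by (auto simp: k_def \<sigma>_def sgn_if)
  note w1 = abs_cont_integrable[OF g1(1)]
  define rp where "rp y = w2 y + \<i> * of_real \<sigma> * w1 y" for y
  define rm where "rm y = w2 y - \<i> * of_real \<sigma> * w1 y" for y
  have rp: "set_integrable lborel {-1..0} rp" and rm: "set_integrable lborel {-1..0} rm"
    unfolding rp_def[abs_def] rm_def[abs_def] using w1 w2
    by (auto intro!: set_integral_add(1) set_integral_diff(1))
  have w1n: "set_integrable lborel {-1..0} (\<lambda>y. cmod (w1 y))" and w2n: "set_integrable lborel {-1..0} (\<lambda>y. cmod (w2 y))"
    by (intro set_integrable_norm w1 w2)+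
  have N: "(LINT y:{-1..0}|lborel. cmod (w2 y) + cmod (w1 y)) = N"
    using w1n w2n by (simp add: N_def)
  have w1le: "cmod (\<i> * of_real \<sigma> * w1 y) \<le> cmod (w1 y)" for y
    using \<sigma> by (simp add: norm_mult mult_left_le_one_le)
  have "(LINT y:{-1..0}|lborel. cmod (rp y)) \<le> (LINT y:{-1..0}|lborel. cmod (w2 y) + cmod (w1 y))"
    using w1le by (intro set_integral_mono set_integrable_norm[OF rp] set_integral_add(1) w1n w2n)
      (auto simp: rp_def intro: order_trans[OF norm_triangle_ineq] add_left_mono)
  then have rpN: "(LINT y:{-1..0}|lborel. cmod (rp y)) \<le> N" by (simp add: N)
  have "(LINT y:{-1..0}|lborel. cmod (rm y)) \<le> (LINT y:{-1..0}|lborel. cmod (w2 y) + cmod (w1 y))"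
    using w1le by (intro set_integral_mono set_integrable_norm[OF rm] set_integral_add(1) w1n w2n)
      (auto simp: rm_def intro: order_trans[OF norm_triangle_ineq4] add_left_mono)
  then have rmN: "(LINT y:{-1..0}|lborel. cmod (rm y)) \<le> N" by (simp add: N)
  have N1: "(LINT y:{-1..0}|lborel. cmod (w1 y)) \<le> N" and N2: "(LINT y:{-1..0}|lborel. cmod (w2 y)) \<le> N"
    by (auto simp: N_def set_integral_norm_nonneg)
  \<comment> \<open>Variation of constants: exp (k y) q and exp (- k y) p differ from
    \<open>A\<close> and \<open>B\<close> by constants, which the boundary conditions will
    fix.\<close>
  define A where "A y = (LINT t:{-1..y}|lborel. of_real (exp (k * t)) * rm t)" for y
  define B where "B y = (LINT t:{-1..y}|lborel. of_real (exp (- k * t)) * rp t)" for y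
  have A: "abs_cont A (\<lambda>y. of_real (exp (k * y)) * rm y)"
    unfolding A_def by (intro abs_cont_primitive set_integrable_cmult_continuous rm continuous_intros)
  have B: "abs_cont B (\<lambda>y. of_real (exp (- k * y)) * rp y)"
    unfolding B_def by (intro abs_cont_primitive set_integrable_cmult_continuous rp continuous_intros)
  have A0: "A (-1) = 0" and B0: "B (-1) = 0"
    using abs_cont_LINT[OF A, of "-1"] abs_cont_LINT[OF B, of "-1"] by (simp_all add: A_def B_def)
  have "cmod (A 0) \<le> (LINT t:{-1..0}|lborel. cmod (of_real (exp (k * t)) * rm t))"
    using abs_cont_norm_le[OF A, of 0 "-1"] by (simp add: A0)
  also have "\<dots> \<le> (LINT t:{-1..0}|lborel. cmod (rm t))"
    using k by (intro set_integral_mono set_integrable_norm rm abs_cont_integrable[OF A])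
      (auto simp: norm_mult intro!: mult_left_le_one_le mult_nonneg_nonpos)
  finally have AN: "cmod (A 0) \<le> N" using rmN by simp
  \<comment> \<open>\<open>B\<close> carries the weight exp (- k t), which reaches exp k at t = -1,
    so only exp (- k) \<open>B\<close> is bounded uniformly in k. Accordingly B 0 enters the
    estimates of P and Q only with such a factor.\<close>
  have "cmod (of_real (exp (- k)) * B 0) \<le> (LINT t:{-1..0}|lborel. cmod (of_real (exp (- k)) * (of_real (exp (- k * t)) * rp t)))"
    using abs_cont_norm_le[OF abs_cont_cmult[OF B, of "of_real (exp (- k))"], of 0 "-1"] by (simp add: B0)
  also have "\<dots> \<le> (LINT t:{-1..0}|lborel. cmod (rp t))"
  proof (intro set_integral_mono set_integrable_norm rp abs_cont_integrable[OF abs_cont_cmult[OF B]])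
    fix t :: real assume t: "t \<in> {-1..0}"
    have "exp (- k) * exp (- k * t) \<le> 1"
      using t k by (simp add: mult_le_cancel_left flip: exp_add)
        (metis add.commute add_uminus_conv_diff diff_ge_0_iff_ge mult.commute mult_left_le_one_le mult_minus_right neg_le_0_iff_le neg_le_iff_le order_refl)
    then show "cmod (of_real (exp (- k)) * (of_real (exp (- k * t)) * rp t)) \<le> cmod (rp t)"
      by (simp add: norm_mult mult_left_le_one_le flip: mult.assoc)
  qed
  finally have BN: "cmod (of_real (exp (- k)) * B 0) \<le> N" using rpN by simp
  have g1N: "cmod (g1 0) \<le> N"
    using abs_cont_norm_le[OF g1(1), of 0 "-1"] N1 g1(2) by simp
  define e where "e = exp (- k)"
  have e: "0 < e" "e \<le> 1" using k by (auto simp: e_def)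
  \<comment> \<open>P and Q are the values wanted for \<open>p 0\<close> and \<open>q (-1)\<close>.
    The condition p (-1) = - q (-1) reads Q = e (B 0 - P), and the condition at 0 reads P = 2 i
    \<sigma> g1 0 + e Q + A 0; eliminating Q gives this quotient, whose denominator is at least 1
    for every k.\<close>
  define P where "P = (2 * \<i> * of_real \<sigma> * g1 0 + A 0 + of_real (e * e) * B 0) / of_real (1 + e * e)"
  define Q where "Q = of_real e * (B 0 - P)"
  have ee: "1 + e * e > 0" by (simp add: add_pos_nonneg)
  have P: "P = 2 * \<i> * of_real \<sigma> * g1 0 + of_real e * Q + A 0"
  proof -
    have "P * of_real (1 + e * e) = 2 * \<i> * of_real \<sigma> * g1 0 + A 0 + of_real (e * e) * B 0"
      using ee by (simp add: P_def del: of_real_add of_real_mult)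
    then show ?thesis by (simp add: Q_def algebra_simps)
  qed
  \<comment> \<open>4 = 2 + 1 + 1: the trace of g1 counted twice, then A 0 and e^2 B 0.\<close>
  have PN: "cmod P \<le> 4 * N"
  proof -
    have "cmod (2 * \<i> * of_real \<sigma> * g1 0) \<le> 2 * N"
    proof -
      have "\<bar>\<sigma>\<bar> * cmod (g1 0) \<le> 1 * N"
        using \<sigma> g1N by (intro mult_mono) auto
      then show ?thesis by (simp add: norm_mult)
    qed
    moreover have "cmod (of_real (e * e) * B 0) \<le> N"
    proof -
      have "cmod (of_real (e * e) * B 0) = e * cmod (of_real e * B 0)"
        using e by (simp add: norm_mult abs_mult)
      also have "\<dots> \<le> 1 * N"
        using e BN by (intro mult_mono) (auto simp: e_def)
      finally show ?thesis by simp
    qed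
    ultimately have "cmod (2 * \<i> * of_real \<sigma> * g1 0 + A 0 + of_real (e * e) * B 0) \<le> 4 * N"
      using AN by norm
    moreover have "cmod P \<le> cmod (2 * \<i> * of_real \<sigma> * g1 0 + A 0 + of_real (e * e) * B 0)"
      using ee by (auto simp: P_def norm_divide divide_le_eq mult_le_cancel_left1 simp del: of_real_add of_real_mult)
    ultimately show ?thesis by linarith
  qed
  \<comment> \<open>5 = 1 + 4, from e B 0 and e P.\<close>
  have QN: "cmod Q \<le> 5 * N"
  proof -
    have "cmod (of_real e * P) \<le> 1 * (4 * N)"
      unfolding norm_mult using e PN by (intro mult_mono) auto
    moreover have "Q = of_real e * B 0 - of_real e * P" by (simp add: Q_def right_diff_distrib)
    ultimately show ?thesis using BN norm_triangle_ineq4[of "of_real e * B 0" "of_real e * P"]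
      by (simp add: e_def)
  qed
  define p where "p y = of_real (exp (k * y)) * (P - B 0 + B y)" for y
  define q where "q y = of_real (exp (- k * y)) * (of_real e * Q + A y)" for y
  have p: "abs_cont p (\<lambda>y. rp y + of_real k * p y)"
  proof -
    have "abs_cont (\<lambda>y. P - B 0 + B y) (\<lambda>y. of_real (exp (- k * y)) * rp y)"
      using abs_cont_add[OF abs_cont_const B] by simp
    from abs_cont_exp_mult[OF this, of k] show ?thesis
      by (rule abs_cont_cong) (auto simp: p_def algebra_simps simp flip: of_real_mult exp_add)
  qed
  have q: "abs_cont q (\<lambda>y. rm y - of_real k * q y)"
  proof -
    have "abs_cont (\<lambda>y. of_real e * Q + A y) (\<lambda>y. of_real (exp (k * y)) * rm y)"
      using abs_cont_add[OF abs_cont_const A] by simp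
    from abs_cont_exp_mult[OF this, of "- k"] show ?thesis
      by (rule abs_cont_cong) (auto simp: q_def algebra_simps simp flip: of_real_mult exp_add)
  qed
  have p0: "p 0 = P" by (simp add: p_def)
  have q1: "q (-1) = Q"
    by (simp add: q_def A0 e_def exp_minus)
  have p1: "p (-1) = - Q"
    by (simp add: p_def B0 Q_def e_def algebra_simps)
  have q0: "q 0 = of_real e * Q + A 0" by (simp add: q_def)
  \<comment> \<open>Backward from P for \<open>p\<close> and forward from Q for \<open>q\<close>:
    the constants are 4 + 1 and 5 + 1, the added 1 being the L^1 norm of the right-hand
    side.\<close>
  have kp: "k * (LINT y:{-1..0}|lborel. cmod (p y)) \<le> 5 * N"
    using decay_backward[OF p rp k] p0 PN rpN by simp
  have kq: "k * (LINT y:{-1..0}|lborel. cmod (q y)) \<le> 6 * N"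
    using decay_forward[OF q rm k] q1 QN rmN by simp
  define D where "D y = (p y + q y) / 2" for y
  define d where "d y = of_real k * (p y - q y) / 2 + w2 y" for y
  have D: "abs_cont D d"
    using abs_cont_cmult[OF abs_cont_add[OF p q], of "1/2"]
    by (rule abs_cont_cong) (auto simp: D_def d_def rp_def rm_def add_divide_distrib diff_divide_distrib ring_distribs)
  define I where "I y = (LINT t:{-1..y}|lborel. D t)" for y
  define \<phi> where "\<phi> y = I y - I 0" for y
  have iD: "set_integrable lborel {-1..0} D"
    by (intro borel_integrable_atLeastAtMost' abs_cont_continuous[OF D])
  have \<phi>: "abs_cont \<phi> D"
    using abs_cont_diff[OF abs_cont_primitive[OF iD] abs_cont_const] by (simp add: \<phi>_def[abs_def] I_def)
  \<comment> \<open>By the definition of p and q this should be k \<phi>. It has derivative k D and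
    vanishes at 0, as k \<phi> does, so they agree. Taking \<phi> as a primitive of D instead of
    dividing E by k covers k = 0 as well.\<close>
  define E where "E y = (p y - q y) / 2 - \<i> * of_real \<sigma> * g1 y" for y
  have E: "abs_cont E (\<lambda>y. of_real k * D y)"
    using abs_cont_diff[OF abs_cont_cmult[OF abs_cont_diff[OF p q], of "1/2"] abs_cont_cmult[OF g1(1), of "\<i> * of_real \<sigma>"]]
    by (rule abs_cont_cong) (auto simp: E_def D_def rp_def rm_def field_simps)
  have "E y = of_real k * \<phi> y" if y: "y \<in> {-1..0}" for y
  proof -
    have *: "abs_cont (\<lambda>y. E y - of_real k * \<phi> y) (\<lambda>y. 0)"
      using abs_cont_diff[OF E abs_cont_cmult[OF \<phi>, of "of_real k"]] by simp
    have "E 0 = 0" by (simp add: E_def p0 q0 P)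
    then have "E 0 - of_real k * \<phi> 0 = 0" by (simp add: \<phi>_def)
    then show ?thesis
      using abs_cont_LINT[OF *, of 0] abs_cont_LINT[OF * y] by simp
  qed
  then have d: "d y = of_real (m\<^sup>2) * \<phi> y + \<i> * of_real m * g1 y + w2 y" if "y \<in> {-1..0}" for y
  proof -
    have "(p y - q y) / 2 = of_real k * \<phi> y + \<i> * of_real \<sigma> * g1 y"
      using \<open>\<And>y. y \<in> {-1..0} \<Longrightarrow> E y = of_real k * \<phi> y\<close>[OF that] by (simp add: E_def diff_eq_eq)
    then have "d y = of_real k * (of_real k * \<phi> y + \<i> * of_real \<sigma> * g1 y) + w2 y"
      unfolding d_def by (metis times_divide_eq_right)
    moreover have "m\<^sup>2 = k * k" by (simp add: k_def power2_eq_square)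
    ultimately show ?thesis by (simp add: m algebra_simps)
  qed
  have cp: "continuous_on {-1..0} p" and cq: "continuous_on {-1..0} q"
    by (rule abs_cont_continuous[OF p] abs_cont_continuous[OF q])+
  have ip: "set_integrable lborel {-1..0} (\<lambda>y. cmod (p y))" and iq: "set_integrable lborel {-1..0} (\<lambda>y. cmod (q y))"
    by (intro borel_integrable_atLeastAtMost' continuous_intros cp cq)+
  \<comment> \<open>A common majorant of |m D| and |k (p - q) / 2|, with integral at most (5 + 6) /
    2 times N. It is used once for m D and once for d, where w2 adds a further N: 11/2 + 11/2 + 1 =
    12.\<close>
  define S where "S y = k / 2 * cmod (p y) + k / 2 * cmod (q y)" for y
  have iS: "set_integrable lborel {-1..0} S"
    unfolding S_def[abs_def] using ip iq by (intro set_integral_add(1)) auto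
  have "(LINT y:{-1..0}|lborel. S y) = k / 2 * (LINT y:{-1..0}|lborel. cmod (p y)) + k / 2 * (LINT y:{-1..0}|lborel. cmod (q y))"
    unfolding S_def using ip iq by (subst set_integral_add(2)) auto
  then have SN: "(LINT y:{-1..0}|lborel. S y) \<le> 11 / 2 * N"
    using kp kq by simp
  have "(LINT y:{-1..0}|lborel. cmod (of_real m * D y)) \<le> (LINT y:{-1..0}|lborel. S y)"
  proof (intro set_integral_mono iS set_integrable_norm)
    show "set_integrable lborel {-1..0} (\<lambda>y. of_real m * D y)" using iD by auto
    fix y
    have "cmod (of_real m * D y) = k / 2 * cmod (p y + q y)"
      by (simp add: D_def norm_mult norm_divide k_def)
    also have "\<dots> \<le> k / 2 * (cmod (p y) + cmod (q y))"
      using k by (intro mult_left_mono norm_triangle_ineq) auto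
    finally show "cmod (of_real m * D y) \<le> S y" by (simp add: S_def algebra_simps)
  qed
  moreover have "(LINT y:{-1..0}|lborel. cmod (d y)) \<le> (LINT y:{-1..0}|lborel. S y + cmod (w2 y))"
  proof (intro set_integral_mono set_integral_add(1) iS set_integrable_norm w2 abs_cont_integrable[OF D])
    fix y
    have "cmod (d y) \<le> k / 2 * cmod (p y - q y) + cmod (w2 y)"
      unfolding d_def using k by (intro order_trans[OF norm_triangle_ineq]) (simp add: norm_mult norm_divide)
    moreover have "k / 2 * cmod (p y - q y) \<le> k / 2 * (cmod (p y) + cmod (q y))"
      using k by (intro mult_left_mono norm_triangle_ineq4) auto
    ultimately show "cmod (d y) \<le> S y + cmod (w2 y)" by (simp add: S_def algebra_simps)
  qed
  moreover have "(LINT y:{-1..0}|lborel. S y + cmod (w2 y)) \<le> 11 / 2 * N + N"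
    using SN N2 iS w2n by simp
  ultimately have "(LINT y:{-1..0}|lborel. cmod (of_real m * D y)) + (LINT y:{-1..0}|lborel. cmod (d y)) \<le> 12 * N"
    using SN by linarith
  moreover have "\<phi> 0 = 0" "D (-1) = 0" by (auto simp: \<phi>_def D_def p1 q1)
  ultimately show ?thesis using \<phi> D d by blast
qed

section \<open>Fourier coefficients\<close>

lemma periodic_of_int:
  assumes "\<And>x. f (x + 2 * pi) = f x"
  shows "f (x + 2 * pi * of_int k) = f x"
proof (induction k rule: int_induct[where k = 0])
  case (step1 i)
  have "f (x + 2 * pi * of_int (i + 1)) = f ((x + 2 * pi * of_int i) + 2 * pi)"
    by (simp add: algebra_simps)
  with step1 assms show ?case by simp
next
  case (step2 i)
  have "f (x + 2 * pi * of_int i) = f ((x + 2 * pi * of_int (i - 1)) + 2 * pi)"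
    by (simp add: algebra_simps)
  with step2 assms show ?case by simp
qed simp

lemma periodic_cong_cis:
  assumes "\<And>x. f (x + 2 * pi) = f x" "cis x = cis y" shows "f x = f y"
proof -
  have "cos x = cos y" "sin x = sin y" using assms(2) by (auto simp: complex_eq_iff)
  then obtain k where "x = y + 2 * pi * of_int k"
    using sin_cos_eq_iff[of x y] by (auto simp: algebra_simps)
  then show ?thesis using periodic_of_int[of f, OF assms(1)] by simp
qed

text \<open>\<open>Arg\<close> jumps across the negative real axis and \<open>Arg2pi\<close> across
  the positive one, but they differ by a multiple of 2 pi, so f does not distinguish them; at each
  nonzero point one of the two branches is continuous.\<close>

lemma periodic_isCont_Arg:
  fixes f :: "real \<Rightarrow> real"
  assumes "\<And>x. f (x + 2 * pi) = f x" "continuous_on UNIV f" "z \<noteq> 0"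
  shows "isCont (\<lambda>z. f (Arg z)) z"
proof -
  have cf: "isCont f x" for x using assms(2) by (simp add: continuous_on_eq_continuous_at)
  have eq: "f (Arg z) = f (Arg2pi z)" for z
  proof (cases "z = 0")
    case True then show ?thesis by (simp add: Arg_zero)
  next
    case False
    have "cis (Arg z) = cis (Arg2pi z)"
      using cis_Arg[OF False] Arg2pi_eq[of z] False
      by (metis cis_conv_exp mult_cancel_left norm_eq_zero of_real_eq_0_iff rcis_cmod_Arg rcis_def)
    with assms(1) show ?thesis by (rule periodic_cong_cis)
  qed
  show ?thesis
  proof (cases "z \<in> \<real>\<^sub>\<le>\<^sub>0")
    case False
    then show ?thesis by (intro isCont_o2[OF continuous_at_Arg cf])
  next
    case True
    then have "z \<notin> \<real>\<^sub>\<ge>\<^sub>0" using assms(3) by (auto simp: complex_nonneg_Reals_iff complex_nonpos_Reals_iff complex_eq_iff)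
    then have "isCont (\<lambda>z. f (Arg2pi z)) z" by (intro isCont_o2[OF continuous_at_Arg2pi cf])
    then show ?thesis by (simp add: eq)
  qed
qed

text \<open>By Stone-Weierstrass on the unit circle, f is a uniform limit of trigonometric
  polynomials. It is orthogonal to each of them, hence to itself.\<close>

lemma fourier_uniqueness:
  fixes f :: "real \<Rightarrow> real"
  assumes per: "\<And>x. f (x + 2 * pi) = f x" and cont: "continuous_on UNIV f"
    and zero: "\<And>n::int. (LINT x:{0..2 * pi}|lborel. complex_of_real (f x) * cis (- (of_int n * x))) = 0"
  shows "f x = 0"
proof -
  \<comment> \<open>The multipliers h for which f h is still orthogonal to every character. They
    form a complex vector space stable under multiplication by characters.\<close>
  define H where "H = {h :: real \<Rightarrow> complex. continuous_on UNIV h \<and>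
     (\<forall>n::int. (LINT x:{0..2 * pi}|lborel. of_real (f x) * (h x * cis (of_int n * x))) = 0)}"
  have ci: "set_integrable lborel {0..2 * pi} g" if "continuous_on UNIV g" for g :: "real \<Rightarrow> complex"
    by (rule borel_integrable_atLeastAtMost') (rule continuous_on_subset[OF that], simp)
  have cn: "continuous_on UNIV (\<lambda>x. of_real (f x) * (h x * cis (of_int n * x)))" if "continuous_on UNIV h" for h and n :: int
    by (intro continuous_intros that cont)
  have H_add: "(\<lambda>x. h x + h' x) \<in> H" if "h \<in> H" "h' \<in> H" for h h'
    using that ci[OF cn[of h]] ci[OF cn[of h']]
    by (auto simp: H_def distrib_left distrib_right continuous_on_add set_integral_add(2))
  have H_mult: "(\<lambda>x. c * h x) \<in> H" if "h \<in> H" for h c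
  proof -
    have *: "of_real (f x) * (c * h x * cis (of_int n * x)) = c * (of_real (f x) * (h x * cis (of_int n * x)))" for x and n :: int
      by (simp add: mult_ac)
    show ?thesis
      using that unfolding H_def by (auto intro!: continuous_intros simp only: mem_Collect_eq * set_integral_mult_right) auto
  qed
  have H_cis: "(\<lambda>x. cis (of_int m * x) * h x) \<in> H" if "h \<in> H" for h and m :: int
  proof -
    have *: "of_real (f x) * (cis (of_int m * x) * h x * cis (of_int n * x)) = of_real (f x) * (h x * cis (of_int (m + n) * x))" for x and n :: int
      by (simp add: cis_mult ring_distribs)
    show ?thesis
      using that unfolding H_def mem_Collect_eq * by (auto intro!: continuous_intros simp del: of_int_add)
  qed
  \<comment> \<open>Phrased as stability of \<open>H\<close> under multiplication by g, rather than
    as membership of g in \<open>H\<close>, because stability is preserved by products, as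
    Stone-Weierstrass requires; applied to the constant 1 it returns membership.\<close>
  define Pf where "Pf g \<longleftrightarrow> continuous_on (sphere 0 1) g \<and> (\<forall>h\<in>H. (\<lambda>x. of_real (g (cis x)) * h x) \<in> H)" for g :: "complex \<Rightarrow> real"
  have PRe: "Pf Re"
    unfolding Pf_def
  proof (intro conjI ballI)
    show "continuous_on (sphere 0 1) Re" by (intro continuous_intros)
    fix h assume h: "h \<in> H"
    have "(\<lambda>x. (1/2) * (cis (of_int 1 * x) * h x + cis (of_int (-1) * x) * h x)) \<in> H"
      by (intro H_mult H_add H_cis h)
    moreover have "(1/2) * (cis (of_int 1 * x) * h x + cis (of_int (-1) * x) * h x) = of_real (Re (cis x)) * h x" for x
    proof -
      have "cis (of_int 1 * x) + cis (of_int (-1) * x) = 2 * of_real (Re (cis x))"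
        by (simp add: complex_eq_iff)
      then show ?thesis by (metis (no_types, lifting) distrib_right mult.assoc mult.left_commute mult_1 nonzero_eq_divide_eq times_divide_eq_left zero_neq_numeral)
    qed
    ultimately show "(\<lambda>x. of_real (Re (cis x)) * h x) \<in> H" by simp
  qed
  have PIm: "Pf Im"
    unfolding Pf_def
  proof (intro conjI ballI)
    show "continuous_on (sphere 0 1) Im" by (intro continuous_intros)
    fix h assume h: "h \<in> H"
    have "(\<lambda>x. (-\<i>/2) * (cis (of_int 1 * x) * h x + (-1) * (cis (of_int (-1) * x) * h x))) \<in> H"
      by (intro H_mult H_add H_cis h)
    moreover have "(-\<i>/2) * (cis (of_int 1 * x) * h x + (-1) * (cis (of_int (-1) * x) * h x)) = of_real (Im (cis x)) * h x" for x
    proof -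
      have "(-\<i>/2) * (cis (of_int 1 * x) - cis (of_int (-1) * x)) = of_real (Im (cis x))"
        by (simp add: complex_eq_iff)
      then show ?thesis by (metis (no_types, lifting) left_diff_distrib mult.assoc mult_minus1 uminus_add_conv_diff add.commute)
    qed
    ultimately show "(\<lambda>x. of_real (Im (cis x)) * h x) \<in> H" by simp
  qed
  define F where "F z = f (Arg z)" for z
  have F: "F (cis x) = f x" for x
    unfolding F_def by (rule periodic_cong_cis[of f, OF per]) (metis cis_Arg cis_neq_zero norm_cis sgn_div_norm divide_self_if scaleR_one div_by_1 inverse_1)
  have cF: "continuous_on (sphere 0 1) F"
    unfolding F_def by (intro continuous_at_imp_continuous_on ballI periodic_isCont_Arg[of f, OF per cont]) auto
  have 1: "(\<lambda>x. 1) \<in> H"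
  proof -
    have "(LINT x:{0..2 * pi}|lborel. of_real (f x) * (1 * cis (of_int n * x))) = 0" for n :: int
      using zero[of "- n"] by simp
    then show ?thesis by (simp add: H_def)
  qed
  have app: "\<exists>g. Pf g \<and> (\<forall>z\<in>sphere 0 1. \<bar>F z - g z\<bar> < e)" if "e > 0" for e
  proof (rule Stone_Weierstrass_HOL[where P = Pf, OF compact_sphere _ _ _ _ _ cF that])
    show "Pf (\<lambda>x. c)" for c by (auto simp: Pf_def H_mult)
    show "continuous_on (sphere 0 1) g" if "Pf g" for g using that by (simp add: Pf_def)
    show "Pf (\<lambda>x. g x + g' x)" if "Pf g \<and> Pf g'" for g g'
      using that H_add by (fastforce simp: Pf_def distrib_right intro: continuous_on_add)
    show "Pf (\<lambda>x. g x * g' x)" if "Pf g \<and> Pf g'" for g g'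
      using that by (auto simp: Pf_def mult.assoc intro!: continuous_on_mult)
    show "\<exists>g. Pf g \<and> g z \<noteq> g w" if "z \<in> sphere 0 1 \<and> w \<in> sphere 0 1 \<and> z \<noteq> w" for z w
      using that PRe PIm by (auto simp: complex_eq_iff)
  qed
  have fc: "continuous_on {0..2 * pi} f" by (rule continuous_on_subset[OF cont]) simp
  have fi: "set_integrable lborel {0..2 * pi} f" "set_integrable lborel {0..2 * pi} (\<lambda>x. \<bar>f x\<bar>)" "set_integrable lborel {0..2 * pi} (\<lambda>x. f x * f x)"
    by (intro borel_integrable_atLeastAtMost' continuous_intros fc)+
  define K where "K = (LINT x:{0..2 * pi}|lborel. \<bar>f x\<bar>)"
  \<comment> \<open>The approximant h is orthogonal to f, so the integral of f^2 equals that of f (f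
    - h), and |f - h| < e.\<close>
  have le: "(LINT x:{0..2 * pi}|lborel. f x * f x) \<le> e * K" if "e > 0" for e
  proof -
    obtain g where g: "Pf g" "\<And>z. z \<in> sphere 0 1 \<Longrightarrow> \<bar>F z - g z\<bar> < e"
      using app[OF \<open>e > 0\<close>] by blast
    define h where "h x = g (cis x)" for x
    have "(\<lambda>x. of_real (h x) * 1) \<in> H" using g(1)[unfolded Pf_def, THEN conjunct2, rule_format, OF 1] unfolding h_def .
    then have "(LINT x:{0..2 * pi}|lborel. of_real (f x) * (of_real (h x) * 1 * cis (of_int 0 * x))) = 0" and "continuous_on UNIV (\<lambda>x. complex_of_real (h x))"
      unfolding H_def by (blast, simp)
    then have h0: "(LINT x:{0..2 * pi}|lborel. f x * h x) = 0" and ch: "continuous_on {0..2 * pi} h"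
      using continuous_on_Re[of UNIV "\<lambda>x. complex_of_real (h x)"]
      by (auto simp flip: of_real_mult simp: set_integral_complex_of_real intro: continuous_on_subset)
    have "(LINT x:{0..2 * pi}|lborel. f x * f x) = (LINT x:{0..2 * pi}|lborel. f x * f x) - (LINT x:{0..2 * pi}|lborel. f x * h x)"
      using h0 by simp
    also have "\<dots> = (LINT x:{0..2 * pi}|lborel. f x * f x - f x * h x)"
      by (intro set_integral_diff(2)[symmetric] borel_integrable_atLeastAtMost' continuous_intros fc ch)
    also have "\<dots> \<le> (LINT x:{0..2 * pi}|lborel. e * \<bar>f x\<bar>)"
    proof (intro set_integral_mono borel_integrable_atLeastAtMost' continuous_intros fc ch)
      fix x
      have "f x * f x - f x * h x \<le> \<bar>f x\<bar> * \<bar>f x - h x\<bar>"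
        by (metis abs_ge_self abs_mult right_diff_distrib)
      also have "\<dots> \<le> \<bar>f x\<bar> * e"
        using g(2)[of "cis x"] by (intro mult_left_mono) (auto simp: F h_def)
      finally show "f x * f x - f x * h x \<le> e * \<bar>f x\<bar>" by (simp add: mult.commute)
    qed
    finally show ?thesis by (simp add: K_def)
  qed
  have K: "K \<ge> 0" unfolding K_def using set_integral_norm_nonneg[of _ _ f] by simp
  have le0: "(LINT x:{0..2 * pi}|lborel. f x * f x) \<le> 0"
  proof (rule field_le_epsilon)
    fix e :: real assume "e > 0"
    then have "(LINT x:{0..2 * pi}|lborel. f x * f x) \<le> e / (K + 1) * K" using K by (intro le) auto
    also have "\<dots> \<le> e" using K \<open>e > 0\<close> by (simp add: field_simps)
    finally show "(LINT x:{0..2 * pi}|lborel. f x * f x) \<le> 0 + e" by simp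
  qed
  have "0 \<le> (LINT x:{0..2 * pi}|lborel. f x * f x)"
    by (auto simp: set_lebesgue_integral_def intro!: Bochner_Integration.integral_nonneg)
  with le0 have "integral {0..2 * pi} (\<lambda>x. f x * f x) = 0"
    using set_borel_integral_eq_integral(2)[OF fi(3)] by simp
  then have hi: "((\<lambda>x. f x * f x) has_integral 0) (cbox 0 (2 * pi))"
    using set_borel_integral_eq_integral(1)[OF fi(3)] by (metis cbox_interval integrable_integral)
  have f0: "f x = 0" if "x \<in> {0..2 * pi}" for x
  proof -
    have "f x * f x = 0"
      by (rule has_integral_0_cbox_imp_0[OF _ _ hi]) (use that pi_gt_zero in \<open>auto intro!: continuous_intros fc simp: not_le\<close>)
    then show ?thesis by simp
  qed
  define k where "k = \<lfloor>x / (2 * pi)\<rfloor>"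
  have "x + 2 * pi * of_int (- k) \<in> {0..2 * pi}"
  proof -
    have "of_int k \<le> x / (2 * pi)" "x / (2 * pi) < of_int k + 1"
      unfolding k_def by linarith+
    then show ?thesis by (auto simp: field_simps)
  qed
  then show ?thesis using f0 periodic_of_int[of f, OF per, of x "- k"] by simp
qed

section \<open>Fubini on the period cell and modes of integrable functions\<close>

lemma LINT_cis:
  "(LINT x:{0..2 * pi}|lborel. cis (of_int m * x)) = (if m = 0 then of_real (2 * pi) else 0)"
proof (cases "m = 0")
  case False
  define F where "F x = (- \<i> / of_int m) * cis (of_int m * x)" for x
  have "(LINT x:{0..2 * pi}|lborel. cis (of_int m * x)) = F (2 * pi) - F 0"
    unfolding set_lebesgue_integral_def
  proof (rule integral_FTC_atLeastAtMost)
    show "(F has_vector_derivative cis (of_int m * x)) (at x within {0..2 * pi})" for x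
      unfolding F_def using False
      by (auto intro!: derivative_eq_intros simp: has_vector_derivative_def scaleR_conv_of_real mult_ac)
    show "continuous_on {0..2 * pi} (\<lambda>x. cis (of_int m * x))" by (intro continuous_intros)
  qed auto
  also have "cis (of_int m * (2 * pi)) = 1"
    using cis_multiple_2pi[of "of_int m"] by (simp add: mult_ac)
  then have "F (2 * pi) - F 0 = 0" by (simp add: F_def)
  finally show ?thesis using False by simp
qed (simp add: set_lebesgue_integral_def scaleR_conv_of_real)

lemma indicator_cell: "indicator cell (x, y) = indicator {0..2 * pi} x * (indicator {-1..0} y :: real)"
  by (auto simp: cell_def split: split_indicator)

lemma compact_cell: "compact cell"
  by (simp add: cell_def compact_Times)

lemma cell_subset_cstrip: "cell \<subseteq> cstrip"
  by (auto simp: cell_def cstrip_def)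

lemma set_integrable_cell_continuous:
  fixes v :: "real \<times> real \<Rightarrow> 'a::{banach,second_countable_topology}"
  shows "continuous_on cstrip v \<Longrightarrow> set_integrable lborel cell v"
  unfolding set_integrable_def
  by (rule borel_integrable_compact[OF compact_cell]) (rule continuous_on_subset[OF _ cell_subset_cstrip])

lemma set_integrable_cell_mult_continuous:
  fixes v p :: "real \<times> real \<Rightarrow> complex"
  assumes "set_integrable lborel cell v" "continuous_on cell p"
  shows "set_integrable lborel cell (\<lambda>z. p z * v z)"
proof -
  have "bounded (p ` cell)"
    using assms(2) compact_cell compact_continuous_image compact_imp_bounded by blast
  then obtain B where "\<And>x. x \<in> cell \<Longrightarrow> cmod (p x) \<le> B"
    by (meson bounded_iff imageI)
  then show ?thesis
    using assms by (intro set_integrable_cmult_bounded[of lborel _ v p B])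
      (auto simp: set_borel_measurable_def cell_def intro!: borel_measurable_continuous_on_indicator borel_closed closed_Times)
qed

lemma set_integrable_cell_Fubini:
  fixes G :: "real \<times> real \<Rightarrow> 'a::{banach,second_countable_topology}"
  assumes "set_integrable lborel cell G"
  shows "AE y in lborel. y \<in> {-1..0} \<longrightarrow> set_integrable lborel {0..2 * pi} (\<lambda>x. G (x, y))"
    and "set_integrable lborel {-1..0} (\<lambda>y. LINT x:{0..2 * pi}|lborel. G (x, y))"
    and "(LINT z:cell|lborel. G z) = (LINT y:{-1..0}|lborel. LINT x:{0..2 * pi}|lborel. G (x, y))"
proof -
  have K: "integrable (lborel \<Otimes>\<^sub>M lborel) (case_prod (\<lambda>x y. indicator cell (x, y) *\<^sub>R G (x, y)))"
    using assms by (simp add: set_integrable_def lborel_prod case_prod_beta')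
  have eq: "indicator cell (x, y) *\<^sub>R G (x, y) = indicator {-1..0} y *\<^sub>R (indicator {0..2 * pi} x *\<^sub>R G (x, y))" for x y
    by (simp add: indicator_cell)
  show "AE y in lborel. y \<in> {-1..0} \<longrightarrow> set_integrable lborel {0..2 * pi} (\<lambda>x. G (x, y))"
    using lborel_pair.AE_integrable_snd[OF K]
    by eventually_elim (auto simp: eq set_integrable_def)
  have eq2: "(LINT x|lborel. indicator cell (x, y) *\<^sub>R G (x, y)) = indicator {-1..0} y *\<^sub>R (LINT x:{0..2 * pi}|lborel. G (x, y))" for y
    by (simp only: eq integral_scaleR_right set_lebesgue_integral_def)
  show "set_integrable lborel {-1..0} (\<lambda>y. LINT x:{0..2 * pi}|lborel. G (x, y))"
    using lborel_pair.integrable_snd[OF K] unfolding eq2 by (simp add: set_integrable_def)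
  show "(LINT z:cell|lborel. G z) = (LINT y:{-1..0}|lborel. LINT x:{0..2 * pi}|lborel. G (x, y))"
    using lborel_pair.integral_snd[OF K] unfolding eq2
    by (simp add: set_lebesgue_integral_def lborel_prod case_prod_beta')
qed

text \<open>The passage between the strip and a single mode: testing v with p(x2) exp (- i n x1) is
  testing its n-th mode with p.\<close>

lemma fourier1_Fubini:
  fixes v :: "real \<times> real \<Rightarrow> real"
  assumes v: "set_integrable lborel cell v" and p: "continuous_on {-1..0} p"
  shows "set_integrable lborel cell (\<lambda>z. p (snd z) * cis (- (of_int n * fst z)) * of_real (v z))"
    and "set_integrable lborel {-1..0} (\<lambda>y. p y * fourier1 v n y)"
    and "(LINT z:cell|lborel. p (snd z) * cis (- (of_int n * fst z)) * of_real (v z)) =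
      of_real (2 * pi) * (LINT y:{-1..0}|lborel. p y * fourier1 v n y)"
proof -
  define G where "G z = p (snd z) * cis (- (of_int n * fst z)) * of_real (v z)" for z
  have "set_integrable lborel cell (\<lambda>z. complex_of_real (v z))"
    using integrable_of_real[OF v[unfolded set_integrable_def], where 'a = complex]
    by (simp add: set_integrable_def scaleR_conv_of_real)
  then have G: "set_integrable lborel cell G"
    unfolding G_def[abs_def]
    by (rule set_integrable_cell_mult_continuous)
      (auto simp: cell_def intro!: continuous_intros continuous_on_compose2[OF p])
  then show "set_integrable lborel cell (\<lambda>z. p (snd z) * cis (- (of_int n * fst z)) * of_real (v z))"
    by (simp add: G_def[abs_def])
  have eq: "(LINT x:{0..2 * pi}|lborel. G (x, y)) = of_real (2 * pi) * (p y * fourier1 v n y)" for y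
  proof -
    have "(LINT x:{0..2 * pi}|lborel. G (x, y)) = (LINT x:{0..2 * pi}|lborel. p y * (of_real (v (x, y)) * cis (- (of_int n * x))))"
      by (simp add: G_def mult_ac)
    also have "\<dots> = p y * (LINT x:{0..2 * pi}|lborel. of_real (v (x, y)) * cis (- (of_int n * x)))"
      by (rule set_integral_mult_right)
    finally show ?thesis
      by (simp add: fourier1_def scaleR_conv_of_real)
  qed
  show "set_integrable lborel {-1..0} (\<lambda>y. p y * fourier1 v n y)"
    using set_integrable_cell_Fubini(2)[OF G] unfolding eq by simp
  show "(LINT z:cell|lborel. p (snd z) * cis (- (of_int n * fst z)) * of_real (v z)) =
      of_real (2 * pi) * (LINT y:{-1..0}|lborel. p y * fourier1 v n y)"
    using set_integrable_cell_Fubini(3)[OF G] unfolding eq by (simp add: G_def)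
qed

lemma fourier1_integrable:
  assumes "set_integrable lborel cell v" shows "set_integrable lborel {-1..0} (fourier1 v n)"
  using fourier1_Fubini(2)[OF assms continuous_on_const[of _ 1]] by simp

lemma norm_fourier1_le: "cmod (fourier1 v n y) \<le> (LINT x:{0..2 * pi}|lborel. \<bar>v (x, y)\<bar>)"
proof -
  have "cmod (fourier1 v n y) = 1 / (2 * pi) * cmod (LINT x:{0..2 * pi}|lborel. complex_of_real (v (x, y)) * cis (- (of_int n * x)))"
    by (simp add: fourier1_def)
  also have "\<dots> \<le> 1 * cmod (LINT x:{0..2 * pi}|lborel. complex_of_real (v (x, y)) * cis (- (of_int n * x)))"
    using pi_gt3 by (intro mult_right_mono) (auto simp: field_simps)
  also have "\<dots> \<le> (LINT x:{0..2 * pi}|lborel. \<bar>v (x, y)\<bar>)"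
    unfolding set_lebesgue_integral_def mult_1
    by (rule order_trans[OF integral_norm_bound]) (simp add: norm_mult)
  finally show ?thesis .
qed

lemma fourier1_L1_le:
  assumes v: "set_integrable lborel cell v"
  shows "(LINT y:{-1..0}|lborel. cmod (fourier1 v n y)) \<le> (LINT z:cell|lborel. \<bar>v z\<bar>)"
proof -
  have av: "set_integrable lborel cell (\<lambda>z. \<bar>v z\<bar>)"
    using v by (rule set_integrable_abs)
  have "(LINT y:{-1..0}|lborel. cmod (fourier1 v n y)) \<le> (LINT y:{-1..0}|lborel. LINT x:{0..2 * pi}|lborel. \<bar>v (x, y)\<bar>)"
    by (intro set_integral_mono set_integrable_norm fourier1_integrable v norm_fourier1_le set_integrable_cell_Fubini(2)[OF av])
  then show ?thesis by (simp add: set_integrable_cell_Fubini(3)[OF av])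
qed

text \<open>Only almost everywhere, since Fubini yields integrable sections of v and w only for
  almost every y, and additivity of the integral relies on them.\<close>

lemma fourier1_diff_AE:
  assumes "set_integrable lborel cell v" "set_integrable lborel cell w"
  shows "AE y in lborel. y \<in> {-1..0} \<longrightarrow> fourier1 (\<lambda>x. v x - w x) n y = fourier1 v n y - fourier1 w n y"
proof -
  have s: "AE y in lborel. y \<in> {-1..0} \<longrightarrow> set_integrable lborel {0..2 * pi} (\<lambda>x. cis (- (of_int n * x)) * complex_of_real (v (x, y)))"
    if "set_integrable lborel cell v" for v
    using set_integrable_cell_Fubini(1)[OF fourier1_Fubini(1)[OF that continuous_on_const[of _ 1]], of n] by simp
  show ?thesis
    using s[OF assms(1)] s[OF assms(2)]
    by eventually_elim (auto simp: fourier1_def left_diff_distrib mult.commute[of _ "cis _"] right_diff_distrib scaleR_diff_right)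
qed

lemma fourier1_cnj: "fourier1 v (- n) y = cnj (fourier1 v n y)"
proof -
  have "cnj (LINT x:{0..2 * pi}|lborel. complex_of_real (v (x, y)) * cis (- (of_int n * x))) =
      (LINT x:{0..2 * pi}|lborel. cnj (complex_of_real (v (x, y)) * cis (- (of_int n * x))))"
    unfolding set_lebesgue_integral_def complex_cnj_scaleR[symmetric] by (rule Bochner_Integration.integral_cnj[symmetric])
  then show ?thesis
    by (simp add: fourier1_def cis_cnj)
qed

section \<open>Modes of continuous and of differentiable functions\<close>

context
  fixes v :: "real \<times> real \<Rightarrow> real"
  assumes v: "continuous_on cstrip v"
begin

lemma section_continuous:
  "y \<in> {-1..0} \<Longrightarrow> continuous_on S (\<lambda>x. v (x, y))"
  by (rule continuous_on_compose2[OF v]) (auto intro!: continuous_intros simp: cstrip_def)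

lemma fourier_integrand_integrable:
  "y \<in> {-1..0} \<Longrightarrow> set_integrable lborel {0..2 * pi} (\<lambda>x. complex_of_real (v (x, y)) * cis (- (of_int n * x)))"
  by (intro borel_integrable_atLeastAtMost' continuous_intros section_continuous)

lemma fourier1_eq_integral:
  assumes "y \<in> {-1..0}"
  shows "fourier1 v n y = (1 / (2 * pi)) *\<^sub>R integral {0..2 * pi} (\<lambda>x. complex_of_real (v (x, y)) * cis (- (of_int n * x)))"
  unfolding fourier1_def set_borel_integral_eq_integral(2)[OF fourier_integrand_integrable[OF assms]] ..

lemma continuous_on_fourier_integrand:
  "continuous_on ({-1..0} \<times> {0..2 * pi}) (\<lambda>(y, x). complex_of_real (v (x, y)) * cis (- (of_int n * x)))"
  unfolding case_prod_beta'
  by (intro continuous_intros continuous_on_compose2[OF v]) (auto simp: cstrip_def)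

lemma fourier1_continuous: "continuous_on {-1..0} (fourier1 v n)"
proof -
  have "continuous_on {-1..0} (\<lambda>y. (1 / (2 * pi)) *\<^sub>R integral (cbox 0 (2 * pi)) (\<lambda>x. complex_of_real (v (x, y)) * cis (- (of_int n * x))))"
    by (intro continuous_intros integral_continuous_on_param) (use continuous_on_fourier_integrand in simp)
  then show ?thesis
    by (rule continuous_on_eq) (simp add: fourier1_eq_integral)
qed

lemma fourier1_norm_bound:
  assumes "y \<in> {-1..0}" "\<And>x. x \<in> {0..2 * pi} \<Longrightarrow> \<bar>v (x, y)\<bar> \<le> B"
  shows "cmod (fourier1 v n y) \<le> 2 * pi * B"
proof -
  have "(LINT x:{0..2 * pi}|lborel. \<bar>v (x, y)\<bar>) \<le> (LINT x:{0..2 * pi}|lborel. B)"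
    by (intro set_integral_mono borel_integrable_atLeastAtMost' continuous_intros section_continuous assms)
  also have "\<dots> = 2 * pi * B"
    by (simp add: set_lebesgue_integral_def)
  finally show ?thesis using norm_fourier1_le order_trans by blast
qed

end

text \<open>Integration by parts over one period; the boundary terms cancel by periodicity.\<close>

lemma fourier1_deriv1:
  assumes v: "continuous_on cstrip v" and v1: "continuous_on cstrip v1" and per: "periodic1 v"
    and D: "\<And>x. ((\<lambda>t. v (t, y)) has_vector_derivative v1 (x, y)) (at x)"
    and y: "y \<in> {-1..0}"
  shows "fourier1 v1 n y = \<i> * of_int n * fourier1 v n y"
proof -
  let ?e = "\<lambda>x. cis (- (of_int n * x))"
  have e: "(?e has_vector_derivative - \<i> * of_int n * ?e x) (at x)" for x
    by (auto intro!: derivative_eq_intros simp: has_vector_derivative_def scaleR_conv_of_real mult_ac)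
  have c: "continuous_on {0..2 * pi} (\<lambda>x. complex_of_real (v1 (x, y)) * ?e x)"
    "continuous_on {0..2 * pi} (\<lambda>x. complex_of_real (v (x, y)) * ?e x)"
    by (intro continuous_intros section_continuous v v1 y)+
  have "(LINT x:{0..2 * pi}|lborel. complex_of_real (v1 (x, y)) * ?e x + complex_of_real (v (x, y)) * (- \<i> * of_int n * ?e x))
      = complex_of_real (v (2 * pi, y)) * ?e (2 * pi) - complex_of_real (v (0, y)) * ?e 0"
    unfolding set_lebesgue_integral_def
  proof (rule integral_FTC_atLeastAtMost)
    show "((\<lambda>x. complex_of_real (v (x, y)) * ?e x) has_vector_derivative
        complex_of_real (v1 (x, y)) * ?e x + complex_of_real (v (x, y)) * (- \<i> * of_int n * ?e x)) (at x within {0..2 * pi})" for x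
      using has_vector_derivative_mult[OF has_vector_derivative_of_real[OF has_field_derivative_at_within[OF D[folded has_real_derivative_iff_has_vector_derivative]]] has_vector_derivative_at_within[OF e], of x "{0..2*pi}"]
      by (simp add: add.commute)
    show "continuous_on {0..2 * pi} (\<lambda>x. complex_of_real (v1 (x, y)) * ?e x + complex_of_real (v (x, y)) * (- \<i> * of_int n * ?e x))"
      by (intro continuous_intros section_continuous v v1 y)
  qed simp
  also have "\<dots> = 0"
  proof -
    have "v (2 * pi, y) = v (0, y)"
      using per unfolding periodic1_def by (metis add_0)
    moreover have "?e (2 * pi) = 1"
      using cis_multiple_2pi[of "of_int (- n)"] by (simp add: mult_ac)
    ultimately show ?thesis by simp
  qed
  also have "(LINT x:{0..2 * pi}|lborel. complex_of_real (v1 (x, y)) * ?e x + complex_of_real (v (x, y)) * (- \<i> * of_int n * ?e x)) =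
      (LINT x:{0..2 * pi}|lborel. complex_of_real (v1 (x, y)) * ?e x) - \<i> * of_int n * (LINT x:{0..2 * pi}|lborel. complex_of_real (v (x, y)) * ?e x)"
  proof -
    have "complex_of_real (v (x, y)) * (- \<i> * of_int n * ?e x) = (- \<i> * of_int n) * (complex_of_real (v (x, y)) * ?e x)" for x
      by (simp add: mult_ac)
    moreover have "set_integrable lborel {0..2 * pi} (\<lambda>x. (- \<i> * of_int n) * (complex_of_real (v (x, y)) * ?e x))"
      by (intro borel_integrable_atLeastAtMost' continuous_intros section_continuous v v1 y)
    ultimately show ?thesis
      using set_integral_add(2)[OF borel_integrable_atLeastAtMost'[OF c(1)], of "\<lambda>x. (- \<i> * of_int n) * (complex_of_real (v (x, y)) * ?e x)"]
      by (simp only: set_integral_mult_right) simp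
  qed
  finally have "(LINT x:{0..2 * pi}|lborel. complex_of_real (v1 (x, y)) * ?e x) = \<i> * of_int n * (LINT x:{0..2 * pi}|lborel. complex_of_real (v (x, y)) * ?e x)"
    by simp
  then show ?thesis by (simp add: fourier1_def)
qed

text \<open>Differentiation under the integral sign, one-sided at the two ends of the
  interval.\<close>

lemma fourier1_deriv2:
  assumes v: "continuous_on cstrip v" and v2: "continuous_on cstrip v2"
    and D: "\<And>x y. y \<in> {-1..0} \<Longrightarrow> ((\<lambda>t. v (x, t)) has_vector_derivative v2 (x, y)) (at y within {-1..0})"
  shows "abs_cont (fourier1 v n) (fourier1 v2 n)"
proof (rule abs_cont_of_derivative)
  show "continuous_on {-1..0} (fourier1 v2 n)" by (rule fourier1_continuous[OF v2])
  fix y :: real assume y: "y \<in> {-1..0}"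
  have "((\<lambda>y. integral (cbox 0 (2 * pi)) (\<lambda>x. complex_of_real (v (x, y)) * cis (- (of_int n * x)))) has_vector_derivative
      integral (cbox 0 (2 * pi)) (\<lambda>x. complex_of_real (v2 (x, y)) * cis (- (of_int n * x)))) (at y within {-1..0})"
  proof (rule leibniz_rule_vector_derivative[OF _ _ _ y])
    show "((\<lambda>y. complex_of_real (v (x, y)) * cis (- (of_int n * x))) has_vector_derivative
        complex_of_real (v2 (x, t)) * cis (- (of_int n * x))) (at t within {-1..0})" if "t \<in> {-1..0}" for t x
      by (intro has_vector_derivative_mult_left has_vector_derivative_of_real
          D[folded has_real_derivative_iff_has_vector_derivative] that)
    show "(\<lambda>x. complex_of_real (v (x, t)) * cis (- (of_int n * x))) integrable_on cbox 0 (2 * pi)" if "t \<in> {-1..0}" for t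
      using set_borel_integral_eq_integral(1)[OF fourier_integrand_integrable[OF v that]] by simp
    show "continuous_on ({-1..0} \<times> cbox 0 (2 * pi)) (\<lambda>(y, x). complex_of_real (v2 (x, y)) * cis (- (of_int n * x)))"
      using continuous_on_fourier_integrand[OF v2] by simp
  qed simp
  then have "((\<lambda>y. (1 / (2 * pi)) *\<^sub>R integral (cbox 0 (2 * pi)) (\<lambda>x. complex_of_real (v (x, y)) * cis (- (of_int n * x)))) has_vector_derivative
      fourier1 v2 n y) (at y within {-1..0})"
    using y by (auto intro!: derivative_eq_intros simp: fourier1_eq_integral[OF v2])
  then show "(fourier1 v n has_vector_derivative fourier1 v2 n y) (at y within {-1..0})"
    by (rule has_vector_derivative_transform[OF y, rotated]) (simp add: fourier1_eq_integral[OF v])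
qed

subsection \<open>Smooth functions on the strip\<close>

text \<open>Partial derivatives of smooth functions, read off from the total derivative on the whole
  plane, so that they can be iterated; \<open>pd2\<close> is one-sided and meaningful only on the
  closed strip.\<close>

definition d1 :: "(real \<times> real \<Rightarrow> real) \<Rightarrow> real \<times> real \<Rightarrow> real" where
  "d1 v z = frechet_derivative v (at z) (1, 0)"

definition d2 :: "(real \<times> real \<Rightarrow> real) \<Rightarrow> real \<times> real \<Rightarrow> real" where
  "d2 v z = frechet_derivative v (at z) (0, 1)"

lemma smooth_d1: "smooth v \<Longrightarrow> smooth (d1 v)" and smooth_d2: "smooth v \<Longrightarrow> smooth (d2 v)"
  unfolding d1_def[abs_def] d2_def[abs_def] by (rule smooth_frechet, assumption)+

lemma has_derivative_lines:
  fixes v :: "real \<times> real \<Rightarrow> real"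
  assumes "(v has_derivative v') (at (x, y) within S \<times> T)" "x \<in> S" "y \<in> T"
  shows "((\<lambda>t. v (t, y)) has_vector_derivative v' (1, 0)) (at x within S)"
    and "((\<lambda>t. v (x, t)) has_vector_derivative v' (0, 1)) (at y within T)"
proof -
  have lin: "linear v'" using assms(1) has_derivative_linear by blast
  have 1: "((\<lambda>t. (t, y)) has_derivative (\<lambda>h. (h, 0))) (at x within S)"
    by (auto intro!: derivative_eq_intros)
  have "((\<lambda>t. v (t, y)) has_derivative (\<lambda>h. v' (h, 0))) (at x within S)"
    by (rule has_derivative_in_compose[OF 1], rule has_derivative_subset[OF assms(1)]) (use assms(3) in auto)
  moreover have "(\<lambda>h. v' (h, 0)) = (\<lambda>h. h *\<^sub>R v' (1, 0))"
  proof
    show "v' (h, 0) = h *\<^sub>R v' (1, 0)" for h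
      using linear_scale[OF lin, of h "(1, 0)"] by simp
  qed
  ultimately show "((\<lambda>t. v (t, y)) has_vector_derivative v' (1, 0)) (at x within S)"
    by (simp only: has_vector_derivative_def)
  have 2: "((\<lambda>t. (x, t)) has_derivative (\<lambda>h. (0, h))) (at y within T)"
    by (auto intro!: derivative_eq_intros)
  have "((\<lambda>t. v (x, t)) has_derivative (\<lambda>h. v' (0, h))) (at y within T)"
    by (rule has_derivative_in_compose[OF 2], rule has_derivative_subset[OF assms(1)]) (use assms(2) in auto)
  moreover have "(\<lambda>h. v' (0, h)) = (\<lambda>h. h *\<^sub>R v' (0, 1))"
  proof
    show "v' (0, h) = h *\<^sub>R v' (0, 1)" for h
      using linear_scale[OF lin, of h "(0, 1)"] by simp
  qed
  ultimately show "((\<lambda>t. v (x, t)) has_vector_derivative v' (0, 1)) (at y within T)"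
    by (simp only: has_vector_derivative_def)
qed

lemma smooth_lines:
  fixes v :: "real \<times> real \<Rightarrow> real"
  assumes "smooth v"
  shows "((\<lambda>t. v (t, y)) has_vector_derivative d1 v (x, y)) (at x)"
    and "((\<lambda>t. v (x, t)) has_vector_derivative d2 v (x, y)) (at y within T)"
  using has_derivative_lines[of v _ x y UNIV UNIV] smooth_has_derivative[OF assms, of "(x, y)"]
  by (auto simp: d1_def d2_def intro: has_vector_derivative_at_within)

lemma pd1_eqI: "((\<lambda>t. v (t, y)) has_vector_derivative c) (at x) \<Longrightarrow> pd1 v (x, y) = c"
  by (simp add: pd1_def vector_derivative_at)

lemma pd2_eqI:
  assumes "((\<lambda>t. v (x, t)) has_vector_derivative c) (at y within {-1..0})" "y \<in> {-1..0}"
  shows "pd2 v (x, y) = c"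
  using assms by (simp add: pd2_def vector_derivative_within_closed_interval)

lemma smooth_pd1: "smooth v \<Longrightarrow> pd1 v = d1 v"
  using pd1_eqI[OF smooth_lines(1)[of v]] by (auto simp: fun_eq_iff)

lemma smooth_pd2: "smooth v \<Longrightarrow> z \<in> cstrip \<Longrightarrow> pd2 v z = d2 v z"
  by (cases z) (auto simp: cstrip_def intro!: pd2_eqI smooth_lines(2))

lemma periodic1_d1:
  assumes "smooth v" "periodic1 v" shows "periodic1 (d1 v)"
  unfolding periodic1_def
proof (intro allI)
  fix x y
  have "((\<lambda>t. t + 2 * pi) has_vector_derivative 1) (at x)"
    by (auto intro!: derivative_eq_intros)
  then have "((\<lambda>t. v (t + 2 * pi, y)) has_vector_derivative d1 v (x + 2 * pi, y)) (at x)"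
    using smooth_lines(1)[OF assms(1), of y "x + 2 * pi"]
      vector_diff_chain_at[of "\<lambda>t. t + 2 * pi" 1 x "\<lambda>t. v (t, y)" "d1 v (x + 2 * pi, y)"]
    by (simp add: o_def)
  then have "((\<lambda>t. v (t, y)) has_vector_derivative d1 v (x + 2 * pi, y)) (at x)"
    using assms(2) by (simp add: periodic1_def)
  then show "d1 v (x + 2 * pi, y) = d1 v (x, y)"
    using smooth_lines(1)[OF assms(1)] vector_derivative_unique_at by blast
qed

lemma periodic1_d2:
  assumes "smooth v" "periodic1 v" shows "periodic1 (d2 v)"
  unfolding periodic1_def
proof (intro allI)
  fix x y
  have "((\<lambda>t. v (x, t)) has_vector_derivative d2 v (x + 2 * pi, y)) (at y)"
    using smooth_lines(2)[OF assms(1), of "x + 2 * pi" y UNIV] assms(2) by (simp add: periodic1_def)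
  then show "d2 v (x + 2 * pi, y) = d2 v (x, y)"
    using smooth_lines(2)[OF assms(1), of x y UNIV] vector_derivative_unique_at by blast
qed

lemma smooth_fourier1_d1:
  assumes "smooth v" "periodic1 v" "y \<in> {-1..0}"
  shows "fourier1 (d1 v) n y = \<i> * of_int n * fourier1 v n y"
  using assms by (intro fourier1_deriv1 smooth_continuous smooth_d1 smooth_lines)

lemma smooth_fourier1_d2:
  assumes "smooth v"
  shows "abs_cont (fourier1 v n) (fourier1 (d2 v) n)"
  using assms by (intro fourier1_deriv2 smooth_continuous smooth_d2 smooth_lines)

text \<open>Two x1-derivatives bring down n^2. Adding the plain bound on v gives the denominator 1 +
  n^2, which includes n = 0.\<close>

lemma smooth_fourier1_decay:
  assumes "smooth v" "periodic1 v"
  obtains C where "\<And>n y. y \<in> {-1..0} \<Longrightarrow> cmod (fourier1 v n y) \<le> C / (1 + real_of_int n ^ 2)"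
proof -
  have bdd: "\<exists>B. \<forall>z\<in>cell. \<bar>h z\<bar> \<le> B" if "smooth h" for h :: "real \<times> real \<Rightarrow> real"
  proof -
    have "bounded (h ` cell)"
      by (intro compact_imp_bounded compact_continuous_image compact_cell smooth_continuous that)
    then show ?thesis by (auto simp: bounded_iff)
  qed
  obtain B where B: "\<And>z. z \<in> cell \<Longrightarrow> \<bar>v z\<bar> \<le> B" using bdd[OF assms(1)] by blast
  obtain B' where B': "\<And>z. z \<in> cell \<Longrightarrow> \<bar>d1 (d1 v) z\<bar> \<le> B'"
    using bdd[OF smooth_d1[OF smooth_d1[OF assms(1)]]] by blast
  have "cmod (fourier1 v n y) \<le> 2 * pi * (B + B') / (1 + real_of_int n ^ 2)" if y: "y \<in> {-1..0}" for n y
  proof -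
    have "cmod (fourier1 v n y) \<le> 2 * pi * B"
      by (intro fourier1_norm_bound smooth_continuous assms y B) (use y in \<open>auto simp: cell_def\<close>)
    moreover have "cmod (fourier1 (d1 (d1 v)) n y) \<le> 2 * pi * B'"
      by (intro fourier1_norm_bound smooth_continuous smooth_d1 assms y B') (use y in \<open>auto simp: cell_def\<close>)
    moreover have "fourier1 (d1 (d1 v)) n y = - (of_int n ^ 2 * fourier1 v n y)"
      by (simp add: smooth_fourier1_d1[OF smooth_d1[OF assms(1)] periodic1_d1[OF assms] y]
          smooth_fourier1_d1[OF assms y] power2_eq_square mult_ac)
    ultimately have "cmod (fourier1 v n y) * (1 + real_of_int n ^ 2) \<le> 2 * pi * (B + B')"
      by (simp add: norm_mult norm_power ring_distribs mult.commute)
    moreover have "1 + real_of_int n ^ 2 > 0" by (simp add: add_pos_nonneg)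
    ultimately show ?thesis by (simp add: pos_le_divide_eq)
  qed
  then show ?thesis by (rule that)
qed

section \<open>Fourier series on the strip\<close>

text \<open>The integers are enumerated by \<^const>\<open>int_decode\<close>, and real parts are taken termwise so that
  the sum is real without any hypothesis; \<open>a\<close> is the family of Fourier coefficients only if
  \<open>a (- n) = cnj (a n)\<close>.\<close>

definition fourier_series :: "(int \<Rightarrow> real \<Rightarrow> complex) \<Rightarrow> real \<times> real \<Rightarrow> real" where
  "fourier_series a z = (\<Sum>k. Re (a (int_decode k) (snd z) * cis (of_int (int_decode k) * fst z)))"

lemma cis_of_int_2pi: "cis (of_int n * (x + 2 * pi)) = cis (of_int n * x)"
proof -
  have "cis (of_int n * (x + 2 * pi)) = cis (of_int n * x) * cis (2 * pi * of_int n)"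
    by (simp add: cis_mult algebra_simps)
  then show ?thesis by (simp add: cis_multiple_2pi)
qed

lemma periodic1_fourier_series: "periodic1 (fourier_series a)"
  by (simp only: periodic1_def fourier_series_def fst_conv snd_conv cis_of_int_2pi) simp

locale fourier_coefficients =
  fixes a :: "int \<Rightarrow> real \<Rightarrow> complex" and M :: "int \<Rightarrow> real"
  assumes cont: "\<And>n. continuous_on {-1..0} (a n)"
    and bound: "\<And>n y. y \<in> {-1..0} \<Longrightarrow> cmod (a n y) \<le> M n"
    and summable: "summable (\<lambda>k. M (int_decode k))"
begin

definition fterm :: "nat \<Rightarrow> real \<times> real \<Rightarrow> real" where
  "fterm k z = Re (a (int_decode k) (snd z) * cis (of_int (int_decode k) * fst z))"

lemma fterm_bound:
  assumes "z \<in> cstrip" shows "\<bar>fterm k z\<bar> \<le> M (int_decode k)"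
proof -
  have "\<bar>fterm k z\<bar> \<le> cmod (a (int_decode k) (snd z) * cis (of_int (int_decode k) * fst z))"
    unfolding fterm_def by (rule abs_Re_le_cmod)
  also have "\<dots> \<le> M (int_decode k)"
    using bound[of "snd z" "int_decode k"] assms by (auto simp: norm_mult cstrip_def)
  finally show ?thesis .
qed

lemma fterm_continuous: "continuous_on cstrip (fterm k)"
  unfolding fterm_def[abs_def]
  by (intro continuous_intros continuous_on_compose2[OF cont]) (auto simp: cstrip_def)

lemma uniform_limit_fterm:
  "uniform_limit cstrip (\<lambda>n z. \<Sum>k<n. fterm k z) (fourier_series a) sequentially"
  unfolding fourier_series_def[abs_def] fterm_def[symmetric]
  by (rule Weierstrass_m_test[OF _ summable]) (use fterm_bound in auto)

lemma fterm_sums: "z \<in> cstrip \<Longrightarrow> (\<lambda>k. fterm k z) sums fourier_series a z"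
  using tendsto_uniform_limitI[OF uniform_limit_fterm] by (simp add: sums_def)

lemma fourier_series_continuous: "continuous_on cstrip (fourier_series a)"
  by (rule uniform_limit_theorem[OF _ uniform_limit_fterm])
    (auto intro!: always_eventually continuous_on_sum fterm_continuous)

text \<open>The real part of a(j) exp (i j x) contains the frequencies j and -j, each with half
  weight; hence two possible contributions and pi in place of 2 pi.\<close>

lemma LINT_fterm:
  assumes "y \<in> {-1..0}"
  shows "(LINT x:{0..2 * pi}|lborel. of_real (fterm k (x, y)) * cis (- (of_int n * x))) =
     of_real pi * ((if int_decode k = n then a n y else 0) + (if int_decode k = - n then cnj (a (- n) y) else 0))"
proof -
  define j where "j = int_decode k"
  have "of_real (fterm k (x, y)) * cis (- (of_int n * x)) =
      a j y / 2 * cis (of_int (j - n) * x) + cnj (a j y) / 2 * cis (of_int (- j - n) * x)" for x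
  proof -
    have X: "complex_of_real (fterm k (x, y)) = (a j y * cis (of_int j * x) + cnj (a j y) * cis (- (of_int j * x))) / 2"
      using complex_add_cnj[of "a j y * cis (of_int j * x)"] by (simp add: fterm_def j_def cis_cnj)
    have "of_real (fterm k (x, y)) * cis (- (of_int n * x)) =
        a j y / 2 * (cis (of_int j * x) * cis (- (of_int n * x))) + cnj (a j y) / 2 * (cis (- (of_int j * x)) * cis (- (of_int n * x)))"
      unfolding X by (simp add: algebra_simps add_divide_distrib)
    then show ?thesis by (simp add: cis_mult algebra_simps)
  qed
  then have "(LINT x:{0..2 * pi}|lborel. of_real (fterm k (x, y)) * cis (- (of_int n * x))) =
      (LINT x:{0..2 * pi}|lborel. a j y / 2 * cis (of_int (j - n) * x)) + (LINT x:{0..2 * pi}|lborel. cnj (a j y) / 2 * cis (of_int (- j - n) * x))"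
    by (simp only:) (intro set_integral_add(2) borel_integrable_atLeastAtMost' continuous_intros)
  also have "\<dots> = a j y / 2 * (if j - n = 0 then of_real (2 * pi) else 0) + cnj (a j y) / 2 * (if - j - n = 0 then of_real (2 * pi) else 0)"
    by (simp only: set_integral_mult_right LINT_cis)
  finally show ?thesis by (auto simp: j_def ring_distribs)
qed

text \<open>Frequency n receives one half from index n and the other from index -n. Hermitian
  symmetry makes the two halves equal; for n = 0 both come from the same term.\<close>

lemma fourier1_fourier_series:
  assumes y: "y \<in> {-1..0}" and herm: "a (- n) y = cnj (a n y)"
  shows "fourier1 (fourier_series a) n y = a n y"
proof -
  define f where "f k x = indicator {0..2 * pi} x *\<^sub>R (complex_of_real (fterm k (x, y)) * cis (- (of_int n * x)))" for k x
  have yx: "(x, y) \<in> cstrip" for x using y by (simp add: cstrip_def)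
  have fi: "integrable lborel (f k)" for k
    using fourier_integrand_integrable[OF fterm_continuous y] by (simp add: f_def[abs_def] set_integrable_def)
  have fb: "norm (f k x) \<le> indicator {0..2 * pi} x * M (int_decode k)" for k x
    using fterm_bound[OF yx, of k x] by (auto simp: f_def norm_mult split: split_indicator)
  have "(\<lambda>k. integral\<^sup>L lborel (f k)) sums (LINT x|lborel. (\<Sum>k. f k x))"
  proof (rule sums_integral[OF fi])
    have "summable (\<lambda>k. norm (f k x))" for x
      by (rule summable_comparison_test'[OF summable_mult[OF summable, of "indicator {0..2 * pi} x"]]) (use fb in simp)
    then show "AE x in lborel. summable (\<lambda>k. norm (f k x))" by simp
    show "summable (\<lambda>k. LINT x|lborel. norm (f k x))"
    proof (rule summable_comparison_test'[OF summable_mult[OF summable, of "2 * pi"]])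
      fix k
      have "(LINT x|lborel. norm (f k x)) \<le> (LINT x|lborel. indicator {0..2 * pi} x * M (int_decode k))"
        by (intro integral_mono fb integrable_norm fi) auto
      then show "norm (LINT x|lborel. norm (f k x)) \<le> 2 * pi * M (int_decode k)"
        by (simp add: Bochner_Integration.integral_nonneg)
    qed
  qed
  moreover have "(LINT x|lborel. (\<Sum>k. f k x)) = (LINT x:{0..2 * pi}|lborel. complex_of_real (fourier_series a (x, y)) * cis (- (of_int n * x)))"
    unfolding set_lebesgue_integral_def
  proof (intro Bochner_Integration.integral_cong refl)
    fix x
    have "(\<lambda>k. f k x) sums (indicator {0..2 * pi} x *\<^sub>R (complex_of_real (fourier_series a (x, y)) * cis (- (of_int n * x))))"
      unfolding f_def by (intro sums_scaleR_right sums_mult2 sums_of_real fterm_sums yx)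
    then show "(\<Sum>k. f k x) = indicator {0..2 * pi} x *\<^sub>R (complex_of_real (fourier_series a (x, y)) * cis (- (of_int n * x)))"
      by (simp add: sums_iff)
  qed
  moreover have "(\<lambda>k. integral\<^sup>L lborel (f k)) sums (of_real pi * (a n y + cnj (a (- n) y)))"
  proof -
    have 1: "(\<lambda>k. if int_decode k = m then c else 0) sums c" for m and c :: complex
    proof -
      have "int_decode k = m \<longleftrightarrow> k = int_encode m" for k by auto
      then show ?thesis using sums_single[of "int_encode m" "\<lambda>_. c"] by simp
    qed
    have "integral\<^sup>L lborel (f k) = of_real pi * ((if int_decode k = n then a n y else 0) + (if int_decode k = - n then cnj (a (- n) y) else 0))" for k
      using LINT_fterm[OF y, of k n] by (simp add: set_lebesgue_integral_def f_def[abs_def])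
    then show ?thesis by (auto intro!: sums_mult sums_add 1)
  qed
  ultimately have "(LINT x:{0..2 * pi}|lborel. complex_of_real (fourier_series a (x, y)) * cis (- (of_int n * x))) = of_real pi * (a n y + cnj (a (- n) y))"
    using sums_unique2 by simp
  then show ?thesis by (simp add: fourier1_def herm scaleR_conv_of_real field_simps)
qed

end

text \<open>Termwise differentiation on the convex set \<open>cstrip\<close>: both series of partial
  derivatives converge uniformly, each within e / 2, so the partial sums of the differentials
  converge uniformly in operator norm. Working within the closed strip gives one-sided derivatives
  at the boundary.\<close>

lemma fourier_series_has_derivative:
  assumes \<phi>: "fourier_coefficients \<phi> M0"
    and \<phi>1: "fourier_coefficients (\<lambda>n y. \<i> * of_int n * \<phi> n y) M1"
    and \<phi>2: "fourier_coefficients D M2"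
    and D: "\<And>n. abs_cont (\<phi> n) (D n)"
    and z: "z \<in> cstrip"
  shows "(fourier_series \<phi> has_derivative
    (\<lambda>h. fst h * fourier_series (\<lambda>n y. \<i> * of_int n * \<phi> n y) z + snd h * fourier_series D z)) (at z within cstrip)"
proof -
  interpret a: fourier_coefficients \<phi> M0 by fact
  interpret b: fourier_coefficients "\<lambda>n y. \<i> * of_int n * \<phi> n y" M1 by fact
  interpret c: fourier_coefficients D M2 by fact
  let ?F1 = "fourier_series (\<lambda>n y. \<i> * of_int n * \<phi> n y)" and ?F2 = "fourier_series D"
  have "\<exists>g. \<forall>z\<in>cstrip. (\<lambda>k. a.fterm k z) sums g z \<and> (g has_derivative (\<lambda>h. fst h * ?F1 z + snd h * ?F2 z)) (at z within cstrip)"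
  proof (rule has_derivative_series)
    show "convex cstrip" unfolding cstrip_def by (intro convex_Times) auto
    show "z \<in> cstrip" by fact
    then show "(\<lambda>k. a.fterm k z) sums fourier_series \<phi> z" by (rule a.fterm_sums)
    show "(a.fterm k has_derivative (\<lambda>h. fst h * b.fterm k z + snd h * c.fterm k z)) (at z within cstrip)"
      if z: "z \<in> cstrip" for k z
    proof -
      define j where "j = int_decode k"
      have "(\<phi> j has_vector_derivative D j (snd z)) (at (snd z) within {-1..0})"
        using z by (intro abs_cont_derivative[OF D c.cont]) (auto simp: cstrip_def)
      then have "(\<phi> j has_derivative (\<lambda>h. h *\<^sub>R D j (snd z))) (at (snd z) within snd ` cstrip)"
        unfolding has_vector_derivative_def by (rule has_derivative_subset) (auto simp: cstrip_def)
      then have 1: "((\<lambda>z. \<phi> j (snd z)) has_derivative (\<lambda>h. snd h *\<^sub>R D j (snd z))) (at z within cstrip)"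
        by (rule has_derivative_in_compose[rotated]) (auto intro!: derivative_eq_intros)
      have "((\<lambda>x. cis (of_int j * x)) has_vector_derivative \<i> * of_int j * cis (of_int j * fst z)) (at (fst z))"
        by (auto intro!: derivative_eq_intros simp: has_vector_derivative_def scaleR_conv_of_real mult_ac)
      then have "((\<lambda>x. cis (of_int j * x)) has_derivative (\<lambda>h. h *\<^sub>R (\<i> * of_int j * cis (of_int j * fst z)))) (at (fst z) within fst ` cstrip)"
        unfolding has_vector_derivative_def by (rule has_derivative_at_withinI)
      then have 2: "((\<lambda>z. cis (of_int j * fst z)) has_derivative (\<lambda>h. fst h *\<^sub>R (\<i> * of_int j * cis (of_int j * fst z)))) (at z within cstrip)"
        by (rule has_derivative_in_compose[rotated]) (auto intro!: derivative_eq_intros)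
      have "(a.fterm k has_derivative (\<lambda>h. Re (\<phi> j (snd z) * (fst h *\<^sub>R (\<i> * of_int j * cis (of_int j * fst z))) + snd h *\<^sub>R D j (snd z) * cis (of_int j * fst z)))) (at z within cstrip)"
        unfolding a.fterm_def[abs_def] j_def[symmetric]
        by (intro has_derivative_Re has_derivative_mult 1 2)
      moreover have "Re (\<phi> j (snd z) * (fst h *\<^sub>R (\<i> * of_int j * cis (of_int j * fst z))) + snd h *\<^sub>R D j (snd z) * cis (of_int j * fst z)) =
          fst h * b.fterm k z + snd h * c.fterm k z" for h
        unfolding b.fterm_def c.fterm_def j_def[symmetric] by (simp add: algebra_simps)
      ultimately show ?thesis by simp
    qed
    show "\<forall>\<^sub>F n in sequentially. \<forall>z\<in>cstrip. \<forall>h. norm ((\<Sum>k<n. fst h * b.fterm k z + snd h * c.fterm k z) - (fst h * ?F1 z + snd h * ?F2 z)) \<le> e * norm h"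
      if "e > 0" for e
    proof -
      have "\<forall>\<^sub>F n in sequentially. \<forall>z\<in>cstrip. dist (\<Sum>k<n. b.fterm k z) (?F1 z) < e / 2"
        "\<forall>\<^sub>F n in sequentially. \<forall>z\<in>cstrip. dist (\<Sum>k<n. c.fterm k z) (?F2 z) < e / 2"
        using uniform_limitD[OF b.uniform_limit_fterm, of "e / 2"] uniform_limitD[OF c.uniform_limit_fterm, of "e / 2"] that by auto
      then show ?thesis
      proof eventually_elim
        case (elim n)
        show ?case
        proof (intro ballI allI)
          fix z and h :: "real \<times> real" assume z: "z \<in> cstrip"
          let ?B = "(\<Sum>k<n. b.fterm k z) - ?F1 z" and ?C = "(\<Sum>k<n. c.fterm k z) - ?F2 z"
          have "\<bar>fst h * ?B + snd h * ?C\<bar> \<le> \<bar>fst h\<bar> * \<bar>?B\<bar> + \<bar>snd h\<bar> * \<bar>?C\<bar>"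
            using abs_triangle_ineq[of "fst h * ?B" "snd h * ?C"] by (simp only: abs_mult)
          also have "\<dots> \<le> norm h * (e / 2) + norm h * (e / 2)"
            using elim z norm_fst_le[of "fst h" "snd h"] norm_snd_le[of "snd h" "fst h"]
            by (intro add_mono mult_mono) (auto simp: dist_real_def less_imp_le)
          also have "fst h * ?B + snd h * ?C = (\<Sum>k<n. fst h * b.fterm k z + snd h * c.fterm k z) - (fst h * ?F1 z + snd h * ?F2 z)"
            by (simp add: sum.distrib sum_distrib_left right_diff_distrib)
          finally show "norm ((\<Sum>k<n. fst h * b.fterm k z + snd h * c.fterm k z) - (fst h * ?F1 z + snd h * ?F2 z)) \<le> e * norm h"
            by (simp only: real_norm_def) (simp add: mult.commute)
        qed
      qed
    qed
  qed
  then obtain g where g: "\<And>z. z \<in> cstrip \<Longrightarrow> (\<lambda>k. a.fterm k z) sums g z"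
    "\<And>z. z \<in> cstrip \<Longrightarrow> (g has_derivative (\<lambda>h. fst h * ?F1 z + snd h * ?F2 z)) (at z within cstrip)"
    by blast
  have "g z = fourier_series \<phi> z" if "z \<in> cstrip" for z
    using sums_unique2[OF g(1) a.fterm_sums] that by blast
  then show ?thesis
    using has_derivative_transform[OF z _ g(2)[OF z]] by simp
qed

section \<open>Parseval identity between an integrable and a regular function\<close>

lemma fourier1_diff:
  assumes "continuous_on cstrip v" "continuous_on cstrip w" "y \<in> {-1..0}"
  shows "fourier1 (\<lambda>x. v x - w x) n y = fourier1 v n y - fourier1 w n y"
  using fourier_integrand_integrable[OF assms(1,3)] fourier_integrand_integrable[OF assms(2,3)]
  by (simp add: fourier1_def left_diff_distrib scaleR_diff_right)

lemma fourier1_eq_0_imp: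
  assumes v: "continuous_on cstrip v" "periodic1 v" and 0: "\<And>n y. y \<in> {-1..0} \<Longrightarrow> fourier1 v n y = 0"
    and z: "z \<in> cstrip"
  shows "v z = 0"
proof -
  obtain x y where zy: "z = (x, y)" "y \<in> {-1..0}" using z by (auto simp: cstrip_def)
  have "(\<lambda>x. v (x, y)) x = 0"
  proof (rule fourier_uniqueness[where f = "\<lambda>x. v (x, y)"])
    show "v (x + 2 * pi, y) = v (x, y)" for x using v(2) by (simp add: periodic1_def)
    show "continuous_on UNIV (\<lambda>x. v (x, y))" by (rule section_continuous[OF v(1) zy(2)])
    show "(LINT x:{0..2 * pi}|lborel. complex_of_real (v (x, y)) * cis (- (of_int n * x))) = 0" for n
      using 0[OF zy(2), of n] by (simp add: fourier1_def)
  qed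
  then show ?thesis by (simp add: zy)
qed

text \<open>h equals its uniformly convergent Fourier series, which may then be integrated termwise
  against the merely integrable v. The pairing is bilinear, without conjugation, so mode n of h
  meets mode -n of v.\<close>

lemma parseval:
  assumes v: "set_integrable lborel cell v" and h: "continuous_on cstrip h" "periodic1 h"
    and M: "\<And>n y. y \<in> {-1..0} \<Longrightarrow> cmod (fourier1 h n y) \<le> M n" "summable (\<lambda>k. M (int_decode k))"
  shows "(\<lambda>k. Re (of_real (2 * pi) * (LINT y:{-1..0}|lborel. fourier1 h (int_decode k) y * fourier1 v (- int_decode k) y)))
    sums (LINT z:cell|lborel. v z * h z)"
proof -
  interpret fourier_coefficients "fourier1 h" M
    by unfold_locales (use fourier1_continuous[OF h(1)] M in auto)
  \<comment> \<open>The series has the same modes as h, so uniqueness of Fourier coefficients on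
    each horizontal line gives equality.\<close>
  have heq: "h z = fourier_series (fourier1 h) z" if "z \<in> cstrip" for z
  proof -
    have "h z - fourier_series (fourier1 h) z = 0"
    proof (rule fourier1_eq_0_imp[OF _ _ _ that])
      show "continuous_on cstrip (\<lambda>z. h z - fourier_series (fourier1 h) z)"
        by (intro continuous_intros h fourier_series_continuous)
      show "periodic1 (\<lambda>z. h z - fourier_series (fourier1 h) z)"
        using h(2) periodic1_fourier_series by (simp add: periodic1_def)
      show "fourier1 (\<lambda>z. h z - fourier_series (fourier1 h) z) n y = 0" if "y \<in> {-1..0}" for n y
        using that by (simp add: fourier1_diff[OF h(1) fourier_series_continuous that] fourier1_fourier_series fourier1_cnj)
    qed
    then show ?thesis by simp
  qed
  define f where "f k z = indicator cell z *\<^sub>R (v z * fterm k z)" for k z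
  have av: "integrable lborel (\<lambda>z. indicator cell z * \<bar>v z\<bar>)"
    using set_integrable_abs[OF v] by (simp add: set_integrable_def)
  have fb: "norm (f k z) \<le> indicator cell z * \<bar>v z\<bar> * M (int_decode k)" for k z
    using fterm_bound[of z k] cell_subset_cstrip
    by (auto simp: f_def abs_mult split: split_indicator intro!: mult_left_mono)
  define W where "W k z = fourier1 h (int_decode k) (snd z) * cis (- (of_int (- int_decode k) * fst z)) * complex_of_real (v z)" for k z
  have W: "set_integrable lborel cell (W k)" for k
    unfolding W_def[abs_def] by (rule fourier1_Fubini(1)[OF v fourier1_continuous[OF h(1)]])
  have fW: "f k z = Re (indicator cell z *\<^sub>R W k z)" for k z
    by (simp add: f_def W_def fterm_def)
  have fi: "integrable lborel (f k)" for k
    unfolding fW using W by (intro integrable_Re) (simp add: set_integrable_def)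
  have fI: "integral\<^sup>L lborel (f k) = Re (of_real (2 * pi) * (LINT y:{-1..0}|lborel. fourier1 h (int_decode k) y * fourier1 v (- int_decode k) y))" for k
  proof -
    have "integral\<^sup>L lborel (f k) = Re (LINT z:cell|lborel. W k z)"
      unfolding fW set_lebesgue_integral_def using W by (intro integral_Re) (simp add: set_integrable_def)
    also have "(LINT z:cell|lborel. W k z) = of_real (2 * pi) * (LINT y:{-1..0}|lborel. fourier1 h (int_decode k) y * fourier1 v (- int_decode k) y)"
      unfolding W_def by (rule fourier1_Fubini(3)[OF v fourier1_continuous[OF h(1)]])
    finally show ?thesis .
  qed
  have "(\<lambda>k. integral\<^sup>L lborel (f k)) sums (LINT z|lborel. (\<Sum>k. f k z))"
  proof (rule sums_integral[OF fi])
    have "summable (\<lambda>k. norm (f k z))" for z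
      by (rule summable_comparison_test'[OF summable_mult[OF summable, of "indicator cell z * \<bar>v z\<bar>"]]) (use fb in simp)
    then show "AE z in lborel. summable (\<lambda>k. norm (f k z))" by simp
    show "summable (\<lambda>k. LINT z|lborel. norm (f k z))"
    proof (rule summable_comparison_test'[OF summable_mult[OF summable, of "LINT z|lborel. indicator cell z * \<bar>v z\<bar>"]])
      fix k
      have "(LINT z|lborel. norm (f k z)) \<le> (LINT z|lborel. indicator cell z * \<bar>v z\<bar> * M (int_decode k))"
        by (intro integral_mono fb integrable_norm fi integrable_mult_left av)
      then show "norm (LINT z|lborel. norm (f k z)) \<le> (LINT z|lborel. indicator cell z * \<bar>v z\<bar>) * M (int_decode k)"
        by (simp add: Bochner_Integration.integral_nonneg)
    qed
  qed
  moreover have "(LINT z|lborel. (\<Sum>k. f k z)) = (LINT z:cell|lborel. v z * h z)"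
    unfolding set_lebesgue_integral_def
  proof (intro Bochner_Integration.integral_cong refl)
    fix z
    show "(\<Sum>k. f k z) = indicator cell z *\<^sub>R (v z * h z)"
    proof (cases "z \<in> cell")
      case True
      then have "z \<in> cstrip" using cell_subset_cstrip by auto
      then have "(\<lambda>k. f k z) sums (indicator cell z *\<^sub>R (v z * h z))"
        unfolding f_def heq[OF \<open>z \<in> cstrip\<close>] by (intro sums_scaleR_right sums_mult fterm_sums)
      then show ?thesis by (simp add: sums_iff)
    qed (simp add: f_def)
  qed
  ultimately show ?thesis unfolding fI by simp
qed

lemma summable_int_decode_quadratic: "summable (\<lambda>k. C / (1 + real_of_int (int_decode k) ^ 2))"
proof (rule summable_comparison_test')
  show "summable (\<lambda>k. \<bar>C\<bar> * 8 * inverse (real (Suc k) ^ 2))"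
    by (intro summable_mult) (subst summable_Suc_iff, rule inverse_power_summable, simp)
  fix k
  \<comment> \<open>The enumeration runs 0, -1, 1, -2, 2, ..., so the k-th integer has modulus at
    least k / 2.\<close>
  have "\<bar>int_decode k\<bar> * 2 \<ge> int k"
    by (cases "sum_decode k") (auto simp: int_decode_def sum_decode_def split: if_splits elim!: evenE oddE)
  then have "real k \<le> 2 * \<bar>real_of_int (int_decode k)\<bar>" by linarith
  then have "real k ^ 2 \<le> (2 * \<bar>real_of_int (int_decode k)\<bar>) ^ 2"
    by (intro power_mono) auto
  then have 1: "real k ^ 2 \<le> 4 * real_of_int (int_decode k) ^ 2" by (simp add: power_mult_distrib)
  \<comment> \<open>This says (k + 1)^2 <= 2 k^2 + 2, which together with the previous bound
    explains the constant 8.\<close>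
  have "0 \<le> (real k - 1) ^ 2" by simp
  then have "real (Suc k) ^ 2 \<le> 8 * (1 + real_of_int (int_decode k) ^ 2)"
    using 1 by (simp add: power2_eq_square algebra_simps)
  moreover have "1 + real_of_int (int_decode k) ^ 2 > 0" by (simp add: add_pos_nonneg)
  ultimately have "1 / (1 + real_of_int (int_decode k) ^ 2) \<le> 8 * inverse (real (Suc k) ^ 2)"
    by (simp add: field_simps)
  then have "\<bar>C\<bar> * (1 / (1 + real_of_int (int_decode k) ^ 2)) \<le> \<bar>C\<bar> * (8 * inverse (real (Suc k) ^ 2))"
    by (intro mult_left_mono) auto
  then show "norm (C / (1 + real_of_int (int_decode k) ^ 2)) \<le> \<bar>C\<bar> * 8 * inverse (real (Suc k) ^ 2)"
    by (simp add: abs_of_pos[OF \<open>1 + real_of_int (int_decode k) ^ 2 > 0\<close>] mult.assoc)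
qed

section \<open>Fourier modes of elements of the Wiener--Sobolev space\<close>

lemma ws_weight_ge_1:
  fixes s lam :: real and n :: int
  assumes "0 \<le> s" "0 \<le> lam"
  shows "1 \<le> ennreal ((1 + real_of_int \<bar>n\<bar>) powr s * exp (lam * real_of_int \<bar>n\<bar>))"
proof -
  have "1 * 1 \<le> (1 + real_of_int \<bar>n\<bar>) powr s * exp (lam * real_of_int \<bar>n\<bar>)"
    using assms by (intro mult_mono ge_one_powr_ge_zero) auto
  then show ?thesis by simp
qed

text \<open>Every weight is at least 1, and the unordered sum dominates all finite sums, in
  particular those along the enumeration of the integers.\<close>

lemma ws_norm_ge_suminf:
  assumes "0 \<le> s" "0 \<le> lam"
  shows "(\<Sum>k. deriv_L1 1 (fourier1 v (int_decode k))) \<le> ws_norm s 1 lam v"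
proof -
  let ?c = "\<lambda>n. ennreal ((1 + real_of_int \<bar>n\<bar>) powr s * exp (lam * real_of_int \<bar>n\<bar>)) * deriv_L1 1 (fourier1 v n)"
  have "sum (\<lambda>k. deriv_L1 1 (fourier1 v (int_decode k))) {..<N} \<le> ws_norm s 1 lam v" for N
  proof -
    have "sum (\<lambda>k. deriv_L1 1 (fourier1 v (int_decode k))) {..<N} \<le> sum (\<lambda>k. ?c (int_decode k)) {..<N}"
      using mult_right_mono[OF ws_weight_ge_1[OF assms]] by (intro sum_mono) fastforce
    also have "\<dots> = sum ?c (int_decode ` {..<N})"
      by (simp add: sum.reindex[OF inj_int_decode])
    also have "\<dots> \<le> (SUP F\<in>{F. finite F \<and> F \<subseteq> UNIV}. sum ?c F)"
      by (rule SUP_upper) auto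
    also have "\<dots> = ws_norm s 1 lam v"
      unfolding ws_norm_def by (rule nonneg_infsum_complete[symmetric]) simp
    finally show ?thesis .
  qed
  then show ?thesis by (intro suminf_le_const) auto
qed

lemma ws_norm_ge_mode:
  assumes "0 \<le> s" "0 \<le> lam"
  shows "deriv_L1 1 (fourier1 v n) \<le> ws_norm s 1 lam v"
proof -
  have "(\<Sum>k. deriv_L1 1 (fourier1 v (int_decode k))) \<ge> sum (\<lambda>k. deriv_L1 1 (fourier1 v (int_decode k))) {int_encode n}"
    by (intro sum_le_suminf) auto
  with ws_norm_ge_suminf[OF assms, of v] show ?thesis by simp
qed

text \<open>One approximant at finite distance already provides the weak derivative. The value at -1
  uses the whole sequence: it is bounded by the L^1 norm of the error plus the seminorm of the
  error, and both tend to 0.\<close>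

lemma ws_space_mode:
  assumes v: "v \<in> ws_space s 1 lam" and s: "0 \<le> s" and lam: "0 \<le> lam"
  shows "\<exists>w G. abs_cont G w \<and> G (-1) = 0 \<and> (AE y in lborel. y \<in> {-1..0} \<longrightarrow> fourier1 v n y = G y)"
proof -
  from v obtain \<omega> where vi: "set_integrable lborel cell v" and \<omega>: "\<And>j::nat. test_halfopen (\<omega> j)"
    and lim1: "(\<lambda>j. ws_norm s 1 lam (\<lambda>x. \<omega> j x - v x)) \<longlonglongrightarrow> 0"
    and lim2: "(\<lambda>j. LINT x:cell|lborel. \<bar>\<omega> j x - v x\<bar>) \<longlonglongrightarrow> 0"
    unfolding ws_space_def by blast
  define e where "e j = ws_norm s 1 lam (\<lambda>x. \<omega> j x - v x)" for j
  define u where "u j = fourier1 (\<lambda>x. \<omega> j x - v x) n" for j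
  have sm: "smooth (\<omega> j)" for j using \<omega> by (simp add: test_halfopen_def)
  have \<omega>i: "set_integrable lborel cell (\<omega> j)" for j
    by (intro set_integrable_cell_continuous smooth_continuous sm)
  have di: "set_integrable lborel cell (\<lambda>x. \<omega> j x - v x)" for j
    by (intro set_integral_diff(1) \<omega>i vi)
  have uAE: "AE y in lborel. y \<in> {-1..0} \<longrightarrow> u j y = fourier1 (\<omega> j) n y - fourier1 v n y" for j
    unfolding u_def by (rule fourier1_diff_AE[OF \<omega>i vi])
  have vI: "set_integrable lborel {-1..0} (fourier1 v n)" by (rule fourier1_integrable[OF vi])
  have uI: "set_integrable lborel {-1..0} (u j)" for j unfolding u_def by (rule fourier1_integrable[OF di])
  have ue: "deriv_L1 1 (u j) \<le> e j" for j
    unfolding u_def e_def by (rule ws_norm_ge_mode[OF s lam])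
  have \<omega>d: "abs_cont (fourier1 (\<omega> j) n) (fourier1 (d2 (\<omega> j)) n)" for j
    by (rule smooth_fourier1_d2[OF sm])
  have "eventually (\<lambda>j. e j < 1) sequentially"
    using lim1 by (intro order_tendstoD) (auto simp: e_def)
  then obtain J where J: "e J < 1" by (auto simp: eventually_sequentially)
  then have "deriv_L1 1 (u J) < \<infinity>"
    using ue[of J] by (metis ennreal_one_less_top infinity_ennreal_def le_less_trans less_trans)
  then obtain r where r: "weak_deriv 1 (u J) r" by (rule deriv_L1_finite)
  \<comment> \<open>Mode n of v is the mode of the approximant minus that of the error;
    \<open>w\<close> is the corresponding difference of weak derivatives.\<close>
  define w where "w y = fourier1 (d2 (\<omega> J)) n y - r y" for y
  have w: "weak_deriv 1 (fourier1 v n) w"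
  proof (rule weak_deriv_cong)
    show "weak_deriv 1 (\<lambda>y. fourier1 (\<omega> J) n y - u J y) w"
      unfolding w_def[abs_def] by (intro weak_deriv_diff abs_cont_imp_weak_deriv \<omega>d r)
    show "AE y in lborel. y \<in> {-1<..<0} \<longrightarrow> fourier1 (\<omega> J) n y - u J y = fourier1 v n y"
      using uAE[of J] by eventually_elim auto
    show "set_integrable lborel {-1<..<0} (fourier1 v n)" using vI by (simp add: set_integrable_open_iff)
  qed
  then obtain G where G: "abs_cont G w" "AE y in lborel. y \<in> {-1<..<0} \<longrightarrow> fourier1 v n y = G y"
    by (rule weak_deriv_imp_abs_cont)
  have G': "AE y in lborel. y \<in> {-1..0} \<longrightarrow> fourier1 v n y = G y"
    using G(2) AE_lborel_singleton[of "-1"] AE_lborel_singleton[of 0] by eventually_elim auto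
  have GI: "set_integrable lborel {-1..0} G"
    by (intro borel_integrable_atLeastAtMost' abs_cont_continuous[OF G(1)])
  have le: "ennreal (cmod (G (-1))) \<le> e j + ennreal (LINT x:cell|lborel. \<bar>\<omega> j x - v x\<bar>)" for j
  proof -
    define X where "X y = fourier1 (\<omega> j) n y - G y" for y
    define x where "x y = fourier1 (d2 (\<omega> j)) n y - w y" for y
    have X: "abs_cont X x"
      unfolding X_def[abs_def] x_def[abs_def] by (intro abs_cont_diff \<omega>d G(1))
    have XI: "set_integrable lborel {-1..0} X"
      by (intro borel_integrable_atLeastAtMost' abs_cont_continuous[OF X])
    have Xu: "AE y in lborel. y \<in> {-1..0} \<longrightarrow> X y = u j y"
      using uAE[of j] G' by eventually_elim (auto simp: X_def)
    have "weak_deriv 1 (u j) x"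
    proof (rule weak_deriv_cong[OF abs_cont_imp_weak_deriv[OF X]])
      show "AE y in lborel. y \<in> {-1<..<0} \<longrightarrow> X y = u j y" using Xu by eventually_elim auto
      show "set_integrable lborel {-1<..<0} (u j)" using uI by (simp add: set_integrable_open_iff)
    qed
    then have 1: "ennreal (LINT y:{-1..0}|lborel. cmod (x y)) \<le> e j"
      using ue[of j] deriv_L1_eq by metis
    have "fourier1 (\<omega> j) n (-1) = 0"
    proof -
      have "\<omega> j (t, -1) = 0" for t
        using \<omega>[of j] unfolding test_halfopen_def by force
      then show ?thesis by (simp add: fourier1_def)
    qed
    then have "cmod (X (-1)) = cmod (G (-1))" by (simp add: X_def)
    then have "cmod (G (-1)) \<le> cmod (X y) + (LINT y:{-1..0}|lborel. cmod (x y))" if "y \<in> {-1..0}" for y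
      using abs_cont_norm_le[OF X, of "-1" y] that norm_triangle_ineq2[of "X (-1)" "X y"] by simp
    \<comment> \<open>Averaging the pointwise bound over an interval of length 1 replaces the value
      of X at y by its L^1 norm, which the L^1 convergence on the strip controls.\<close>
    then have "(LINT y::real:{-1..0}|lborel. cmod (G (-1))) \<le> (LINT y:{-1..0}|lborel. cmod (X y) + (LINT y:{-1..0}|lborel. cmod (x y)))"
      by (intro set_integral_mono set_integral_add(1) set_integrable_norm XI borel_integrable_atLeastAtMost' continuous_on_const)
    also have "\<dots> = (LINT y:{-1..0}|lborel. cmod (X y)) + (LINT y::real:{-1..0}|lborel. LINT y:{-1..0}|lborel. cmod (x y))"
      by (intro set_integral_add(2) set_integrable_norm XI borel_integrable_atLeastAtMost' continuous_on_const)
    finally have "cmod (G (-1)) \<le> (LINT y:{-1..0}|lborel. cmod (X y)) + (LINT y:{-1..0}|lborel. cmod (x y))"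
      by (simp add: set_integral_const)
    also have "(LINT y:{-1..0}|lborel. cmod (X y)) = (LINT y:{-1..0}|lborel. cmod (u j y))"
      unfolding set_lebesgue_integral_def
    proof (rule integral_cong_AE)
      show "(\<lambda>y. indicator {-1..0} y *\<^sub>R cmod (X y)) \<in> borel_measurable lborel" "(\<lambda>y. indicator {-1..0} y *\<^sub>R cmod (u j y)) \<in> borel_measurable lborel"
        using set_integrable_norm[OF XI] set_integrable_norm[OF uI[of j]] by (auto simp: set_integrable_def)
      show "AE y in lborel. indicator {-1..0} y *\<^sub>R cmod (X y) = indicator {-1..0} y *\<^sub>R cmod (u j y)"
        using Xu by eventually_elim (auto split: split_indicator)
    qed
    also have "\<dots> \<le> (LINT x:cell|lborel. \<bar>\<omega> j x - v x\<bar>)"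
      unfolding u_def by (rule fourier1_L1_le[OF di])
    finally have "cmod (G (-1)) \<le> (LINT x:cell|lborel. \<bar>\<omega> j x - v x\<bar>) + (LINT y:{-1..0}|lborel. cmod (x y))"
      by simp
    then have "ennreal (cmod (G (-1))) \<le> ennreal ((LINT x:cell|lborel. \<bar>\<omega> j x - v x\<bar>) + (LINT y:{-1..0}|lborel. cmod (x y)))"
      by (rule ennreal_leI)
    also have "\<dots> = ennreal (LINT y:{-1..0}|lborel. cmod (x y)) + ennreal (LINT x:cell|lborel. \<bar>\<omega> j x - v x\<bar>)"
      using set_integral_norm_nonneg[of lborel "{-1..0}" x] set_integral_norm_nonneg[of lborel cell "\<lambda>x. \<omega> j x - v x"]
      by (simp add: ennreal_plus add.commute)
    also have "\<dots> \<le> e j + ennreal (LINT x:cell|lborel. \<bar>\<omega> j x - v x\<bar>)"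
      by (intro add_right_mono 1)
    finally show ?thesis .
  qed
  have "(\<lambda>j. e j + ennreal (LINT x:cell|lborel. \<bar>\<omega> j x - v x\<bar>)) \<longlonglongrightarrow> 0 + ennreal 0"
    by (intro tendsto_add tendsto_ennrealI lim2) (use lim1 in \<open>simp add: e_def[abs_def]\<close>)
  then have "ennreal (cmod (G (-1))) \<le> 0 + ennreal 0"
    using le by (intro LIMSEQ_le_const) auto
  then have "G (-1) = 0" by simp
  with G(1) G' show ?thesis by blast
qed

text \<open>v is one approximant minus an error of norm below 1. The x2-derivative of the
  approximant is smooth, so its modes are O(1 / (1 + n^2)), summable without weight whatever s and
  lam are.\<close>

lemma ws_space_summable:
  assumes v: "v \<in> ws_space s 1 lam" and s: "0 \<le> s" and lam: "0 \<le> lam"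
  shows "(\<Sum>k. deriv_L1 1 (fourier1 v (int_decode k))) < \<infinity>"
proof -
  from v obtain \<omega> where vi: "set_integrable lborel cell v" and \<omega>: "\<And>j::nat. test_halfopen (\<omega> j)"
    and lim1: "(\<lambda>j. ws_norm s 1 lam (\<lambda>x. \<omega> j x - v x)) \<longlonglongrightarrow> 0"
    unfolding ws_space_def by blast
  have "eventually (\<lambda>j. ws_norm s 1 lam (\<lambda>x. \<omega> j x - v x) < 1) sequentially"
    using lim1 by (intro order_tendstoD) auto
  then obtain J where J: "ws_norm s 1 lam (\<lambda>x. \<omega> J x - v x) < 1" by (auto simp: eventually_sequentially)
  have sm: "smooth (\<omega> J)" and per: "periodic1 (\<omega> J)" using \<omega> by (auto simp: test_halfopen_def)
  have \<omega>i: "set_integrable lborel cell (\<omega> J)"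
    by (intro set_integrable_cell_continuous smooth_continuous sm)
  obtain C where C: "\<And>n y. y \<in> {-1..0} \<Longrightarrow> cmod (fourier1 (d2 (\<omega> J)) n y) \<le> C / (1 + real_of_int n ^ 2)"
    using smooth_fourier1_decay[OF smooth_d2[OF sm] periodic1_d2[OF sm per]] by blast
  have C0: "C \<ge> 0"
    using order_trans[OF norm_ge_zero C[of 0 0]] by simp
  \<comment> \<open>If the mode of the error has no integrable weak derivative, the right-hand side
    is \<infinity> and nothing is to be shown.\<close>
  have le: "deriv_L1 1 (fourier1 v n) \<le> deriv_L1 1 (fourier1 (\<lambda>x. \<omega> J x - v x) n) + ennreal (C / (1 + real_of_int n ^ 2))" for n
  proof (cases "deriv_L1 1 (fourier1 (\<lambda>x. \<omega> J x - v x) n) < \<infinity>")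
    case True
    then obtain r where r: "weak_deriv 1 (fourier1 (\<lambda>x. \<omega> J x - v x) n) r" by (rule deriv_L1_finite)
    have \<omega>d: "abs_cont (fourier1 (\<omega> J) n) (fourier1 (d2 (\<omega> J)) n)"
      by (rule smooth_fourier1_d2[OF sm])
    have w: "weak_deriv 1 (fourier1 v n) (\<lambda>y. fourier1 (d2 (\<omega> J)) n y - r y)"
    proof (rule weak_deriv_cong)
      show "weak_deriv 1 (\<lambda>y. fourier1 (\<omega> J) n y - fourier1 (\<lambda>x. \<omega> J x - v x) n y) (\<lambda>y. fourier1 (d2 (\<omega> J)) n y - r y)"
        by (intro weak_deriv_diff abs_cont_imp_weak_deriv \<omega>d r)
      show "AE y in lborel. y \<in> {-1<..<0} \<longrightarrow> fourier1 (\<omega> J) n y - fourier1 (\<lambda>x. \<omega> J x - v x) n y = fourier1 v n y"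
        using fourier1_diff_AE[OF \<omega>i vi, of n] by eventually_elim auto
      show "set_integrable lborel {-1<..<0} (fourier1 v n)"
        using fourier1_integrable[OF vi] by (simp add: set_integrable_open_iff)
    qed
    have rI: "set_integrable lborel {-1..0} r" by (rule weak_deriv_integrable(4)[OF r])
    have "(LINT y:{-1..0}|lborel. cmod (fourier1 (d2 (\<omega> J)) n y - r y)) \<le> (LINT y:{-1..0}|lborel. cmod (r y) + C / (1 + real_of_int n ^ 2))"
    proof (rule set_integral_mono)
      show "set_integrable lborel {-1..0} (\<lambda>y. cmod (fourier1 (d2 (\<omega> J)) n y - r y))"
        by (rule set_integrable_norm[OF weak_deriv_integrable(4)[OF w]])
      show "set_integrable lborel {-1..0} (\<lambda>y. cmod (r y) + C / (1 + real_of_int n ^ 2))"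
        by (intro set_integral_add(1) set_integrable_norm rI borel_integrable_atLeastAtMost' continuous_on_const)
      show "cmod (fourier1 (d2 (\<omega> J)) n y - r y) \<le> cmod (r y) + C / (1 + real_of_int n ^ 2)" if "y \<in> {-1..0}" for y
        using C[OF that, of n] norm_triangle_ineq4[of "fourier1 (d2 (\<omega> J)) n y" "r y"] by linarith
    qed
    also have "\<dots> = (LINT y:{-1..0}|lborel. cmod (r y)) + (LINT y::real:{-1..0}|lborel. C / (1 + real_of_int n ^ 2))"
      by (intro set_integral_add(2) set_integrable_norm rI borel_integrable_atLeastAtMost' continuous_on_const)
    also have "\<dots> = (LINT y:{-1..0}|lborel. cmod (r y)) + C / (1 + real_of_int n ^ 2)"
      by (simp add: set_integral_const)
    finally have "ennreal (LINT y:{-1..0}|lborel. cmod (fourier1 (d2 (\<omega> J)) n y - r y)) \<le> ennreal ((LINT y:{-1..0}|lborel. cmod (r y)) + C / (1 + real_of_int n ^ 2))"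
      by (rule ennreal_leI)
    then show ?thesis
      using set_integral_norm_nonneg[of lborel "{-1..0}" r] C0
      unfolding deriv_L1_eq[OF w] deriv_L1_eq[OF r] by (simp add: ennreal_plus)
  next
    case False
    then have "deriv_L1 1 (fourier1 (\<lambda>x. \<omega> J x - v x) n) = top" by (simp add: not_less top_unique)
    then show ?thesis by simp
  qed
  have "(\<Sum>k. deriv_L1 1 (fourier1 v (int_decode k))) \<le>
      (\<Sum>k. deriv_L1 1 (fourier1 (\<lambda>x. \<omega> J x - v x) (int_decode k)) + ennreal (C / (1 + real_of_int (int_decode k) ^ 2)))"
    by (intro suminf_le le) auto
  also have "\<dots> = (\<Sum>k. deriv_L1 1 (fourier1 (\<lambda>x. \<omega> J x - v x) (int_decode k))) + (\<Sum>k. ennreal (C / (1 + real_of_int (int_decode k) ^ 2)))"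
    by (intro suminf_add[symmetric]) auto
  also have "\<dots> < \<infinity>"
  proof -
    have "(\<Sum>k. deriv_L1 1 (fourier1 (\<lambda>x. \<omega> J x - v x) (int_decode k))) < 1"
      using ws_norm_ge_suminf[OF s lam] J by (rule le_less_trans)
    moreover have "(\<Sum>k. ennreal (C / (1 + real_of_int (int_decode k) ^ 2))) \<noteq> top"
      by (rule ennreal_suminf_neq_top[OF summable_int_decode_quadratic]) (use C0 in \<open>simp add: add_nonneg_nonneg\<close>)
    ultimately show ?thesis
      unfolding infinity_ennreal_def ennreal_add_less_top
      using less_trans[OF _ ennreal_one_less_top] by (simp only: less_top)
  qed
  finally show ?thesis .
qed

section \<open>Hermitian symmetry of the modes\<close>

text \<open>Projection onto the families that are modes of real-valued functions.\<close>

definition symm :: "(int \<Rightarrow> real \<Rightarrow> complex) \<Rightarrow> int \<Rightarrow> real \<Rightarrow> complex" where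
  "symm f n y = (f n y + cnj (f (- n) y)) / 2"

lemma symm_minus: "symm f (- n) y = cnj (symm f n y)"
  by (simp add: symm_def add.commute)

lemma abs_cont_cnj:
  assumes "abs_cont F f" shows "abs_cont (\<lambda>y. cnj (F y)) (\<lambda>y. cnj (f y))"
proof (rule abs_contI)
  show "set_integrable lborel {-1..0} (\<lambda>y. cnj (f y))"
    using abs_cont_integrable[OF assms] integrable_cnj by (auto simp: set_integrable_def simp flip: complex_cnj_scaleR)
  show "(LINT t:{-1..y}|lborel. cnj (f t)) = cnj (F y) - cnj (F (-1))" if "y \<in> {-1..0}" for y
  proof -
    have "(LINT t:{-1..y}|lborel. cnj (f t)) = cnj (LINT t:{-1..y}|lborel. f t)"
      unfolding set_lebesgue_integral_def complex_cnj_scaleR[symmetric] by (rule Bochner_Integration.integral_cnj)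
    then show ?thesis by (simp add: abs_cont_LINT[OF assms that])
  qed
qed

lemma abs_cont_symm:
  assumes "\<And>n. abs_cont (F n) (f n)" shows "abs_cont (symm F n) (symm f n)"
  using abs_cont_cmult[OF abs_cont_add[OF assms abs_cont_cnj[OF assms]], of "1 / 2" n "- n"]
  by (rule abs_cont_cong) (auto simp: symm_def)

lemma LINT_symm_le:
  assumes "\<And>n. set_integrable lborel {-1..0} (f n)" "set_integrable lborel {-1..0} (symm f n)"
  shows "(LINT y:{-1..0}|lborel. cmod (c * symm f n y)) \<le>
    ((LINT y:{-1..0}|lborel. cmod (c * f n y)) + (LINT y:{-1..0}|lborel. cmod (c * f (- n) y))) / 2"
proof -
  have i: "set_integrable lborel {-1..0} (\<lambda>y. cmod (c * f n y) / 2)" for n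
    using set_integrable_norm[OF assms(1)[of n]] by (simp add: norm_mult)
  have "(LINT y:{-1..0}|lborel. cmod (c * symm f n y)) \<le> (LINT y:{-1..0}|lborel. cmod (c * f n y) / 2 + cmod (c * f (- n) y) / 2)"
  proof (rule set_integral_mono)
    show "set_integrable lborel {-1..0} (\<lambda>y. cmod (c * symm f n y))"
      using set_integrable_norm[OF assms(2)] by (simp add: norm_mult)
    show "set_integrable lborel {-1..0} (\<lambda>y. cmod (c * f n y) / 2 + cmod (c * f (- n) y) / 2)"
      by (intro set_integral_add(1) i)
    show "cmod (c * symm f n y) \<le> cmod (c * f n y) / 2 + cmod (c * f (- n) y) / 2" for y
    proof -
      have "cmod c * cmod (f n y + cnj (f (- n) y)) \<le> cmod c * (cmod (f n y) + cmod (f (- n) y))"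
        using norm_triangle_ineq[of "f n y" "cnj (f (- n) y)"] by (intro mult_left_mono) auto
      then have "cmod c * cmod (f n y + cnj (f (- n) y)) / 2 \<le> cmod c * (cmod (f n y) + cmod (f (- n) y)) / 2"
        by (rule divide_right_mono) simp
      moreover have "cmod (c * symm f n y) = cmod c * cmod (f n y + cnj (f (- n) y)) / 2"
        by (simp only: symm_def norm_mult norm_divide) simp
      ultimately show ?thesis by (simp only: norm_mult distrib_left add_divide_distrib)
    qed
  qed
  also have "\<dots> = (LINT y:{-1..0}|lborel. cmod (c * f n y) / 2) + (LINT y:{-1..0}|lborel. cmod (c * f (- n) y) / 2)"
    by (intro set_integral_add(2) i)
  finally show ?thesis by simp
qed

text \<open>The representatives for n and -n are obtained independently and are conjugate only
  almost everywhere. Symmetrising changes \<open>G0\<close> at most on a null set and makes the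
  symmetry hold at every y, for the derivatives too.\<close>

lemma ws_space_modes:
  assumes v: "v \<in> ws_space s 1 lam" and s: "0 \<le> s" and lam: "0 \<le> lam"
  shows "\<exists>w G. (\<forall>n. abs_cont (G n) (w n)) \<and> (\<forall>n. G n (-1) = 0) \<and>
    (\<forall>n. AE y in lborel. y \<in> {-1..0} \<longrightarrow> fourier1 v n y = G n y) \<and>
    (\<forall>n. deriv_L1 1 (fourier1 v n) = ennreal (LINT y:{-1..0}|lborel. cmod (w n y))) \<and>
    summable (\<lambda>k. LINT y:{-1..0}|lborel. cmod (w (int_decode k) y)) \<and>
    (\<forall>n y. w (- n) y = cnj (w n y)) \<and> (\<forall>n y. G (- n) y = cnj (G n y))"
proof -
  have vi: "set_integrable lborel cell v" using v by (simp add: ws_space_def)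
  obtain w0 G0 where *: "\<And>n. abs_cont (G0 n) (w0 n)" "\<And>n. G0 n (-1) = 0"
    "\<And>n. AE y in lborel. y \<in> {-1..0} \<longrightarrow> fourier1 v n y = G0 n y"
    using ws_space_mode[OF v s lam] by metis
  define w where "w = symm w0"
  define G where "G = symm G0"
  have G: "abs_cont (G n) (w n)" "G n (-1) = 0" for n
    using abs_cont_symm[OF *(1)] *(2) by (auto simp: G_def w_def symm_def)
  have ae: "AE y in lborel. y \<in> {-1..0} \<longrightarrow> fourier1 v n y = G n y" for n
    using *(3)[of n] *(3)[of "- n"]
  proof eventually_elim
    case (elim y)
    then have "y \<in> {-1..0} \<Longrightarrow> G0 (- n) y = cnj (G0 n y)"
      using fourier1_cnj[of v n y] by simp
    with elim show ?case by (simp add: G_def symm_def)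
  qed
  have L1: "deriv_L1 1 (fourier1 v n) = ennreal (LINT y:{-1..0}|lborel. cmod (w n y))" for n
  proof (rule deriv_L1_eq, rule weak_deriv_cong[OF abs_cont_imp_weak_deriv[OF G(1)]])
    show "AE y in lborel. y \<in> {-1<..<0} \<longrightarrow> G n y = fourier1 v n y" using ae[of n] by eventually_elim auto
    show "set_integrable lborel {-1<..<0} (fourier1 v n)"
      using fourier1_integrable[OF vi] by (simp add: set_integrable_open_iff)
  qed
  have "summable (\<lambda>k. LINT y:{-1..0}|lborel. cmod (w (int_decode k) y))"
  proof (rule summable_suminf_not_top)
    show "(\<Sum>k. ennreal (LINT y:{-1..0}|lborel. cmod (w (int_decode k) y))) \<noteq> top"
      using ws_space_summable[OF v s lam] unfolding L1 by simp
  qed (rule set_integral_norm_nonneg)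
  moreover have "w (- n) y = cnj (w n y)" "G (- n) y = cnj (G n y)" for n y
    unfolding w_def G_def by (rule symm_minus)+
  ultimately show ?thesis
    using G ae L1 by (intro exI[of _ w] exI[of _ G] conjI allI) auto
qed

section \<open>The boundary value problem on the strip\<close>

lemma abs_cont_integral_by_parts:
  assumes "abs_cont E e" "abs_cont F f" "E (-1) * F (-1) = 0" "E 0 * F 0 = 0"
  shows "(LINT y:{-1..0}|lborel. e y * F y) = - (LINT y:{-1..0}|lborel. E y * f y)"
proof -
  have 1: "set_integrable lborel {-1..0} (\<lambda>y. e y * F y)"
    using set_integrable_cmult_continuous[OF abs_cont_integrable[OF assms(1)] abs_cont_continuous[OF assms(2)]]
    by (simp add: mult.commute)
  have 2: "set_integrable lborel {-1..0} (\<lambda>y. E y * f y)"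
    using set_integrable_cmult_continuous[OF abs_cont_integrable[OF assms(2)] abs_cont_continuous[OF assms(1)]] .
  have "(LINT y:{-1..0}|lborel. e y * F y + E y * f y) = 0"
    using abs_cont_LINT[OF abs_cont_mult[OF assms(1,2)], of 0] assms(3,4) by simp
  then show ?thesis by (simp add: set_integral_add(2)[OF 1 2] eq_neg_iff_add_eq_0)
qed

lemma LINT_mult_cong_AE:
  fixes p u v :: "real \<Rightarrow> complex"
  assumes "continuous_on {-1..0} p" "set_integrable lborel {-1..0} u" "set_integrable lborel {-1..0} v"
    and ae: "AE y in lborel. y \<in> {-1..0} \<longrightarrow> u y = v y"
  shows "(LINT y:{-1..0}|lborel. p y * u y) = (LINT y:{-1..0}|lborel. p y * (v y :: complex))"
  unfolding set_lebesgue_integral_def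
proof (rule integral_cong_AE)
  show "(\<lambda>y. indicator {-1..0} y *\<^sub>R (p y * u y)) \<in> borel_measurable lborel"
    "(\<lambda>y. indicator {-1..0} y *\<^sub>R (p y * v y)) \<in> borel_measurable lborel"
    using set_integrable_cmult_continuous[OF assms(2,1)] set_integrable_cmult_continuous[OF assms(3,1)]
    unfolding set_integrable_def by (simp_all only: borel_measurable_integrable)
  show "AE y in lborel. indicator {-1..0} y *\<^sub>R (p y * u y) = indicator {-1..0} y *\<^sub>R (p y * v y)"
    using ae by eventually_elim (auto split: split_indicator)
qed

lemma continuous_AE_eq:
  fixes u v :: "real \<Rightarrow> complex"
  assumes u: "continuous_on {-1..0} u" and v: "continuous_on {-1..0} v"
    and ae: "AE y in lborel. y \<in> {-1<..<0} \<longrightarrow> u y = v y" and y: "y \<in> {-1..0}"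
  shows "u y = v y"
proof -
  define h where "h y = cmod (u y - v y)" for y
  have ch: "continuous_on {-1..0} h" unfolding h_def[abs_def] by (intro continuous_intros u v)
  then have ih: "set_integrable lborel {-1..0} h" by (rule borel_integrable_atLeastAtMost')
  have "(LINT y:{-1..0}|lborel. h y) = (LINT y::real|lborel. 0)"
    unfolding set_lebesgue_integral_def
  proof (rule integral_cong_AE)
    show "(\<lambda>y. indicator {-1..0} y *\<^sub>R h y) \<in> borel_measurable lborel"
      using ih unfolding set_integrable_def by (rule borel_measurable_integrable)
    show "AE y in lborel. indicator {-1..0} y *\<^sub>R h y = 0"
      using ae AE_lborel_singleton[of "-1"] AE_lborel_singleton[of 0]
      by eventually_elim (auto simp: h_def split: split_indicator)
  qed simp
  then have "(h has_integral 0) (cbox (-1) 0)"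
    using set_borel_integral_eq_integral[OF ih] by (metis cbox_interval integrable_integral integral_zero)
  then have "h y = 0"
    by (rule has_integral_0_cbox_imp_0[rotated 2]) (use y ch in \<open>auto simp: h_def\<close>)
  then show ?thesis by (simp add: h_def)
qed

lemma cell_sets: "cell \<in> sets lborel"
  by (simp add: borel_compact compact_cell)

subsection \<open>Uniqueness\<close>

text \<open>The weak equation makes k^2 f the weak derivative of F, and continuity of F upgrades
  this to absolute continuity. Then F + k f and F - k f are exact multiples of exp (k y) and exp (-
  k y), and the boundary conditions annihilate both.\<close>

lemma mode_uniqueness:
  assumes f: "abs_cont f F" and F: "continuous_on {-1..0} F" and bc: "f 0 = 0" "F (-1) = 0" and k: "k \<ge> 0"
    and weak: "\<And>p. test_interval p \<Longrightarrow>
      (LINT y:{-1..0}|lborel. of_real (deriv (deriv p) y) * f y) = of_real (k\<^sup>2) * (LINT y:{-1..0}|lborel. of_real (p y) * f y)"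
    and y: "y \<in> {-1..0}"
  shows "f y = 0"
proof -
  have fi: "set_integrable lborel {-1<..<0} (\<lambda>y. of_real (k\<^sup>2) * f y)"
    unfolding set_integrable_open_iff
    by (intro borel_integrable_atLeastAtMost' continuous_intros abs_cont_continuous[OF f])
  have "weak_deriv 1 F (\<lambda>y. of_real (k\<^sup>2) * f y)"
  proof (rule weak_derivI[OF _ fi])
    show "set_integrable lborel {-1<..<0} F"
      unfolding set_integrable_open_iff by (rule borel_integrable_atLeastAtMost'[OF F])
    fix p assume p: "test_interval p"
    have sd: "abs_cont (\<lambda>y. of_real (deriv p y)) (\<lambda>y. of_real (deriv (deriv p) y))"
      by (rule abs_cont_of_real_smooth[OF test_interval_smooth(2)[OF p]])
    have "deriv p y = 0" if "y \<notin> {-1<..<0}" for y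
    proof -
      from p obtain a b where ab: "-1 < a" "b < 0" "\<And>y. y \<notin> {a..b} \<Longrightarrow> p y = 0"
        by (auto simp: test_interval_def)
      have "(p has_real_derivative 0) (at y)"
      proof (rule has_field_derivative_transform_within_open)
        show "((\<lambda>_. 0) has_real_derivative 0) (at y)" by simp
        show "open (- {a..b})" "y \<in> - {a..b}" using that ab by auto
      qed (use ab in auto)
      then show ?thesis by (rule DERIV_imp_deriv)
    qed
    then have "(LINT y:{-1..0}|lborel. of_real (deriv (deriv p) y) * f y) = - (LINT y:{-1..0}|lborel. of_real (deriv p y) * F y)"
      by (intro abs_cont_integral_by_parts sd f) auto
    then have "(LINT y:{-1..0}|lborel. of_real (deriv p y) * F y) = - (of_real (k\<^sup>2) * (LINT y:{-1..0}|lborel. of_real (p y) * f y))"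
      using weak[OF p] by simp
    also have "of_real (k\<^sup>2) * (LINT y:{-1..0}|lborel. of_real (p y) * f y) = (LINT y:{-1..0}|lborel. of_real (p y) * (of_real (k\<^sup>2) * f y))"
      by (simp add: mult.left_commute[of "of_real (p _)"] del: of_real_power)
    finally show "(LINT y:{-1<..<0}|lborel. deriv p y *\<^sub>R F y) = - (LINT y:{-1<..<0}|lborel. p y *\<^sub>R (of_real (k\<^sup>2) * f y))"
      by (simp only: set_integral_open_eq scaleR_conv_of_real)
  qed
  then obtain U where U: "abs_cont U (\<lambda>y. of_real (k\<^sup>2) * f y)" "AE y in lborel. y \<in> {-1<..<0} \<longrightarrow> F y = U y"
    by (rule weak_deriv_imp_abs_cont)
  have "F y = U y" if "y \<in> {-1..0}" for y
    by (rule continuous_AE_eq[OF F abs_cont_continuous[OF U(1)] U(2) that])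
  then have FF: "abs_cont F (\<lambda>y. of_real (k\<^sup>2) * f y)"
    using abs_cont_cong[OF U(1)] by simp
  define p where "p y = F y + of_real k * f y" for y
  define q where "q y = F y - of_real k * f y" for y
  have p: "abs_cont (\<lambda>y. of_real (exp (- k * y)) * p y) (\<lambda>y. 0)"
    using abs_cont_exp_mult[OF abs_cont_add[OF FF abs_cont_cmult[OF f, of "of_real k"]], of "- k"]
    by (rule abs_cont_cong) (auto simp: p_def power2_eq_square algebra_simps)
  have q: "abs_cont (\<lambda>y. of_real (exp (k * y)) * q y) (\<lambda>y. 0)"
    using abs_cont_exp_mult[OF abs_cont_diff[OF FF abs_cont_cmult[OF f, of "of_real k"]], of k]
    by (rule abs_cont_cong) (auto simp: q_def power2_eq_square algebra_simps)
  have const: "H y = H 0" if "abs_cont H (\<lambda>y. 0)" "y \<in> {-1..0}" for H y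
    using abs_cont_LINT[OF that(1), of 0] abs_cont_LINT[OF that] by simp
  have p0: "of_real (exp (- k * y)) * p y = p 0" and q0: "of_real (exp (k * y)) * q y = q 0" if "y \<in> {-1..0}" for y
    using const[OF p that] const[OF q that] by simp_all
  \<comment> \<open>f 0 = 0 identifies p and q at 0, and F (-1) = 0 makes them opposite at -1.
    Transported along the exponentials, this gives (exp k + exp (- k)) p (-1) = 0.\<close>
  have eq: "p 0 = q 0" "q (-1) = - p (-1)" using bc by (simp_all add: p_def q_def)
  have A: "of_real (exp k) * p (-1) = p 0" and B: "- (of_real (exp (- k)) * p (-1)) = p 0"
    using p0[of "-1"] q0[of "-1"] eq by simp_all
  have "(of_real (exp k) + of_real (exp (- k))) * p (-1) = of_real (exp k) * p (-1) - (- (of_real (exp (- k)) * p (-1)))"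
    by (simp add: distrib_right)
  then have "(of_real (exp k) + of_real (exp (- k))) * p (-1) = 0"
    unfolding A B by simp
  moreover have "complex_of_real (exp k) + of_real (exp (- k)) \<noteq> 0"
    using exp_gt_zero[of k] exp_gt_zero[of "- k"] unfolding of_real_add[symmetric] of_real_eq_0_iff by linarith
  ultimately have "p (-1) = 0" by simp
  then have "p 0 = 0" using A by simp
  then have "p y = 0" "q y = 0" if "y \<in> {-1..0}" for y
    using p0[OF that] q0[OF that] eq by simp_all
  \<comment> \<open>For k = 0 both p and q equal F and carry no information on f; so f is recovered
    as a constant with f 0 = 0 instead of from p - q.\<close>
  then have "F y = 0" if "y \<in> {-1..0}" for y
    using that by (fastforce simp: p_def q_def)
  then have "abs_cont f (\<lambda>y. 0)"
    using abs_cont_cong[OF f, of f "\<lambda>y. 0"] by simp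
  from const[OF this y] bc show ?thesis by simp
qed

lemma test_strip_trig:
  assumes p: "test_interval p"
  shows "test_strip (\<lambda>z. (a * sin (of_int n * fst z) + b * cos (of_int n * fst z)) * p (snd z))" (is "test_strip ?\<psi>")
    and "z \<in> cstrip \<Longrightarrow> laplace\<delta> \<delta> (\<lambda>z. (a * sin (of_int n * fst z) + b * cos (of_int n * fst z)) * p (snd z)) z =
      (a * sin (of_int n * fst z) + b * cos (of_int n * fst z)) * (deriv (deriv p) (snd z) - \<delta> * of_int n ^ 2 * p (snd z))"
proof -
  note s = test_interval_smooth[OF p]
  let ?c = "\<lambda>a b x. a * sin (of_int n * x) + b * cos (of_int n * x :: real)"
  show "test_strip ?\<psi>"
    unfolding test_strip_def
  proof (intro conjI)
    show "smooth ?\<psi>"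
      by (intro smooth_mult smooth_compose_linear[OF bounded_linear_fst smooth_sin_cos] smooth_compose_linear[OF bounded_linear_snd s(1)])
    have "sin (of_int n * (x + 2 * pi)) = sin (of_int n * x)" "cos (of_int n * (x + 2 * pi)) = cos (of_int n * x)" for x
      using cis_of_int_2pi[of n x] by (simp_all add: complex_eq_iff)
    then show "periodic1 ?\<psi>" by (simp add: periodic1_def)
    from p show "\<exists>a' b'. -1 < a' \<and> b' < 0 \<and> (\<forall>x1 x2. x2 \<notin> {a'..b'} \<longrightarrow> ?\<psi> (x1, x2) = 0)"
      unfolding test_interval_def by fastforce
  qed
  assume z: "z \<in> cstrip"
  have c': "(?c a b has_real_derivative ?c (- (b * of_int n)) (a * of_int n) x) (at x)" for a b x
    by (auto intro!: derivative_eq_intros simp: algebra_simps)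
  have pd1: "pd1 (\<lambda>z. ?c a b (fst z) * q (snd z)) = (\<lambda>z. ?c (- (b * of_int n)) (a * of_int n) (fst z) * q (snd z))" for a b and q :: "real \<Rightarrow> real"
  proof
    fix z :: "real \<times> real"
    obtain x y where z: "z = (x, y)" by (cases z)
    have "((\<lambda>t. ?c a b t * q y) has_vector_derivative ?c (- (b * of_int n)) (a * of_int n) x * q y) (at x)"
      using DERIV_cmult_right[OF c'[of a b x], of "q y"] by (simp add: has_real_derivative_iff_has_vector_derivative)
    then show "pd1 (\<lambda>z. ?c a b (fst z) * q (snd z)) z = ?c (- (b * of_int n)) (a * of_int n) (fst z) * q (snd z)"
      unfolding z by (intro pd1_eqI) simp
  qed
  \<comment> \<open>Stated for h that has product form only on [-1, 0], because the first
    application of \<open>pd2\<close> is known only there and has to be differentiated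
    again.\<close>
  have pd2: "pd2 h (x, y) = ?c a b x * deriv q y"
    if "smooth q" "y \<in> {-1..0}" "\<And>t. t \<in> {-1..0} \<Longrightarrow> h (x, t) = ?c a b x * q t" for h x y and q :: "real \<Rightarrow> real"
  proof (rule pd2_eqI[OF _ that(2)])
    have "((\<lambda>t. ?c a b x * q t) has_real_derivative ?c a b x * deriv q y) (at y within {-1..0})"
      by (rule DERIV_cmult[OF has_field_derivative_at_within[OF smooth_has_real_derivative[OF that(1)]]])
    then have "((\<lambda>t. ?c a b x * q t) has_vector_derivative ?c a b x * deriv q y) (at y within {-1..0})"
      by (simp add: has_real_derivative_iff_has_vector_derivative)
    then show "((\<lambda>t. h (x, t)) has_vector_derivative ?c a b x * deriv q y) (at y within {-1..0})"
      by (rule has_vector_derivative_transform[OF that(2) that(3), rotated])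
  qed
  obtain x y where zy: "z = (x, y)" "y \<in> {-1..0}" using z by (auto simp: cstrip_def)
  have A: "pd2 (pd2 ?\<psi>) (x, y) = ?c a b x * deriv (deriv p) y"
    by (rule pd2[OF s(2) zy(2)], rule pd2[OF s(1)]) auto
  have B: "pd1 (pd1 ?\<psi>) (x, y) = - (of_int n ^ 2 * ?c a b x * p y)"
    unfolding pd1 by (simp add: power2_eq_square algebra_simps)
  show "laplace\<delta> \<delta> ?\<psi> z = ?c a b (fst z) * (deriv (deriv p) (snd z) - \<delta> * of_int n ^ 2 * p (snd z))"
    unfolding laplace\<delta>_def zy A B by (simp add: algebra_simps)
qed

lemma C1_closed_strip_lines:
  assumes "C1_closed_strip v" "y \<in> {-1..0}"
  shows "((\<lambda>t. v (x, t)) has_vector_derivative pd2 v (x, y)) (at y within {-1..0})"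
    and "((\<lambda>t. v (t, y)) has_vector_derivative pd1 v (x, y)) (at x)"
proof -
  have "(x, y) \<in> cstrip" using assms(2) by (simp add: cstrip_def)
  then obtain v' where "(v has_derivative v') (at (x, y) within UNIV \<times> {-1..0})"
    using assms(1) unfolding C1_closed_strip_def differentiable_on_def differentiable_def cstrip_def by blast
  note * = has_derivative_lines[OF this UNIV_I assms(2)]
  show "((\<lambda>t. v (x, t)) has_vector_derivative pd2 v (x, y)) (at y within {-1..0})"
    using *(2) pd2_eqI[OF *(2) assms(2)] by simp
  show "((\<lambda>t. v (t, y)) has_vector_derivative pd1 v (x, y)) (at x)"
    using *(1) pd1_eqI[OF *(1)] by simp
qed

lemma C1_closed_strip_continuous: "C1_closed_strip v \<Longrightarrow> continuous_on cstrip v"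
  by (simp add: C1_closed_strip_def differentiable_imp_continuous_on)

text \<open>The data cancel in the difference d. Products of a trigonometric function of x1 and a
  test function of x2 reduce its weak equation to that of a mode with k = sqrt \<delta> |n|.\<close>

lemma bvp_uniqueness:
  assumes \<delta>: "0 < \<delta>" and u: "bvp_solution \<delta> g u" and v: "bvp_solution \<delta> g v" and z: "z \<in> cstrip"
  shows "u z = v z"
proof -
  have Cu: "C1_closed_strip u" and Cv: "C1_closed_strip v" using u v by (auto simp: bvp_solution_def)
  note cu = C1_closed_strip_continuous[OF Cu] and cv = C1_closed_strip_continuous[OF Cv]
  define d where "d z = u z - v z" for z
  define d' where "d' z = pd2 u z - pd2 v z" for z
  have cd: "continuous_on cstrip d" unfolding d_def[abs_def] by (intro continuous_intros cu cv)
  have cd': "continuous_on cstrip d'"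
    unfolding d'_def[abs_def] using Cu Cv by (intro continuous_intros) (auto simp: C1_closed_strip_def)
  have line: "((\<lambda>t. d (x, t)) has_vector_derivative d' (x, y)) (at y within {-1..0})" if "y \<in> {-1..0}" for x y
    unfolding d_def d'_def
    by (intro has_vector_derivative_diff C1_closed_strip_lines(1) Cu Cv that)
  have per: "periodic1 d" using u v by (simp add: bvp_solution_def d_def periodic1_def)
  have zero: "fourier1 d n y = 0" if y: "y \<in> {-1..0}" for n y
  proof (rule mode_uniqueness[where k = "sqrt \<delta> * \<bar>of_int n\<bar>" and F = "fourier1 d' n"])
    show "abs_cont (fourier1 d n) (fourier1 d' n)" by (rule fourier1_deriv2[OF cd cd' line])
    show "continuous_on {-1..0} (fourier1 d' n)" by (rule fourier1_continuous[OF cd'])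
    show "fourier1 d n 0 = 0" "fourier1 d' n (-1) = 0"
      using u v by (simp_all add: bvp_solution_def d_def d'_def fourier1_def)
    show "0 \<le> sqrt \<delta> * \<bar>real_of_int n\<bar>" using \<delta> by simp
    fix p assume p: "test_interval p"
    note s = test_interval_smooth[OF p]
    have k2: "(sqrt \<delta> * \<bar>real_of_int n\<bar>)\<^sup>2 = \<delta> * of_int n ^ 2" using \<delta> by (simp add: power_mult_distrib)
    define P where "P y = deriv (deriv p) y - \<delta> * of_int n ^ 2 * p y" for y
    have cP: "continuous_on S P" for S
      unfolding P_def by (intro continuous_intros smooth_continuous smooth_deriv s)
    have int: "(LINT z:cell|lborel. d z * ((a * sin (of_int n * fst z) + b * cos (of_int n * fst z)) * P (snd z))) = 0" for a b
    proof -
      let ?\<psi> = "\<lambda>z. (a * sin (of_int n * fst z) + b * cos (of_int n * fst z)) * p (snd z)"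
      let ?T = "\<lambda>z. (a * sin (of_int n * fst z) + b * cos (of_int n * fst z)) * P (snd z)"
      have L: "(LINT z:cell|lborel. h z * laplace\<delta> \<delta> ?\<psi> z) = (LINT z:cell|lborel. h z * ?T z)" for h
        using test_strip_trig(2)[OF p] cell_subset_cstrip
        by (intro set_lebesgue_integral_cong cell_sets) (auto simp: P_def subset_eq)
      have "(LINT z:cell|lborel. u z * ?T z) = (LINT z:cell|lborel. v z * ?T z)"
        using u v test_strip_trig(1)[OF p] unfolding L[symmetric] bvp_solution_def by simp
      moreover have "(LINT z:cell|lborel. u z * ?T z - v z * ?T z) = (LINT z:cell|lborel. u z * ?T z) - (LINT z:cell|lborel. v z * ?T z)"
        by (intro set_integral_diff(2) set_integrable_cell_continuous continuous_intros cu cv continuous_on_compose2[OF cP]) auto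
      ultimately show ?thesis by (simp add: d_def left_diff_distrib)
    qed
    \<comment> \<open>Test functions are real, so the exponential is assembled from the cosine (a =
      0, b = 1) and i times minus the sine (a = -1, b = 0).\<close>
    have "(LINT z:cell|lborel. of_real (P (snd z)) * cis (- (of_int n * fst z)) * of_real (d z)) =
        (LINT z:cell|lborel. of_real (d z * ((0 * sin (of_int n * fst z) + 1 * cos (of_int n * fst z)) * P (snd z))) +
          \<i> * of_real (d z * (((-1) * sin (of_int n * fst z) + 0 * cos (of_int n * fst z)) * P (snd z))))"
      by (intro set_lebesgue_integral_cong cell_sets) (auto simp: complex_eq_iff)
    also have "\<dots> = (LINT z:cell|lborel. of_real (d z * ((0 * sin (of_int n * fst z) + 1 * cos (of_int n * fst z)) * P (snd z)))) +
         (LINT z:cell|lborel. \<i> * of_real (d z * (((-1) * sin (of_int n * fst z) + 0 * cos (of_int n * fst z)) * P (snd z))))"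
      by (intro set_integral_add(2) set_integrable_cell_continuous continuous_intros cd continuous_on_compose2[OF cP]) auto
    also have "\<dots> = 0"
      by (simp only: set_integral_mult_right set_integral_complex_of_real int) simp
    finally have "of_real (2 * pi) * (LINT y:{-1..0}|lborel. of_real (P y) * fourier1 d n y) = 0"
      using fourier1_Fubini(3)[OF set_integrable_cell_continuous[OF cd], of "\<lambda>y. of_real (P y)" n] cP
      by (simp add: continuous_intros)
    then have "0 = (LINT y:{-1..0}|lborel. of_real (P y) * fourier1 d n y)" by simp
    also have "\<dots> = (LINT y:{-1..0}|lborel. of_real (deriv (deriv p) y) * fourier1 d n y - of_real (\<delta> * of_int n ^ 2) * (of_real (p y) * fourier1 d n y))"
      by (simp add: P_def algebra_simps)
    also have "\<dots> = (LINT y:{-1..0}|lborel. of_real (deriv (deriv p) y) * fourier1 d n y) - (LINT y:{-1..0}|lborel. of_real (\<delta> * of_int n ^ 2) * (of_real (p y) * fourier1 d n y))"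
      by (intro set_integral_diff(2) borel_integrable_atLeastAtMost' continuous_intros smooth_continuous smooth_deriv s fourier1_continuous cd)
    also have "(LINT y:{-1..0}|lborel. of_real (\<delta> * of_int n ^ 2) * (of_real (p y) * fourier1 d n y)) = of_real (\<delta> * of_int n ^ 2) * (LINT y:{-1..0}|lborel. of_real (p y) * fourier1 d n y)"
      by (rule set_integral_mult_right)
    finally show "(LINT y:{-1..0}|lborel. of_real (deriv (deriv p) y) * fourier1 d n y) =
        of_real ((sqrt \<delta> * \<bar>real_of_int n\<bar>)\<^sup>2) * (LINT y:{-1..0}|lborel. of_real (p y) * fourier1 d n y)"
      unfolding k2 by simp
  qed (fact y)
  have "d z = 0" by (rule fourier1_eq_0_imp[OF cd per zero z])
  then show ?thesis by (simp add: d_def)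
qed

subsection \<open>Existence\<close>

text \<open>The last two clauses are what lets the real Fourier series of \<phi> and D have exactly
  these functions as modes.\<close>

definition mode_family ::
  "real \<Rightarrow> (int \<Rightarrow> real \<Rightarrow> complex) \<Rightarrow> (int \<Rightarrow> real \<Rightarrow> complex) \<Rightarrow> (int \<Rightarrow> real) \<Rightarrow>
    (int \<Rightarrow> real \<Rightarrow> complex) \<Rightarrow> (int \<Rightarrow> real \<Rightarrow> complex) \<Rightarrow> (int \<Rightarrow> real \<Rightarrow> complex) \<Rightarrow> bool" where
  "mode_family \<mu> G1 w2 N \<phi> D d \<longleftrightarrow>
    (\<forall>n. abs_cont (\<phi> n) (D n) \<and> \<phi> n 0 = 0 \<and> D n (-1) = 0 \<and> abs_cont (D n) (d n) \<and>
      (\<forall>y\<in>{-1..0}. d n y = of_real ((\<mu> * of_int n)\<^sup>2) * \<phi> n y + \<i> * of_real (\<mu> * of_int n) * G1 n y + w2 n y) \<and>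
      (LINT y:{-1..0}|lborel. cmod (of_real (\<mu> * of_int n) * D n y)) + (LINT y:{-1..0}|lborel. cmod (d n y)) \<le> 12 * N n \<and>
      (\<forall>y. \<phi> (- n) y = cnj (\<phi> n y)) \<and> (\<forall>y. D (- n) y = cnj (D n y)))"

text \<open>Solutions chosen for n and -n are unrelated, so the family is replaced by its Hermitian
  average. Linearity and the symmetry of the data preserve the equation, and N (- n) = N n preserves
  the bound.\<close>

lemma mode_family_exists:
  fixes \<mu> :: real and G1 w1 w2 :: "int \<Rightarrow> real \<Rightarrow> complex"
  assumes G1: "\<And>n. abs_cont (G1 n) (w1 n)" "\<And>n. G1 n (-1) = 0" and w2: "\<And>n. set_integrable lborel {-1..0} (w2 n)"
    and herm: "\<And>n y. G1 (- n) y = cnj (G1 n y)" "\<And>n y. w1 (- n) y = cnj (w1 n y)" "\<And>n y. w2 (- n) y = cnj (w2 n y)"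
    and N: "\<And>n. N n = (LINT y:{-1..0}|lborel. cmod (w1 n y)) + (LINT y:{-1..0}|lborel. cmod (w2 n y))"
  shows "\<exists>\<phi> D d. mode_family \<mu> G1 w2 N \<phi> D d"
proof -
  have "\<forall>n. \<exists>\<phi> D d. abs_cont \<phi> D \<and> \<phi> 0 = 0 \<and> D (-1) = 0 \<and> abs_cont D d \<and>
     (\<forall>y\<in>{-1..0}. d y = of_real ((\<mu> * of_int n)\<^sup>2) * \<phi> y + \<i> * of_real (\<mu> * of_int n) * G1 n y + w2 n y) \<and>
     (LINT y:{-1..0}|lborel. cmod (of_real (\<mu> * of_int n) * D y)) + (LINT y:{-1..0}|lborel. cmod (d y)) \<le> 12 * N n"
    unfolding N by (intro allI mode_solution G1 w2)
  then obtain \<phi> D d where *: "\<And>n. abs_cont (\<phi> n) (D n)" "\<And>n. \<phi> n 0 = 0" "\<And>n. D n (-1) = 0" "\<And>n. abs_cont (D n) (d n)"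
    "\<And>n y. y \<in> {-1..0} \<Longrightarrow> d n y = of_real ((\<mu> * of_int n)\<^sup>2) * \<phi> n y + \<i> * of_real (\<mu> * of_int n) * G1 n y + w2 n y"
    "\<And>n. (LINT y:{-1..0}|lborel. cmod (of_real (\<mu> * of_int n) * D n y)) + (LINT y:{-1..0}|lborel. cmod (d n y)) \<le> 12 * N n"
    unfolding choice_iff by blast
  show ?thesis
    unfolding mode_family_def
  proof (rule exI[of _ "symm \<phi>"], rule exI[of _ "symm D"], rule exI[of _ "symm d"], intro conjI allI ballI)
    show ac: "abs_cont (symm \<phi> n) (symm D n)" "abs_cont (symm D n) (symm d n)" for n
      by (rule abs_cont_symm *)+
    show "symm \<phi> n 0 = 0" "symm D n (-1) = 0" for n by (simp_all add: symm_def *)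
    show "symm d n y = of_real ((\<mu> * of_int n)\<^sup>2) * symm \<phi> n y + \<i> * of_real (\<mu> * of_int n) * G1 n y + w2 n y" if "y \<in> {-1..0}" for n y
    proof -
      \<comment> \<open>Conjugation turns i into -i and -n restores the sign, so the conjugate of
        equation -n is equation n.\<close>
      have "cnj (d (- n) y) = of_real ((\<mu> * of_int n)\<^sup>2) * cnj (\<phi> (- n) y) + \<i> * of_real (\<mu> * of_int n) * G1 n y + w2 n y"
        using *(5)[OF that, of "- n"] by (simp add: herm)
      then show ?thesis
        unfolding symm_def *(5)[OF that, of n] by (simp only: distrib_left add_divide_distrib) (simp add: field_simps)
    qed
    have Nm: "N (- n) = N n" for n by (simp add: N herm)
    show "(LINT y:{-1..0}|lborel. cmod (of_real (\<mu> * of_int n) * symm D n y)) + (LINT y:{-1..0}|lborel. cmod (symm d n y)) \<le> 12 * N n" for n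
    proof -
      have i: "set_integrable lborel {-1..0} (D n)" "set_integrable lborel {-1..0} (d n)"
        "set_integrable lborel {-1..0} (symm D n)" "set_integrable lborel {-1..0} (symm d n)" for n
        using abs_cont_integrable * ac by blast+
      have "(LINT y:{-1..0}|lborel. cmod (of_real (\<mu> * of_int (- n)) * D (- n) y)) = (LINT y:{-1..0}|lborel. cmod (of_real (\<mu> * of_int n) * D (- n) y))"
        by (simp add: norm_mult)
      then show ?thesis
        using LINT_symm_le[of D n "of_real (\<mu> * of_int n)", OF i(1,3)] LINT_symm_le[of d n 1, OF i(2,4)] *(6)[of n] *(6)[of "- n"] Nm[of n]
        by simp
    qed
    show "symm \<phi> (- n) y = cnj (symm \<phi> n y)" "symm D (- n) y = cnj (symm D n y)" for n y
      by (rule symm_minus)+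
  qed
qed

lemma fourier1_cong:
  assumes "\<And>x. v (x, y) = w (x, y)" shows "fourier1 v n y = fourier1 w n y"
  using assms by (simp add: fourier1_def)

lemma fourier1_cmult: "fourier1 (\<lambda>z. c * v z) n y = of_real c * fourier1 v n y"
proof -
  have "(LINT x:{0..2 * pi}|lborel. complex_of_real (c * v (x, y)) * cis (- (of_int n * x))) =
      (LINT x:{0..2 * pi}|lborel. of_real c * (complex_of_real (v (x, y)) * cis (- (of_int n * x))))"
    by (simp add: mult.assoc)
  then show ?thesis
    by (simp only: fourier1_def set_integral_mult_right) (simp add: mult_scaleR_right)
qed

lemma test_strip_d:
  assumes "test_strip \<psi>"
  shows "smooth \<psi>" "periodic1 \<psi>"
    "y \<notin> {-1<..<0} \<Longrightarrow> \<psi> (x, y) = 0" "y \<notin> {-1<..<0} \<Longrightarrow> d2 \<psi> (x, y) = 0"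
proof -
  show s: "smooth \<psi>" "periodic1 \<psi>" using assms by (auto simp: test_strip_def)
  obtain a b where ab: "-1 < a" "b < 0" "\<And>x y. y \<notin> {a..b} \<Longrightarrow> \<psi> (x, y) = 0"
    using assms by (auto simp: test_strip_def)
  show "\<psi> (x, y) = 0" if "y \<notin> {-1<..<0}" using that ab by auto
  assume y: "y \<notin> {-1<..<0}"
  have "((\<lambda>t. \<psi> (x, t)) has_vector_derivative 0) (at y)"
  proof (rule has_vector_derivative_transform_within_open)
    show "((\<lambda>_. 0) has_vector_derivative 0) (at y)" by simp
    show "open (- {a..b})" "y \<in> - {a..b}" using y ab by auto
  qed (use ab in auto)
  then show "d2 \<psi> (x, y) = 0"
    using smooth_lines(2)[OF s(1), of x y UNIV] vector_derivative_unique_at by blast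
qed

lemma test_strip_laplace:
  assumes "smooth \<psi>" "z \<in> cstrip"
  shows "laplace\<delta> \<delta> \<psi> z = \<delta> * d1 (d1 \<psi>) z + d2 (d2 \<psi>) z"
proof -
  obtain x y where zy: "z = (x, y)" "y \<in> {-1..0}" using assms(2) by (auto simp: cstrip_def)
  have "pd2 (pd2 \<psi>) (x, y) = d2 (d2 \<psi>) (x, y)"
  proof (rule pd2_eqI[OF _ zy(2)])
    show "((\<lambda>t. pd2 \<psi> (x, t)) has_vector_derivative d2 (d2 \<psi>) (x, y)) (at y within {-1..0})"
      by (rule has_vector_derivative_transform[OF zy(2) _ smooth_lines(2)[OF smooth_d2[OF assms(1)]]])
        (simp add: smooth_pd2 assms(1) cstrip_def)
  qed
  then show ?thesis
    by (simp add: laplace\<delta>_def zy smooth_pd1[OF assms(1)] smooth_pd1[OF smooth_d1[OF assms(1)]])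
qed

lemma parseval_smooth:
  assumes v: "set_integrable lborel cell v" and h: "smooth h" "periodic1 h"
  shows "(\<lambda>k. Re (of_real (2 * pi) * (LINT y:{-1..0}|lborel. fourier1 h (int_decode k) y * fourier1 v (- int_decode k) y)))
    sums (LINT z:cell|lborel. v z * h z)"
proof -
  obtain C where "\<And>n y. y \<in> {-1..0} \<Longrightarrow> cmod (fourier1 h n y) \<le> C / (1 + real_of_int n ^ 2)"
    using smooth_fourier1_decay[OF h] by blast
  then show ?thesis
    by (rule parseval[OF v smooth_continuous[OF h(1)] h(2) _ summable_int_decode_quadratic])
qed

text \<open>Two integrations by parts move the derivatives from X2 onto \<phi> and reach d; after
  inserting the equation, one more moves the derivative of G2 back to the test function. At 0 and at
  -1 all boundary terms vanish with X0 and X1.\<close>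

lemma weak_equation_mode:
  fixes X0 X1 X2 :: "real \<Rightarrow> complex"
  assumes X0: "abs_cont X0 X1" "abs_cont X1 X2" "X0 (-1) = 0" "X0 0 = 0" "X1 (-1) = 0" "X1 0 = 0"
    and \<phi>: "abs_cont \<phi> D" "abs_cont D d"
    and eq: "\<And>y. y \<in> {-1..0} \<Longrightarrow> d y = of_real (m\<^sup>2) * \<phi> y + \<i> * of_real m * G1 y + w2 y"
    and G1: "continuous_on {-1..0} G1" and G2: "abs_cont G2 w2"
  shows "(LINT y:{-1..0}|lborel. X2 y * \<phi> y) - of_real (m\<^sup>2) * (LINT y:{-1..0}|lborel. X0 y * \<phi> y) =
    \<i> * of_real m * (LINT y:{-1..0}|lborel. X0 y * G1 y) - (LINT y:{-1..0}|lborel. X1 y * G2 y)"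
proof -
  note cX0 = abs_cont_continuous[OF X0(1)] and c\<phi> = abs_cont_continuous[OF \<phi>(1)]
  have "(LINT y:{-1..0}|lborel. X2 y * \<phi> y) = - (LINT y:{-1..0}|lborel. X1 y * D y)"
    by (rule abs_cont_integral_by_parts[OF X0(2) \<phi>(1)]) (simp_all add: X0)
  also have "(LINT y:{-1..0}|lborel. X1 y * D y) = - (LINT y:{-1..0}|lborel. X0 y * d y)"
    by (rule abs_cont_integral_by_parts[OF X0(1) \<phi>(2)]) (simp_all add: X0)
  also have "(LINT y:{-1..0}|lborel. X0 y * d y) = (LINT y:{-1..0}|lborel. (of_real (m\<^sup>2) * (X0 y * \<phi> y) + \<i> * of_real m * (X0 y * G1 y)) + X0 y * w2 y)"
    by (intro set_lebesgue_integral_cong) (auto simp: eq algebra_simps)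
  also have "\<dots> = (LINT y:{-1..0}|lborel. of_real (m\<^sup>2) * (X0 y * \<phi> y) + \<i> * of_real m * (X0 y * G1 y)) + (LINT y:{-1..0}|lborel. X0 y * w2 y)"
    by (intro set_integral_add(2) set_integrable_cmult_continuous abs_cont_integrable[OF G2] cX0
        borel_integrable_atLeastAtMost' continuous_intros c\<phi> G1)
  also have "(LINT y:{-1..0}|lborel. of_real (m\<^sup>2) * (X0 y * \<phi> y) + \<i> * of_real m * (X0 y * G1 y)) =
     (LINT y:{-1..0}|lborel. of_real (m\<^sup>2) * (X0 y * \<phi> y)) + (LINT y:{-1..0}|lborel. \<i> * of_real m * (X0 y * G1 y))"
    by (intro set_integral_add(2) borel_integrable_atLeastAtMost' continuous_intros cX0 c\<phi> G1)
  also have "(LINT y:{-1..0}|lborel. X0 y * w2 y) = - (LINT y:{-1..0}|lborel. X1 y * G2 y)"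
    using abs_cont_integral_by_parts[OF X0(1) G2] by (simp add: X0)
  finally show ?thesis by (simp only: set_integral_mult_right) simp
qed

lemma bvp_existence:
  assumes \<delta>: "0 < \<delta>" and lam: "0 \<le> lam" and s: "0 \<le> s" and g: "g \<in> ws_space_vec s 1 lam"
  obtains \<phi> where "bvp_solution \<delta> g \<phi>"
    "\<And>n. deriv_L1 1 (fourier1 (fst \<circ> grad\<delta> \<delta> \<phi>) n) + deriv_L1 1 (fourier1 (snd \<circ> grad\<delta> \<delta> \<phi>) n)
      \<le> 12 * (deriv_L1 1 (fourier1 (fst \<circ> g) n) + deriv_L1 1 (fourier1 (snd \<circ> g) n))"
proof -
  have g1: "fst \<circ> g \<in> ws_space s 1 lam" and g2: "snd \<circ> g \<in> ws_space s 1 lam"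
    using g by (auto simp: ws_space_vec_def)
  have g1i: "set_integrable lborel cell (fst \<circ> g)" and g2i: "set_integrable lborel cell (snd \<circ> g)"
    using g1 g2 by (auto simp: ws_space_def)
  obtain w1 G1 where G1: "\<And>n. abs_cont (G1 n) (w1 n)" "\<And>n. G1 n (-1) = 0"
    "\<And>n. AE y in lborel. y \<in> {-1..0} \<longrightarrow> fourier1 (fst \<circ> g) n y = G1 n y"
    "\<And>n. deriv_L1 1 (fourier1 (fst \<circ> g) n) = ennreal (LINT y:{-1..0}|lborel. cmod (w1 n y))"
    "summable (\<lambda>k. LINT y:{-1..0}|lborel. cmod (w1 (int_decode k) y))"
    "\<And>n y. w1 (- n) y = cnj (w1 n y)" "\<And>n y. G1 (- n) y = cnj (G1 n y)"
    using ws_space_modes[OF g1 s lam] by blast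
  obtain w2 G2 where G2: "\<And>n. abs_cont (G2 n) (w2 n)" "\<And>n. G2 n (-1) = 0"
    "\<And>n. AE y in lborel. y \<in> {-1..0} \<longrightarrow> fourier1 (snd \<circ> g) n y = G2 n y"
    "\<And>n. deriv_L1 1 (fourier1 (snd \<circ> g) n) = ennreal (LINT y:{-1..0}|lborel. cmod (w2 n y))"
    "summable (\<lambda>k. LINT y:{-1..0}|lborel. cmod (w2 (int_decode k) y))"
    "\<And>n y. w2 (- n) y = cnj (w2 n y)" "\<And>n y. G2 (- n) y = cnj (G2 n y)"
    using ws_space_modes[OF g2 s lam] by blast
  define N where "N n = (LINT y:{-1..0}|lborel. cmod (w1 n y)) + (LINT y:{-1..0}|lborel. cmod (w2 n y))" for n
  have sN: "summable (\<lambda>k. c * N (int_decode k))" for c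
    unfolding N_def by (intro summable_mult summable_add G1(5) G2(5))
  define \<mu> where "\<mu> = sqrt \<delta>"
  have \<mu>: "\<mu> > 0" "\<mu> * \<mu> = \<delta>" using \<delta> by (auto simp: \<mu>_def)
  have "\<exists>\<phi> D d. mode_family \<mu> G1 w2 N \<phi> D d"
    by (rule mode_family_exists[where ?w1.0 = w1])
      (rule G1 abs_cont_integrable[OF G2(1)] G2(6) N_def)+
  then obtain \<phi> D d where fam: "mode_family \<mu> G1 w2 N \<phi> D d" by blast
  have \<phi>: "\<And>n. abs_cont (\<phi> n) (D n)" "\<And>n. \<phi> n 0 = 0" "\<And>n. D n (-1) = 0" "\<And>n. abs_cont (D n) (d n)"
    and eq: "\<And>n y. y \<in> {-1..0} \<Longrightarrow> d n y = of_real ((\<mu> * of_int n)\<^sup>2) * \<phi> n y + \<i> * of_real (\<mu> * of_int n) * G1 n y + w2 n y"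
    and est: "\<And>n. (LINT y:{-1..0}|lborel. cmod (of_real (\<mu> * of_int n) * D n y)) + (LINT y:{-1..0}|lborel. cmod (d n y)) \<le> 12 * N n"
    and herm: "\<And>n y. \<phi> (- n) y = cnj (\<phi> n y)" "\<And>n y. D (- n) y = cnj (D n y)"
    using fam unfolding mode_family_def by blast+
  \<comment> \<open>D n (-1) = 0 turns the L^1 bound on d into a uniform one; \<phi> n 0 = 0 does
    the same for m \<phi> and for \<phi> below. These give the summable majorants for the series of
    \<phi> and its two partial derivatives.\<close>
  have bD: "cmod (D n y) \<le> 12 * N n" if "y \<in> {-1..0}" for n y
  proof -
    have "cmod (D n y) \<le> (LINT y:{-1..0}|lborel. cmod (d n y))"
      using abs_cont_norm_le[OF \<phi>(4), of y "-1" n] that \<phi>(3) by simp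
    then show ?thesis using est[of n] set_integral_norm_nonneg[of lborel "{-1..0}" "\<lambda>y. of_real (\<mu> * of_int n) * D n y"] by linarith
  qed
  \<comment> \<open>The factor 1 / \<mu> degenerates as \<delta> tends to 0, but this bound serves
    only convergence for fixed \<delta>; the final estimate contains the combination \<mu> n D
    alone.\<close>
  have b1: "cmod (\<i> * of_int n * \<phi> n y) \<le> 12 / \<mu> * N n" if "y \<in> {-1..0}" for n y
  proof -
    have "cmod (of_real (\<mu> * of_int n) * \<phi> n y) \<le> (LINT y:{-1..0}|lborel. cmod (of_real (\<mu> * of_int n) * D n y))"
      using abs_cont_norm_le[OF abs_cont_cmult[OF \<phi>(1)], of y 0 "of_real (\<mu> * of_int n)" n] that \<phi>(2) by simp
    then have "cmod (of_real (\<mu> * of_int n) * \<phi> n y) \<le> 12 * N n"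
      using est[of n] set_integral_norm_nonneg[of lborel "{-1..0}" "d n"] by linarith
    moreover have "cmod (of_real (\<mu> * of_int n) * \<phi> n y) = \<mu> * cmod (\<i> * of_int n * \<phi> n y)"
      using \<mu>(1) by (simp add: norm_mult abs_mult)
    ultimately have "\<mu> * cmod (\<i> * of_int n * \<phi> n y) \<le> 12 * N n" by simp
    then show ?thesis using \<mu>(1) by (simp add: field_simps)
  qed
  have b0: "cmod (\<phi> n y) \<le> 12 * N n" if "y \<in> {-1..0}" for n y
  proof -
    have "cmod (\<phi> n y) \<le> (LINT y:{-1..0}|lborel. cmod (D n y))"
      using abs_cont_norm_le[OF \<phi>(1), of y 0 n] that \<phi>(2) by simp
    also have "\<dots> \<le> (LINT y::real:{-1..0}|lborel. 12 * N n)"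
      by (intro set_integral_mono bD set_integrable_norm abs_cont_integrable[OF \<phi>(1)] borel_integrable_atLeastAtMost' continuous_on_const)
    also have "\<dots> = 12 * N n" by (simp add: set_integral_const)
    finally show ?thesis .
  qed
  have c\<phi>: "continuous_on {-1..0} (\<phi> n)" and cD: "continuous_on {-1..0} (D n)" for n
    using abs_cont_continuous \<phi> by blast+
  interpret F0: fourier_coefficients \<phi> "\<lambda>n. 12 * N n"
    by unfold_locales (rule c\<phi> b0 sN, assumption?)+
  interpret F1: fourier_coefficients "\<lambda>n y. \<i> * of_int n * \<phi> n y" "\<lambda>n. 12 / \<mu> * N n"
    by unfold_locales (intro continuous_intros c\<phi>, rule b1, assumption, rule sN)
  interpret F2: fourier_coefficients D "\<lambda>n. 12 * N n"
    by unfold_locales (rule cD bD sN, assumption?)+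
  define \<Phi> where "\<Phi> = fourier_series \<phi>"
  define \<Phi>1 where "\<Phi>1 = fourier_series (\<lambda>n y. \<i> * of_int n * \<phi> n y)"
  define \<Phi>2 where "\<Phi>2 = fourier_series D"
  have deriv: "(\<Phi> has_derivative (\<lambda>h. fst h * \<Phi>1 z + snd h * \<Phi>2 z)) (at z within cstrip)" if "z \<in> cstrip" for z
    unfolding \<Phi>_def \<Phi>1_def \<Phi>2_def
    by (rule fourier_series_has_derivative[OF F0.fourier_coefficients_axioms F1.fourier_coefficients_axioms F2.fourier_coefficients_axioms \<phi>(1) that])
  have pd: "pd1 \<Phi> (x, y) = \<Phi>1 (x, y)" "pd2 \<Phi> (x, y) = \<Phi>2 (x, y)" if "y \<in> {-1..0}" for x y
    using has_derivative_lines[of \<Phi> _ x y UNIV "{-1..0}", OF deriv[of "(x, y)", unfolded cstrip_def] UNIV_I that] that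
    by (auto intro!: pd1_eqI pd2_eqI)
  have cont1: "continuous_on cstrip (pd1 \<Phi>)"
    by (rule continuous_on_eq[OF F1.fourier_series_continuous]) (auto simp: cstrip_def pd \<Phi>1_def)
  have cont2: "continuous_on cstrip (pd2 \<Phi>)"
    by (rule continuous_on_eq[OF F2.fourier_series_continuous]) (auto simp: cstrip_def pd \<Phi>2_def)
  have C1: "C1_closed_strip \<Phi>"
    unfolding C1_closed_strip_def differentiable_on_def differentiable_def using deriv cont1 cont2 by blast
  have f0: "fourier1 \<Phi> n y = \<phi> n y" if "y \<in> {-1..0}" for n y
    unfolding \<Phi>_def by (rule F0.fourier1_fourier_series[OF that herm(1)])
  have f1: "fourier1 (pd1 \<Phi>) n y = \<i> * of_int n * \<phi> n y" if "y \<in> {-1..0}" for n y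
  proof -
    have "fourier1 (pd1 \<Phi>) n y = fourier1 \<Phi>1 n y" by (rule fourier1_cong) (rule pd(1)[OF that])
    also have "\<dots> = \<i> * of_int n * \<phi> n y"
      unfolding \<Phi>1_def by (rule F1.fourier1_fourier_series[OF that]) (simp add: herm)
    finally show ?thesis .
  qed
  have f2: "fourier1 (pd2 \<Phi>) n y = D n y" if "y \<in> {-1..0}" for n y
  proof -
    have "fourier1 (pd2 \<Phi>) n y = fourier1 \<Phi>2 n y" by (rule fourier1_cong) (rule pd(2)[OF that])
    also have "\<dots> = D n y"
      unfolding \<Phi>2_def by (rule F2.fourier1_fourier_series[OF that herm(2)])
    finally show ?thesis .
  qed
  have c0: "continuous_on cstrip \<Phi>" using C1 by (rule C1_closed_strip_continuous)
  have "bvp_solution \<delta> g \<Phi>"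
    unfolding bvp_solution_def
  proof (intro conjI allI impI)
    show "periodic1 \<Phi>" unfolding \<Phi>_def by (rule periodic1_fourier_series)
    show "C1_closed_strip \<Phi>" by fact
    show "\<Phi> (x, 0) = 0" for x by (simp add: \<Phi>_def fourier_series_def \<phi>(2))
    show "pd2 \<Phi> (x, -1) = 0" for x by (simp add: pd \<Phi>2_def fourier_series_def \<phi>(3))
    fix \<psi> assume \<psi>: "test_strip \<psi>"
    note ts = test_strip_d[OF \<psi>]
    note sm = ts(1) smooth_d1[OF ts(1)] smooth_d2[OF ts(1)] smooth_d1[OF smooth_d1[OF ts(1)]] smooth_d2[OF smooth_d2[OF ts(1)]]
    note per = periodic1_d1[OF ts(1,2)] periodic1_d2[OF ts(1,2)] periodic1_d1[OF smooth_d1[OF ts(1)] periodic1_d1[OF ts(1,2)]]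
      periodic1_d2[OF smooth_d2[OF ts(1)] periodic1_d2[OF ts(1,2)]]
    have \<Phi>i: "set_integrable lborel cell \<Phi>" by (rule set_integrable_cell_continuous[OF c0])
    define S where "S v h n = of_real (2 * pi) * (LINT y:{-1..0}|lborel. fourier1 h n y * fourier1 v (- n) y)" for v h n
    have sums: "(\<lambda>k. Re (S v h (int_decode k))) sums (LINT z:cell|lborel. v z * h z)"
      if "set_integrable lborel cell v" "smooth h" "periodic1 h" for v h
      unfolding S_def by (rule parseval_smooth[OF that])
    \<comment> \<open>The weak equation for a single frequency: mode n of the test function meets
      mode -n of the solution and of the data, whence the equation of index -n. Parseval then sums
      these identities to the equation on the strip.\<close>
    have key: "of_real \<delta> * S \<Phi> (d1 (d1 \<psi>)) n + S \<Phi> (d2 (d2 \<psi>)) n =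
        - (of_real \<mu> * S (fst \<circ> g) (d1 \<psi>) n + S (snd \<circ> g) (d2 \<psi>) n)" for n
    proof -
      let ?X = "fourier1 \<psi> n" and ?X1 = "fourier1 (d2 \<psi>) n" and ?X2 = "fourier1 (d2 (d2 \<psi>)) n"
      have X: "abs_cont ?X ?X1" "abs_cont ?X1 ?X2"
        by (rule smooth_fourier1_d2[OF sm(1)] smooth_fourier1_d2[OF sm(3)])+
      have bc: "?X (-1) = 0" "?X 0 = 0" "?X1 (-1) = 0" "?X1 0 = 0"
        using ts(3,4) by (simp_all add: fourier1_def)
      have G1c: "continuous_on {-1..0} (G1 n)" and G2c: "continuous_on {-1..0} (G2 n)" for n
        using abs_cont_continuous G1(1) G2(1) by blast+
      have mode: "(LINT y:{-1..0}|lborel. ?X2 y * \<phi> (- n) y) - of_real ((\<mu> * of_int (- n))\<^sup>2) * (LINT y:{-1..0}|lborel. ?X y * \<phi> (- n) y) =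
          \<i> * of_real (\<mu> * of_int (- n)) * (LINT y:{-1..0}|lborel. ?X y * G1 (- n) y) - (LINT y:{-1..0}|lborel. ?X1 y * G2 (- n) y)"
        by (rule weak_equation_mode[OF X bc \<phi>(1) \<phi>(4) eq G1c G2(1)])
      have e1: "fourier1 (d1 \<psi>) n y = \<i> * of_int n * ?X y" if "y \<in> {-1..0}" for y
        by (rule smooth_fourier1_d1[OF ts(1,2) that])
      have e11: "fourier1 (d1 (d1 \<psi>)) n y = - (of_int n)\<^sup>2 * ?X y" if "y \<in> {-1..0}" for y
        by (simp add: smooth_fourier1_d1[OF sm(2) per(1) that] e1[OF that] power2_eq_square mult.assoc[symmetric]) (simp add: mult_ac)
      have S11: "S \<Phi> (d1 (d1 \<psi>)) n = of_real (2 * pi) * (- (of_int n)\<^sup>2 * (LINT y:{-1..0}|lborel. ?X y * \<phi> (- n) y))"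
      proof -
        have "(LINT y:{-1..0}|lborel. fourier1 (d1 (d1 \<psi>)) n y * fourier1 \<Phi> (- n) y) = (LINT y:{-1..0}|lborel. - (of_int n)\<^sup>2 * (?X y * \<phi> (- n) y))"
          by (intro set_lebesgue_integral_cong) (auto simp: e11 f0)
        then show ?thesis unfolding S_def by (simp only: set_integral_mult_right)
      qed
      have S22: "S \<Phi> (d2 (d2 \<psi>)) n = of_real (2 * pi) * (LINT y:{-1..0}|lborel. ?X2 y * \<phi> (- n) y)"
      proof -
        have "(LINT y:{-1..0}|lborel. ?X2 y * fourier1 \<Phi> (- n) y) = (LINT y:{-1..0}|lborel. ?X2 y * \<phi> (- n) y)"
          by (intro set_lebesgue_integral_cong) (auto simp: f0)
        then show ?thesis unfolding S_def by simp
      qed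
      have S1: "S (fst \<circ> g) (d1 \<psi>) n = of_real (2 * pi) * (\<i> * of_int n * (LINT y:{-1..0}|lborel. ?X y * G1 (- n) y))"
      proof -
        have "(LINT y:{-1..0}|lborel. fourier1 (d1 \<psi>) n y * fourier1 (fst \<circ> g) (- n) y) =
            (LINT y:{-1..0}|lborel. fourier1 (d1 \<psi>) n y * G1 (- n) y)"
          by (intro LINT_mult_cong_AE G1(3) fourier1_integrable g1i borel_integrable_atLeastAtMost' G1c fourier1_continuous smooth_continuous sm)
        also have "\<dots> = (LINT y:{-1..0}|lborel. \<i> * of_int n * (?X y * G1 (- n) y))"
          by (intro set_lebesgue_integral_cong) (auto simp: e1)
        finally show ?thesis unfolding S_def by (simp only: set_integral_mult_right)
      qed
      have S2: "S (snd \<circ> g) (d2 \<psi>) n = of_real (2 * pi) * (LINT y:{-1..0}|lborel. ?X1 y * G2 (- n) y)"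
      proof -
        have "(LINT y:{-1..0}|lborel. ?X1 y * fourier1 (snd \<circ> g) (- n) y) = (LINT y:{-1..0}|lborel. ?X1 y * G2 (- n) y)"
          by (intro LINT_mult_cong_AE G2(3) fourier1_integrable g2i borel_integrable_atLeastAtMost' G2c fourier1_continuous smooth_continuous sm)
        then show ?thesis unfolding S_def by simp
      qed
      have \<mu>2: "complex_of_real ((\<mu> * of_int (- n))\<^sup>2) = of_real \<delta> * (of_int n)\<^sup>2"
        by (simp add: power2_eq_square \<mu>(2)[symmetric])
      show ?thesis
        using arg_cong[OF mode, of "\<lambda>x. of_real (2 * pi) * x"] unfolding S11 S22 S1 S2 \<mu>2
        by (simp add: algebra_simps)
    qed
    have "(\<lambda>k. \<delta> * Re (S \<Phi> (d1 (d1 \<psi>)) (int_decode k)) + Re (S \<Phi> (d2 (d2 \<psi>)) (int_decode k))) sums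
        (\<delta> * (LINT z:cell|lborel. \<Phi> z * d1 (d1 \<psi>) z) + (LINT z:cell|lborel. \<Phi> z * d2 (d2 \<psi>) z))"
      by (intro sums_add sums_mult sums \<Phi>i sm per)
    moreover have "(\<lambda>k. - (\<mu> * Re (S (fst \<circ> g) (d1 \<psi>) (int_decode k)) + Re (S (snd \<circ> g) (d2 \<psi>) (int_decode k)))) sums
        (- (\<mu> * (LINT z:cell|lborel. (fst \<circ> g) z * d1 \<psi> z) + (LINT z:cell|lborel. (snd \<circ> g) z * d2 \<psi> z)))"
      by (intro sums_minus sums_add sums_mult sums g1i g2i sm per)
    moreover have "\<delta> * Re (S \<Phi> (d1 (d1 \<psi>)) n) + Re (S \<Phi> (d2 (d2 \<psi>)) n) = - (\<mu> * Re (S (fst \<circ> g) (d1 \<psi>) n) + Re (S (snd \<circ> g) (d2 \<psi>) n))" for n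
      using arg_cong[OF key[of n], of Re] by simp
    ultimately have main: "\<delta> * (LINT z:cell|lborel. \<Phi> z * d1 (d1 \<psi>) z) + (LINT z:cell|lborel. \<Phi> z * d2 (d2 \<psi>) z) =
        - (\<mu> * (LINT z:cell|lborel. (fst \<circ> g) z * d1 \<psi> z) + (LINT z:cell|lborel. (snd \<circ> g) z * d2 \<psi> z))"
      using sums_unique2 by simp
    have "(LINT z:cell|lborel. \<Phi> z * laplace\<delta> \<delta> \<psi> z) = (LINT z:cell|lborel. \<delta> * (\<Phi> z * d1 (d1 \<psi>) z) + \<Phi> z * d2 (d2 \<psi>) z)"
      using cell_subset_cstrip
      by (intro set_lebesgue_integral_cong cell_sets) (auto simp: test_strip_laplace[OF ts(1)] algebra_simps subset_eq)
    also have "\<dots> = (LINT z:cell|lborel. \<delta> * (\<Phi> z * d1 (d1 \<psi>) z)) + (LINT z:cell|lborel. \<Phi> z * d2 (d2 \<psi>) z)"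
      by (intro set_integral_add(2) set_integrable_cell_continuous continuous_intros c0 smooth_continuous sm)
    also have "\<dots> = \<delta> * (LINT z:cell|lborel. \<Phi> z * d1 (d1 \<psi>) z) + (LINT z:cell|lborel. \<Phi> z * d2 (d2 \<psi>) z)"
      by (simp only: set_integral_mult_right)
    also note main
    also have "\<mu> * (LINT z:cell|lborel. (fst \<circ> g) z * d1 \<psi> z) + (LINT z:cell|lborel. (snd \<circ> g) z * d2 \<psi> z) = (LINT z:cell|lborel. g z \<bullet> grad\<delta> \<delta> \<psi> z)"
    proof -
      have gi: "set_integrable lborel cell (\<lambda>z. v z * h z)" if "set_integrable lborel cell v" "smooth h" for v h :: "real \<times> real \<Rightarrow> real"
      proof -
        have "set_integrable lborel cell (\<lambda>z. complex_of_real (v z))"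
          using integrable_of_real[OF that(1)[unfolded set_integrable_def], where 'a = complex]
          by (simp add: set_integrable_def scaleR_conv_of_real)
        then have "set_integrable lborel cell (\<lambda>z. complex_of_real (h z) * complex_of_real (v z))"
          by (rule set_integrable_cell_mult_continuous) (intro continuous_intros smooth_continuous that)
        then have "integrable lborel (\<lambda>z. Re (indicator cell z *\<^sub>R (complex_of_real (h z) * complex_of_real (v z))))"
          unfolding set_integrable_def by (rule integrable_Re)
        then show ?thesis by (simp add: set_integrable_def mult_ac)
      qed
      have "(LINT z:cell|lborel. g z \<bullet> grad\<delta> \<delta> \<psi> z) = (LINT z:cell|lborel. \<mu> * ((fst \<circ> g) z * d1 \<psi> z) + (snd \<circ> g) z * d2 \<psi> z)"
        using cell_subset_cstrip
        by (intro set_lebesgue_integral_cong cell_sets)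
          (auto simp: grad\<delta>_def inner_prod_def \<mu>_def smooth_pd1[OF ts(1)] smooth_pd2[OF ts(1)] subset_eq)
      also have "\<dots> = (LINT z:cell|lborel. \<mu> * ((fst \<circ> g) z * d1 \<psi> z)) + (LINT z:cell|lborel. (snd \<circ> g) z * d2 \<psi> z)"
        by (intro set_integral_add(2) set_integrable_mult_right gi g1i g2i sm)
      finally show ?thesis by (simp only: set_integral_mult_right)
    qed
    finally show "(LINT z:cell|lborel. \<Phi> z * laplace\<delta> \<delta> \<psi> z) = - (LINT z:cell|lborel. g z \<bullet> grad\<delta> \<delta> \<psi> z)" .
  qed
  moreover have "deriv_L1 1 (fourier1 (fst \<circ> grad\<delta> \<delta> \<Phi>) n) + deriv_L1 1 (fourier1 (snd \<circ> grad\<delta> \<delta> \<Phi>) n)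
      \<le> 12 * (deriv_L1 1 (fourier1 (fst \<circ> g) n) + deriv_L1 1 (fourier1 (snd \<circ> g) n))" for n
  proof -
    \<comment> \<open>Mode n of the first gradient component is i \<mu> n \<phi> n, with derivative
      i \<mu> n D n; that of the second is D n, with derivative d n. Their L^1 norms are the two
      terms of \<open>est\<close>.\<close>
    have "abs_cont (fourier1 (fst \<circ> grad\<delta> \<delta> \<Phi>) n) (\<lambda>y. \<i> * of_real (\<mu> * of_int n) * D n y)"
    proof (rule abs_cont_cong[OF abs_cont_cmult[OF \<phi>(1)]])
      show "\<i> * of_real (\<mu> * of_int n) * \<phi> n y = fourier1 (fst \<circ> grad\<delta> \<delta> \<Phi>) n y" if "y \<in> {-1..0}" for y
        using f1[OF that, of n] by (simp add: grad\<delta>_def o_def fourier1_cmult \<mu>_def mult_ac)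
    qed simp
    then have 1: "deriv_L1 1 (fourier1 (fst \<circ> grad\<delta> \<delta> \<Phi>) n) = ennreal (LINT y:{-1..0}|lborel. cmod (of_real (\<mu> * of_int n) * D n y))"
      using deriv_L1_eq[OF abs_cont_imp_weak_deriv] by (simp add: norm_mult)
    have "abs_cont (fourier1 (snd \<circ> grad\<delta> \<delta> \<Phi>) n) (d n)"
      by (rule abs_cont_cong[OF \<phi>(4)]) (use f2 in \<open>auto simp: grad\<delta>_def o_def\<close>)
    then have 2: "deriv_L1 1 (fourier1 (snd \<circ> grad\<delta> \<delta> \<Phi>) n) = ennreal (LINT y:{-1..0}|lborel. cmod (d n y))"
      by (rule deriv_L1_eq[OF abs_cont_imp_weak_deriv])
    have "ennreal ((LINT y:{-1..0}|lborel. cmod (of_real (\<mu> * of_int n) * D n y)) + (LINT y:{-1..0}|lborel. cmod (d n y))) \<le> ennreal (12 * N n)"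
      by (rule ennreal_leI[OF est])
    also have "ennreal (12 * N n) = 12 * ennreal (N n)"
      by (simp add: ennreal_mult')
    also have "ennreal (N n) = (ennreal (LINT y:{-1..0}|lborel. cmod (w1 n y)) + ennreal (LINT y:{-1..0}|lborel. cmod (w2 n y)))"
      unfolding N_def by (intro ennreal_plus set_integral_norm_nonneg)
    finally show ?thesis
      unfolding 1 2 G1(4) G2(4) by (simp add: ennreal_plus[OF set_integral_norm_nonneg set_integral_norm_nonneg])
  qed
  ultimately show ?thesis by (rule that)
qed

text \<open>Each weight multiplies both sides of the mode inequality, so one constant serves all s
  and lam. Writing norms as suprema of finite sums of extended nonnegative numbers covers infinite
  norms too.\<close>

lemma ws_norm_vec_le_of_modes:
  assumes "\<And>n. deriv_L1 k (fourier1 (fst \<circ> V) n) + deriv_L1 k (fourier1 (snd \<circ> V) n)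
      \<le> c * (deriv_L1 k (fourier1 (fst \<circ> W) n) + deriv_L1 k (fourier1 (snd \<circ> W) n))"
  shows "ws_norm_vec s k lam V \<le> c * ws_norm_vec s k lam W"
proof -
  define a where "a n = ennreal ((1 + real_of_int \<bar>n\<bar>) powr s * exp (lam * real_of_int \<bar>n\<bar>))" for n :: int
  define L where "L V n = deriv_L1 k (fourier1 (fst \<circ> V) n) + deriv_L1 k (fourier1 (snd \<circ> V) n)" for V n
  have eq: "ws_norm_vec s k lam V = (SUP F\<in>{F. finite F \<and> F \<subseteq> UNIV}. \<Sum>n\<in>F. a n * L V n)" for V
  proof -
    have "ws_norm_vec s k lam V = (\<Sum>\<^sub>\<infinity>n. a n * L V n)"
      unfolding ws_norm_vec_def ws_norm_def a_def L_def distrib_left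
      by (rule infsum_add[symmetric]; rule nonneg_summable_on_complete; simp)
    then show ?thesis by (simp add: nonneg_infsum_complete)
  qed
  have "(\<Sum>n\<in>F. a n * L V n) \<le> c * (\<Sum>n\<in>F. a n * L W n)" for F
  proof -
    have "(\<Sum>n\<in>F. a n * L V n) \<le> (\<Sum>n\<in>F. a n * (c * L W n))"
      unfolding L_def by (intro sum_mono mult_left_mono assms) simp
    then show ?thesis by (simp add: sum_distrib_left mult_ac)
  qed
  then show ?thesis
    unfolding eq by (subst SUP_mult_left_ennreal) (rule SUP_mono, blast)
qed

theorem theorem3p1:
  fixes \<delta> s\<^sub>0 lam :: real
    and g :: "real \<times> real \<Rightarrow> real \<times> real"
  assumes "0 < \<delta>" and "\<delta> \<le> 1"
    and "1 \<le> s\<^sub>0" and "0 \<le> lam"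
    and "g \<in> ws_space_vec s\<^sub>0 1 lam"
  shows "\<exists>\<phi>. bvp_solution \<delta> g \<phi> \<and>
             (\<forall>\<phi>'. bvp_solution \<delta> g \<phi>' \<longrightarrow> (\<forall>x\<in>cstrip. \<phi>' x = \<phi> x)) \<and>
             (\<forall>s\<ge>0. ws_norm_vec s 1 lam (grad\<delta> \<delta> \<phi>) \<le> 13 * ws_norm_vec s 1 lam g)"
proof -
  obtain \<phi> where \<phi>: "bvp_solution \<delta> g \<phi>"
    and est: "\<And>n. deriv_L1 1 (fourier1 (fst \<circ> grad\<delta> \<delta> \<phi>) n) + deriv_L1 1 (fourier1 (snd \<circ> grad\<delta> \<delta> \<phi>) n)
      \<le> 12 * (deriv_L1 1 (fourier1 (fst \<circ> g) n) + deriv_L1 1 (fourier1 (snd \<circ> g) n))"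
    using bvp_existence[OF assms(1,4) _ assms(5)] assms(3) by auto
  have "ws_norm_vec s 1 lam (grad\<delta> \<delta> \<phi>) \<le> 13 * ws_norm_vec s 1 lam g" for s
  proof -
    \<comment> \<open>The mode estimate yields 12, slightly better than the required 13.\<close>
    have "ws_norm_vec s 1 lam (grad\<delta> \<delta> \<phi>) \<le> 12 * ws_norm_vec s 1 lam g"
      by (rule ws_norm_vec_le_of_modes[OF est])
    also have "\<dots> \<le> 13 * ws_norm_vec s 1 lam g"
      by (rule mult_right_mono) simp_all
    finally show ?thesis .
  qed
  with \<phi> bvp_uniqueness[OF assms(1) _ \<phi>] show ?thesis by blast
qed

end
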